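(* Let $1<p<\infty$, $1<\tau_2<\tau_1<\infty$, $0<\theta_1,\theta_2\le\infty$, and let $b_j^{(i)}>-\frac1{\theta_i}$ for $j=1,\dots,m$, $\overline b^{(i)}=(b_1^{(i)},\dots,b_m^{(i)})$, $i=1,2$. 1. If $0<\theta_2<\theta_1\le\infty$, then the embedding $S^{0,\overline b^{(1)}}_{p,\tau_1,\theta_1}B\subset S^{0,\overline b^{(2)}}_{p,\tau_2,\theta_2}B$ is valid if and only if $$\Biggl(\sum_{s_m=1}^\infty\cdots\sum_{s_1=1}^\infty\prod_{j=1}^m s_j^{(b_j^{(2)}-b_j^{(1)})\theta_2\eta'}\Bigl(\sum_{j=1}^m(s_j+1)\Bigr)^{(\frac1{\tau_2}-\frac1{\tau_1})\theta_2\eta'}\Biggr)^{\frac1{\theta_2\eta'}}<\infty,$$ where $\eta=\frac{\theta_1}{\theta_2}$, $\frac1\eta+\frac1{\eta'}=1$ (so $\eta'=1$ if $\theta_1=\infty$). 2. If $0<\theta_1\le\theta_2\le\infty$, then the embedding $S^{0,\overline b^{(1)}}_{p,\tau_1,\theta_1}B\subset S^{0,\overline b^{(2)}}_{p,\tau_2,\theta_2}B$ is valid if $$\sup_{\overline s\in\mathbb{Z}_+^m}\prod_{j=1}^m(s_j+1)^{b_j^{(2)}-b_j^{(1)}}\Bigl(\sum_{j=1}^m(s_j+1)\Bigr)^{\frac1{\tau_2}-\frac1{\tau_1}}<\infty.$$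
   Context: $m\in\mathbb{N}$, $\mathbb{T}^m=[0,2\pi)^m$, $\mathbb{Z}_+=\mathbb{N}\cup\{0\}$; $1/\infty=0$. For $1<p<\infty$, $1\le\tau<\infty$, $L_{p,\tau}(\mathbb{T}^m)$ is the Lorentz space of real-valued measurable functions $f$, $2\pi$-periodic in each variable, with $$\|f\|_{p,\tau}=\Bigl\{\frac{\tau}{p}\int_0^1 (f^*(t))^\tau t^{\frac{\tau}{p}-1}dt\Bigr\}^{1/\tau}<\infty,$$ where $f^*$ is the non-increasing rearrangement of $|f(2\pi\overline x)|$, $\overline x\in[0,1)^m$. $\mathring L_{p,\tau}(\mathbb{T}^m)$ is the set of $f\in L_{p,\tau}(\mathbb{T}^m)$ with $\int_0^{2\pi}f(\overline x)\,dx_j=0$ for $j=1,\dots,m$. For $\overline s\in\mathbb{Z}_+^m$ let $\rho(\overline s)=\{\overline k\in\mathbb{Z}^m: [2^{s_j-1}]\le|k_j|<2^{s_j},\ j=1,\dots,m\}$ ($[a]$ is the integer part of $a$) and $\delta_{\overline s}(f,\overline x)=\sum_{\overline n\in\rho(\overline s)}a_{\overline n}(f)e^{i\langle\overline n,\overline x\rangle}$, where $a_{\overline n}(f)$ are the Fourier coefficients of $f$ with respect to the trigonometric system. $S^{0,\overline b}_{p,\tau,\theta}B$ is the set of all $f\in\mathring L_{p,\tau}(\mathbb{T}^m)$ with $$\|f\|_{S^{0,\overline b}_{p,\tau,\theta}B}=\Bigl\{\sum_{\overline s\in\mathbb{Z}_+^m}\prod_{j=1}^m(s_j+1)^{b_j\theta}\|\delta_{\overline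 s}(f)\|_{p,\tau}^\theta\Bigr\}^{1/\theta}<\infty$$ (with the usual supremum modification if $\theta=\infty$).
   Formalization: "The embedding is valid" is proved as the norm estimate ‖f‖_{S2} ≤ C‖f‖_{S1} for all f in S1; membership of f in L_{p,τ2} (part of the definition of the target space) is not claimed, since it fails in general. *)

theory Defs
  imports "HOL-Analysis.Analysis"
begin

text \<open>Powers of extended nonnegative numbers; only used with exponents \<open>a > 0\<close>.\<close>
definition enn_powr :: "ennreal \<Rightarrow> real \<Rightarrow> ennreal" where
  "enn_powr x a = (if x = \<infinity> then \<infinity> else ennreal (enn2real x powr a))"

text \<open>Functions on the torus are \<open>2\<pi>\<close>-periodic functions on \<open>real ^ 'm\<close>, with \<open>m = CARD('m)\<close>.
  The values of the function are allowed in any normed space because the blocks \<open>\<delta>\<^sub>s(f)\<close> below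
  are complex-typed (although real-valued for real \<open>f\<close>).\<close>
definition rearrangement :: "(real ^ 'm \<Rightarrow> 'a::real_normed_vector) \<Rightarrow> real \<Rightarrow> ennreal" where
  "rearrangement f t =
     Inf {y. emeasure lebesgue
               {x. (\<forall>i. 0 \<le> x $ i \<and> x $ i < 1) \<and> y < ennreal (norm (f ((2 * pi) *\<^sub>R x)))}
             \<le> ennreal t}"

definition lorentz_norm :: "real \<Rightarrow> real \<Rightarrow> (real ^ 'm \<Rightarrow> 'a::real_normed_vector) \<Rightarrow> ennreal" where
  "lorentz_norm p \<tau> f =
     enn_powr
       (ennreal (\<tau> / p) *
        (\<integral>\<^sup>+t\<in>{0<..<1}. enn_powr (rearrangement f t) \<tau> * ennreal (t powr (\<tau> / p - 1)) \<partial>lborel))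
       (1 / \<tau>)"

definition lorentz_space :: "real \<Rightarrow> real \<Rightarrow> (real ^ 'm \<Rightarrow> real) set" where
  "lorentz_space p \<tau> =
     {f. f \<in> borel_measurable lebesgue \<and>
         (\<forall>x j. f (x + axis j (2 * pi)) = f x) \<and>
         lorentz_norm p \<tau> f < \<infinity>}"

text \<open>The condition on \<open>\<integral> f dx\<^sub>j\<close> is required for almost every value of the other variables:
  by Fubini, almost every section of an \<open>f\<close> in \<open>lorentz_space p \<tau>\<close> is integrable.\<close>
definition lorentz_space0 :: "real \<Rightarrow> real \<Rightarrow> (real ^ 'm \<Rightarrow> real) set" where
  "lorentz_space0 p \<tau> =
     {f \<in> lorentz_space p \<tau>.
        \<forall>j. AE x in lebesgue.
          (LINT t:{0..<2 * pi}|lebesgue. f (\<chi> i. if i = j then t else x $ i)) = 0}"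

definition dyadic_block :: "nat ^ 'm \<Rightarrow> (int ^ 'm) set" where
  "dyadic_block s =
     {k. \<forall>j. \<lfloor>2 powr (real (s $ j) - 1)\<rfloor> \<le> \<bar>k $ j\<bar> \<and> \<bar>k $ j\<bar> < 2 ^ (s $ j)}"

definition freq_inner :: "int ^ 'm \<Rightarrow> real ^ 'm \<Rightarrow> real" where
  "freq_inner n x = (\<Sum>j\<in>UNIV. real_of_int (n $ j) * x $ j)"

definition fourier_coeff :: "(real ^ 'm \<Rightarrow> real) \<Rightarrow> int ^ 'm \<Rightarrow> complex" where
  "fourier_coeff f n =
     (LINT x:{x. \<forall>i. 0 \<le> x $ i \<and> x $ i < 2 * pi}|lebesgue.
        complex_of_real (f x) * exp (- (\<i> * complex_of_real (freq_inner n x))))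
     / complex_of_real ((2 * pi) ^ CARD('m))"

definition delta_block :: "nat ^ 'm \<Rightarrow> (real ^ 'm \<Rightarrow> real) \<Rightarrow> real ^ 'm \<Rightarrow> complex" where
  "delta_block s f x =
     (\<Sum>n\<in>dyadic_block s. fourier_coeff f n * exp (\<i> * complex_of_real (freq_inner n x)))"

text \<open>The third index \<open>\<theta>\<close> ranges over \<open>(0, \<infinity>]\<close>.\<close>
definition besov_norm ::
  "real \<Rightarrow> real \<Rightarrow> ereal \<Rightarrow> real ^ 'm \<Rightarrow> (real ^ 'm \<Rightarrow> real) \<Rightarrow> ennreal" where
  "besov_norm p \<tau> \<theta> b f =
     (if \<theta> = \<infinity>
      then (SUP s. ennreal (\<Prod>j\<in>UNIV. (real (s $ j) + 1) powr (b $ j))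
                   * lorentz_norm p \<tau> (delta_block s f))
      else let q = real_of_ereal \<theta> in
        enn_powr
          (\<Sum>\<^sub>\<infinity>s. ennreal (\<Prod>j\<in>UNIV. (real (s $ j) + 1) powr (b $ j * q))
                   * enn_powr (lorentz_norm p \<tau> (delta_block s f)) q)
          (1 / q))"

definition besov_space :: "real \<Rightarrow> real \<Rightarrow> ereal \<Rightarrow> real ^ 'm \<Rightarrow> (real ^ 'm \<Rightarrow> real) set" where
  "besov_space p \<tau> \<theta> b = {f \<in> lorentz_space0 p \<tau>. besov_norm p \<tau> \<theta> b f < \<infinity>}"

text \<open>
  The embedding \<open>S\<^sub>1 \<subset> S\<^sub>2\<close> of Besov spaces is understood as the norm estimate
  \<open>\<parallel>f\<parallel>\<^sub>2 \<le> C \<parallel>f\<parallel>\<^sub>1\<close> on \<open>S\<^sub>1\<close>.  In particular \<open>\<parallel>f\<parallel>\<^sub>2\<close> is finite for every \<open>f\<close> in \<open>S\<^sub>1\<close>, and such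
  an \<open>f\<close> belongs to \<open>S\<^sub>2\<close> as soon as it belongs to \<open>lorentz_space0 p \<tau>\<^sub>2\<close>.  The last membership is
  deliberately not part of the notion: these norms do not control \<open>lorentz_norm\<close>, the spaces need
  not be complete, and bare inclusion of sets is a different property.  For \<open>m = 1\<close>, \<open>p = \<tau>\<^sub>1 = 2\<close>,
  \<open>\<tau>\<^sub>2 = 3/2\<close>, \<open>\<theta>\<^sub>1 = \<theta>\<^sub>2 = \<infinity>\<close>, \<open>b\<^sub>1 = b\<^sub>2 + 1/6\<close>, \<open>0 < b\<^sub>2 < 1/3\<close>, the norm estimate holds,
  but the function behaving like \<open>x powr (-1/2) * \<bar>ln x\<bar> powr (-c)\<close> at \<open>0\<close> with \<open>1/2 < c \<le> 2/3\<close>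
  (minus its mean) lies in \<open>S\<^sub>1\<close> and not in \<open>lorentz_space 2 (3/2)\<close>.
\<close>
definition besov_embedding ::
  "real \<Rightarrow> real \<Rightarrow> ereal \<Rightarrow> real ^ 'm \<Rightarrow> real \<Rightarrow> ereal \<Rightarrow> real ^ 'm \<Rightarrow> bool" where
  "besov_embedding p \<tau>\<^sub>1 \<theta>\<^sub>1 b\<^sub>1 \<tau>\<^sub>2 \<theta>\<^sub>2 b\<^sub>2 \<longleftrightarrow>
     (\<exists>C::real. \<forall>f\<in>besov_space p \<tau>\<^sub>1 \<theta>\<^sub>1 b\<^sub>1.
        besov_norm p \<tau>\<^sub>2 \<theta>\<^sub>2 b\<^sub>2 f \<le> ennreal C * besov_norm p \<tau>\<^sub>1 \<theta>\<^sub>1 b\<^sub>1 f)"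

end

theory Submission
  imports Defs
begin

text \<open>
  Everything rests on comparing the two Lorentz norms of one dyadic block. Let \<open>W(s) = \<Sum>\<^sub>j (s\<^sub>j + 1)\<close>.
  For a trigonometric polynomial \<open>T\<close> with spectrum in \<open>\<rho>(s)\<close>, Nikol'skii's inequality bounds the
  contribution of \<open>t < 2\<close>\<open>\<^sup>-\<close>\<open>(\<Sum>\<^sub>j s\<^sub>j)\<close> to the norm with index \<open>\<tau>\<^sub>2\<close>, and Hoelder's inequality for \<open>dt/t\<close> on the remaining
  logarithmic interval of length about \<open>W(s)\<close> costs the factor \<open>W(s)\<close> to the power \<open>1/\<tau>\<^sub>2 - 1/\<tau>\<^sub>1\<close>. The factor
  cannot be improved: a function with rearrangement \<open>t\<close>\<open>\<^sup>-\<^sup>1\<^sup>/\<^sup>p\<close> down to that scale attains it, and since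
  \<open>W(s)\<close> is comparable with \<open>max s\<^sub>j\<close> it suffices to let this function depend on the single variable with the
  largest \<open>s\<^sub>j\<close>, up to a modulation that moves its spectrum into \<open>\<rho>(s)\<close>. The embedding is thereby
  reduced to one between weighted sequence spaces, where Hoelder's inequality and its extremal
  sequences decide.
\<close>

section \<open>Lorentz norms\<close>

text \<open>\<open>lorentz_norm\<close> is built from the rearrangement and need not be a norm for
  \<tau> > p, so the estimates go through level sets and integrals in \<open>t\<close>, never
  through norms of sums.

  Dyadic blocks are disjoint. Hence \<open>delta_block\<close> recovers each piece of a polynomial
  assembled from blocks, and a Besov norm is exactly a weighted sequence norm of block norms: a
  comparison on single blocks, sharp up to constants, decides the matter.

  The obstacle lies in the extremal functions. They must be real with spectrum in \<rho>(s), away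
  from frequency zero, whereas a positive peak is centred at frequency zero. Modulation moves the
  spectrum and keeps the modulus but makes the function complex. Its real or imaginary part may lose
  modulus on sets that are hard to control, so lower bounds are proved for a pair of functions at
  once.

  Necessity is tested on finite sums of extremal polynomials: they lie in the space, and a bound
  independent of the finite index set gives convergence.\<close>

lemma enn_powr_ennreal: "0 \<le> x \<Longrightarrow> enn_powr (ennreal x) a = ennreal (x powr a)"
  by (simp add: enn_powr_def)

lemma enn_powr_top [simp]: "enn_powr top a = top"
  by (simp add: enn_powr_def)

lemma enn_powr_0 [simp]: "enn_powr 0 a = 0"
  by (simp add: enn_powr_def)

lemma enn_powr_mono:
  assumes "x \<le> y" "0 < a"
  shows "enn_powr x a \<le> enn_powr y a"
proof (cases y)
  case (real r)
  then obtain s where "0 \<le> s" "x = ennreal s" "s \<le> r"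
    using assms(1) by (cases x) (auto simp: ennreal_le_iff top_unique)
  with real assms(2) show ?thesis
    by (simp add: enn_powr_ennreal powr_mono2 ennreal_leI)
qed simp

lemma enn_powr_eq_top_iff: "enn_powr x a = top \<longleftrightarrow> x = top"
  by (simp add: enn_powr_def)

lemma enn_powr_mult:
  assumes "0 \<le> c"
  shows "enn_powr (ennreal c * x) a = ennreal (c powr a) * enn_powr x a"
proof (cases x)
  case (real r)
  with assms show ?thesis
    by (simp add: enn_powr_ennreal powr_mult flip: ennreal_mult)
next
  case top
  with assms show ?thesis
    by (cases "c = 0") (simp_all add: ennreal_mult_top)
qed

lemma enn_powr_enn_powr: "enn_powr (enn_powr x a) b = enn_powr x (a * b)"
  by (cases x) (simp_all add: enn_powr_ennreal powr_powr)

lemma enn_powr_1 [simp]: "enn_powr x 1 = x"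
  by (cases x) (simp_all add: enn_powr_ennreal)

lemma borel_measurable_enn_powr [measurable]: "(\<lambda>x. enn_powr x a) \<in> borel_measurable borel"
  unfolding enn_powr_def by measurable

lemma nn_integral_powr_Ioo_0:
  fixes a \<alpha> :: real
  assumes "0 < a" "0 < \<alpha>"
  shows "(\<integral>\<^sup>+t\<in>{0<..<a}. ennreal (t powr (\<alpha> - 1)) \<partial>lborel) = ennreal (a powr \<alpha> / \<alpha>)"
proof -
  \<comment> \<open>For \<alpha> < 1 the integrand is unbounded at 0, so the antiderivative is
    differentiated only in the interior and is merely continuous up to the end point.\<close>
  have "((\<lambda>t. t powr (\<alpha> - 1)) has_integral (a powr \<alpha> / \<alpha> - 0 powr \<alpha> / \<alpha>)) {0..a}"
  proof (rule fundamental_theorem_of_calculus_interior)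
    show "((\<lambda>t. t powr \<alpha> / \<alpha>) has_vector_derivative t powr (\<alpha> - 1)) (at t)" if "t \<in> {0<..<a}" for t
    proof -
      have "((\<lambda>t. t powr \<alpha> / \<alpha>) has_real_derivative (\<alpha> * t powr (\<alpha> - 1)) / \<alpha>) (at t)"
        using that by (intro DERIV_cdivide has_real_derivative_powr) auto
      then show ?thesis
        using assms by (simp add: has_real_derivative_iff_has_vector_derivative)
    qed
    have "continuous_on {0..a} (\<lambda>t. t powr \<alpha>)"
      using assms by (intro continuous_on_powr' continuous_on_id continuous_on_const) auto
    then show "continuous_on {0..a} (\<lambda>t. t powr \<alpha> / \<alpha>)"
      by (intro continuous_on_divide continuous_on_const) (use assms in auto)
  qed (use assms in simp)
  then have "((\<lambda>t. t powr (\<alpha> - 1)) has_integral (a powr \<alpha> / \<alpha>)) {0<..<a}"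
    using assms by (simp add: has_integral_Icc_iff_Ioo)
  then have "(\<integral>\<^sup>+t. ennreal (indicator {0<..<a} t * t powr (\<alpha> - 1)) \<partial>lborel) = ennreal (a powr \<alpha> / \<alpha>)"
    by (intro nn_integral_has_integral_lebesgue) auto
  moreover have "(\<integral>\<^sup>+t\<in>{0<..<a}. ennreal (t powr (\<alpha> - 1)) \<partial>lborel)
      = (\<integral>\<^sup>+t. ennreal (indicator {0<..<a} t * t powr (\<alpha> - 1)) \<partial>lborel)"
    by (intro nn_integral_cong) (auto simp: indicator_def)
  ultimately show ?thesis
    by simp
qed

lemma nn_integral_inverse_Ioo:
  fixes a b :: real
  assumes "0 < a" "a \<le> b"
  shows "(\<integral>\<^sup>+t\<in>{a<..<b}. ennreal (inverse t) \<partial>lborel) = ennreal (ln b - ln a)"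
proof -
  have "((\<lambda>t. inverse t) has_integral (ln b - ln a)) {a..b}"
  proof (rule fundamental_theorem_of_calculus)
    fix t assume "t \<in> {a..b}"
    then have "(ln has_real_derivative inverse t) (at t)"
      using assms by (intro DERIV_ln) auto
    then show "(ln has_vector_derivative inverse t) (at t within {a..b})"
      by (simp add: has_real_derivative_iff_has_vector_derivative has_vector_derivative_at_within)
  qed (use assms in simp)
  then have "((\<lambda>t. inverse t) has_integral (ln b - ln a)) {a<..<b}"
    by (simp add: has_integral_Icc_iff_Ioo)
  then have "(\<integral>\<^sup>+t. ennreal (indicator {a<..<b} t * inverse t) \<partial>lborel) = ennreal (ln b - ln a)"
    using assms by (intro nn_integral_has_integral_lebesgue) auto
  moreover have "(\<integral>\<^sup>+t\<in>{a<..<b}. ennreal (inverse t) \<partial>lborel)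
      = (\<integral>\<^sup>+t. ennreal (indicator {a<..<b} t * inverse t) \<partial>lborel)"
    by (intro nn_integral_cong) (auto simp: indicator_def)
  ultimately show ?thesis
    by simp
qed

section \<open>Distribution functions and rearrangements\<close>

definition unit_cell :: "(real ^ 'm) set" where
  "unit_cell = {x. \<forall>i. 0 \<le> x $ i \<and> x $ i < 1}"

text \<open>The distribution function of |f| on the torus rescaled to volume 1;
  \<open>rearrangement\<close> is its generalised inverse.\<close>

definition distribution :: "(real ^ 'm \<Rightarrow> 'a::real_normed_vector) \<Rightarrow> ennreal \<Rightarrow> ennreal" where
  "distribution f y = emeasure lebesgue {x \<in> unit_cell. y < ennreal (norm (f ((2 * pi) *\<^sub>R x)))}"

lemma unit_cell_borel [measurable]: "unit_cell \<in> sets borel"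
proof -
  have "unit_cell = (\<Inter>i. {x :: real ^ 'm. 0 \<le> x $ i} \<inter> {x. x $ i < 1})"
    by (auto simp: unit_cell_def)
  also have "\<dots> \<in> sets borel"
    by (intro sets.countable_INT'') (auto intro!: sets.Int borel_closed borel_open
       closed_Collect_le open_Collect_less continuous_intros)
  finally show ?thesis .
qed

lemma rearrangement_eq: "rearrangement f t = Inf {y. distribution f y \<le> ennreal t}"
  by (simp add: rearrangement_def distribution_def unit_cell_def)

lemma levelset_borel:
  fixes f :: "real ^ 'm \<Rightarrow> 'a::real_normed_vector"
  assumes [measurable]: "f \<in> borel_measurable borel"
  shows "{x \<in> unit_cell. y < ennreal (norm (f ((2 * pi) *\<^sub>R x)))} \<in> sets borel"
  by measurable

lemma levelset_lebesgue:
  fixes f :: "real ^ 'm \<Rightarrow> 'a::real_normed_vector"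
  assumes "f \<in> borel_measurable borel"
  shows "{x \<in> unit_cell. y < ennreal (norm (f ((2 * pi) *\<^sub>R x)))} \<in> sets lebesgue"
  using levelset_borel[OF assms] by (simp add: sets_completionI_sets)

lemma distribution_mono:
  fixes f :: "real ^ 'm \<Rightarrow> 'a::real_normed_vector"
  assumes "f \<in> borel_measurable borel" "y \<le> y'"
  shows "distribution f y' \<le> distribution f y"
  unfolding distribution_def
  using assms by (intro emeasure_mono levelset_lebesgue) auto

lemma rearrangement_le:
  "distribution f y \<le> ennreal t \<Longrightarrow> rearrangement f t \<le> y"
  unfolding rearrangement_eq by (intro Inf_lower) auto

lemma rearrangement_ge:
  fixes f :: "real ^ 'm \<Rightarrow> 'a::real_normed_vector"
  assumes "f \<in> borel_measurable borel" "ennreal t < distribution f y"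
  shows "y \<le> rearrangement f t"
  unfolding rearrangement_eq
proof (rule Inf_greatest)
  fix z assume "z \<in> {z. distribution f z \<le> ennreal t}"
  then show "y \<le> z"
    using assms distribution_mono[OF assms(1), of z y] by (meson leD le_less_trans linear mem_Collect_eq)
qed

lemma rearrangement_bounded:
  assumes "\<And>x. norm (f x) \<le> S"
  shows "rearrangement f t \<le> ennreal S"
proof (rule rearrangement_le)
  have "{x \<in> unit_cell. ennreal S < ennreal (norm (f ((2 * pi) *\<^sub>R x)))} = {}"
    using assms by (auto simp: not_less intro!: ennreal_leI)
  then show "distribution f (ennreal S) \<le> ennreal t"
    by (simp only: distribution_def emeasure_empty) simp
qed

lemma rearrangement_antimono:
  assumes "t \<le> u"
  shows "rearrangement f u \<le> rearrangement f t"
  unfolding rearrangement_eq using assms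
  by (intro Inf_superset_mono) (auto intro: order_trans ennreal_leI)

text \<open>Since the rearrangement is antitone in \<open>t\<close>, each set on which it exceeds
  \<open>y\<close> is an interval.\<close>

lemma borel_measurable_rearrangement [measurable]: "rearrangement f \<in> borel_measurable borel"
proof (rule borel_measurableI_greater)
  fix y
  have "is_interval {t. y < rearrangement f t}"
    unfolding is_interval_1 using rearrangement_antimono[of _ _ f] by (auto intro: less_le_trans)
  then show "{x \<in> space borel. y < rearrangement f x} \<in> sets borel"
    using real_interval_borel_measurable by simp
qed

lemma ennreal_mult_less_cancel:
  assumes "0 < c"
  shows "ennreal c * x < ennreal c * y \<longleftrightarrow> x < y"
proof
  assume "ennreal c * x < ennreal c * y"
  then show "x < y"
    by (metis leD mult_left_mono not_le zero_le)
qed (use assms in \<open>auto intro: ennreal_mult_strict_left_mono\<close>)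

text \<open>One inequality is proved for arbitrary \<open>f\<close>, \<open>g\<close>,
  \<open>c\<close> and used again with the roles exchanged and \<open>1 / c\<close>. The codomains
  differ because a real polynomial will be compared with its complex-valued
  \<open>delta_block\<close>.\<close>

lemma rearrangement_scale:
  fixes f :: "real ^ 'm \<Rightarrow> 'a::real_normed_vector" and g :: "real ^ 'm \<Rightarrow> 'b::real_normed_vector"
  assumes "0 < c" "\<And>x. norm (g x) = c * norm (f x)"
  shows "rearrangement g t = ennreal c * rearrangement f t"
proof -
  have *: "rearrangement g t \<le> ennreal c * rearrangement f t"
    if "0 < c" "\<And>x. norm (g x) = c * norm (f x)" 
      for c and f :: "real ^ 'm \<Rightarrow> 'c::real_normed_vector" and g :: "real ^ 'm \<Rightarrow> 'd::real_normed_vector"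
  proof -
    have "rearrangement g t / ennreal c \<le> rearrangement f t"
      unfolding rearrangement_eq[of f]
    proof (rule Inf_greatest)
      fix y assume y: "y \<in> {y. distribution f y \<le> ennreal t}"
      have "distribution g (ennreal c * y) = distribution f y"
        unfolding distribution_def using that
        by (simp add: ennreal_mult ennreal_mult_less_cancel)
      then have "rearrangement g t \<le> ennreal c * y"
        using y by (intro rearrangement_le) simp
      then show "rearrangement g t / ennreal c \<le> y"
        using that(1) by (simp add: divide_le_posI_ennreal)
    qed
    then have "ennreal c * (rearrangement g t / ennreal c) \<le> ennreal c * rearrangement f t"
      by (rule mult_left_mono) simp
    then show ?thesis
      using that(1) mult_divide_eq_ennreal[of "ennreal c" "rearrangement g t"]
      by (simp add: ennreal_times_divide mult.commute[of "ennreal c" "rearrangement g t"])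
  qed
  show ?thesis
  proof (rule antisym)
    show "ennreal c * rearrangement f t \<le> rearrangement g t"
    proof -
      have "rearrangement f t \<le> ennreal (1 / c) * rearrangement g t"
        using assms by (intro *) (auto simp: field_simps)
      then have "ennreal c * rearrangement f t \<le> ennreal c * (ennreal (1 / c) * rearrangement g t)"
        by (intro mult_left_mono) auto
      then show ?thesis
        using assms(1) by (simp add: mult.assoc[symmetric] flip: ennreal_mult)
    qed
  qed (use * assms in auto)
qed

section \<open>Estimates of Lorentz norms through the rearrangement\<close>

lemma nn_integral_unit_interval_split:
  fixes F F1 F2 :: "real \<Rightarrow> ennreal"
  assumes [measurable]: "F1 \<in> borel_measurable borel" "F2 \<in> borel_measurable borel"
    and "\<And>t. 0 < t \<Longrightarrow> t < a \<Longrightarrow> F t \<le> F1 t" "\<And>t. a < t \<Longrightarrow> t < 1 \<Longrightarrow> F t \<le> F2 t"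
  shows "(\<integral>\<^sup>+t\<in>{0<..<1}. F t \<partial>lborel) \<le> (\<integral>\<^sup>+t\<in>{0<..<a}. F1 t \<partial>lborel) + (\<integral>\<^sup>+t\<in>{a<..<1}. F2 t \<partial>lborel)"
proof -
  have "(\<integral>\<^sup>+t\<in>{0<..<1}. F t \<partial>lborel)
      \<le> (\<integral>\<^sup>+t. F1 t * indicator {0<..<a} t + F2 t * indicator {a<..<1} t \<partial>lborel)"
  proof (rule nn_integral_mono_AE)
    show "AE t in lborel. F t * indicator {0<..<1} t
        \<le> F1 t * indicator {0<..<a} t + F2 t * indicator {a<..<1} t"
      using AE_lborel_singleton[of a]
    proof eventually_elim
      case (elim t)
      then show ?case
        using assms(3,4)[of t] by (cases "t < a") (auto simp: indicator_def)
    qed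
  qed
  also have "\<dots> = (\<integral>\<^sup>+t\<in>{0<..<a}. F1 t \<partial>lborel) + (\<integral>\<^sup>+t\<in>{a<..<1}. F2 t \<partial>lborel)"
    by (rule nn_integral_add) measurable
  finally show ?thesis .
qed

lemma lorentz_norm_powr:
  assumes "0 < \<tau>"
  shows "enn_powr (lorentz_norm p \<tau> f) \<tau> = ennreal (\<tau> / p) *
        (\<integral>\<^sup>+t\<in>{0<..<1}. enn_powr (rearrangement f t) \<tau> * ennreal (t powr (\<tau> / p - 1)) \<partial>lborel)"
  using assms by (simp add: lorentz_norm_def enn_powr_enn_powr)

lemma le_of_enn_powr_le:
  assumes "0 < a" "0 \<le> c" "enn_powr x a \<le> ennreal c"
  shows "x \<le> ennreal (c powr (1 / a))"
  using enn_powr_mono[OF assms(3), of "1 / a"] assms by (simp add: enn_powr_enn_powr enn_powr_ennreal)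

lemma powr_mult_divide_cancel:
  fixes t :: real
  assumes "0 < t"
  shows "t powr (- \<alpha>) * t powr (\<alpha> - 1) = inverse t"
  using assms by (simp add: powr_neg_one inverse_eq_divide flip: powr_add)

text \<open>Chebyshev: the rearrangement is at least \<open>y\<close> on \<open>(0, l)\<close>, and
  the normalising factor \<open>\<tau> / p\<close> turns the integral of
  \<open>t powr (\<tau> / p - 1)\<close> there into exactly \<open>l powr (\<tau> / p)\<close>. So
  the Lorentz norm dominates the weak \<open>L_p\<close> quasi-norm with constant 1, whatever \<tau>
  is.\<close>

lemma lorentz_norm_weak_type:
  fixes f :: "real ^ 'm \<Rightarrow> 'a::real_normed_vector"
  assumes [measurable]: "f \<in> borel_measurable borel" and "0 < p" "0 < \<tau>"
    and K: "lorentz_norm p \<tau> f \<le> ennreal K" "0 \<le> K"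
    and y: "0 \<le> y" "0 < l" "l \<le> 1" "ennreal l \<le> distribution f (ennreal y)"
  shows "y powr p * l \<le> K powr p"
proof -
  have "ennreal (y powr \<tau> * l powr (\<tau> / p))
      = ennreal (\<tau> / p) * (ennreal (y powr \<tau>) * (\<integral>\<^sup>+t\<in>{0<..<l}. ennreal (t powr (\<tau> / p - 1)) \<partial>lborel))"
    using assms by (subst nn_integral_powr_Ioo_0) (simp_all flip: ennreal_mult)
  also have "\<dots> = ennreal (\<tau> / p) * (\<integral>\<^sup>+t. ennreal (y powr \<tau>) * (ennreal (t powr (\<tau> / p - 1)) * indicator {0<..<l} t) \<partial>lborel)"
    by (subst nn_integral_cmult) auto
  also have "\<dots> \<le> ennreal (\<tau> / p) *
        (\<integral>\<^sup>+t\<in>{0<..<1}. enn_powr (rearrangement f t) \<tau> * ennreal (t powr (\<tau> / p - 1)) \<partial>lborel)"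
  proof (intro mult_left_mono nn_integral_mono)
    fix t :: real
    show "ennreal (y powr \<tau>) * (ennreal (t powr (\<tau> / p - 1)) * indicator {0<..<l} t)
      \<le> enn_powr (rearrangement f t) \<tau> * ennreal (t powr (\<tau> / p - 1)) * indicator {0<..<1} t"
    proof (cases "t \<in> {0<..<l}")
      case True
      then have "ennreal t < distribution f (ennreal y)"
        using y by (intro less_le_trans[OF _ y(4)]) (auto simp: ennreal_less_iff)
      then have "ennreal y \<le> rearrangement f t"
        by (intro rearrangement_ge) auto
      then have "ennreal (y powr \<tau>) \<le> enn_powr (rearrangement f t) \<tau>"
        using enn_powr_mono[of "ennreal y" "rearrangement f t" \<tau>] assms by (simp add: enn_powr_ennreal)
      then show ?thesis
        using True y by (auto intro!: mult_right_mono)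
    qed simp
  qed simp
  also have "\<dots> = enn_powr (lorentz_norm p \<tau> f) \<tau>"
    using assms by (simp add: lorentz_norm_powr)
  also have "\<dots> \<le> ennreal (K powr \<tau>)"
    using enn_powr_mono[OF K(1), of \<tau>] assms by (simp add: enn_powr_ennreal)
  finally have "y powr \<tau> * l powr (\<tau> / p) \<le> K powr \<tau>"
    by (simp add: ennreal_le_iff)
  then have "(y powr \<tau> * l powr (\<tau> / p)) powr (p / \<tau>) \<le> (K powr \<tau>) powr (p / \<tau>)"
    using assms by (intro powr_mono2) auto
  then show ?thesis
    using assms by (simp add: powr_mult powr_powr)
qed

text \<open>The majorant is \<open>t powr (- 1 / p)\<close> cut off at height
  \<open>a powr (- 1 / p)\<close>. Its part below \<open>a\<close> contributes an amount independent
  of \<open>a\<close>; above \<open>a\<close> the weight turns the power into \<open>dt/t\<close>,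
  whose integral is \<open>ln (1 / a)\<close>. The case \<open>a = 1\<close> serves bounded
  functions, small \<open>a\<close> the spikes.\<close>

lemma lorentz_norm_le_log:
  assumes "0 < p" "0 < \<tau>" "0 \<le> G" "0 < a" "a \<le> 1"
    and "\<And>t. 0 < t \<Longrightarrow> t < a \<Longrightarrow> rearrangement f t \<le> ennreal (G * a powr (- 1 / p))"
    and "\<And>t. a < t \<Longrightarrow> t < 1 \<Longrightarrow> rearrangement f t \<le> ennreal (G * t powr (- 1 / p))"
  shows "enn_powr (lorentz_norm p \<tau> f) \<tau> \<le> ennreal (G powr \<tau> * (1 + \<tau> / p * ln (1 / a)))"
proof -
  have bound: "enn_powr (rearrangement f t) \<tau> * ennreal (t powr (\<tau> / p - 1))
      \<le> ennreal ((G * u powr (- 1 / p)) powr \<tau> * t powr (\<tau> / p - 1))"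
    if "rearrangement f t \<le> ennreal (G * u powr (- 1 / p))" for t u
  proof -
    have "enn_powr (rearrangement f t) \<tau> \<le> ennreal ((G * u powr (- 1 / p)) powr \<tau>)"
      using enn_powr_mono[OF that, of \<tau>] assms enn_powr_ennreal[of "G * u powr (- 1 / p)" \<tau>] by simp
    then show ?thesis
      by (simp add: ennreal_mult mult_right_mono)
  qed
  have "(\<integral>\<^sup>+t\<in>{0<..<1}. enn_powr (rearrangement f t) \<tau> * ennreal (t powr (\<tau> / p - 1)) \<partial>lborel)
      \<le> (\<integral>\<^sup>+t\<in>{0<..<a}. ennreal ((G * a powr (- 1 / p)) powr \<tau>) * ennreal (t powr (\<tau> / p - 1)) \<partial>lborel)
        + (\<integral>\<^sup>+t\<in>{a<..<1}. ennreal (G powr \<tau>) * ennreal (inverse t) \<partial>lborel)"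
  proof (rule nn_integral_unit_interval_split)
    fix t assume t: "a < t" "t < 1"
    then have "(G * t powr (- 1 / p)) powr \<tau> * t powr (\<tau> / p - 1) = G powr \<tau> * inverse t"
      using assms powr_mult_divide_cancel[of t "\<tau> / p"] by (simp add: powr_mult powr_powr)
    then show "enn_powr (rearrangement f t) \<tau> * ennreal (t powr (\<tau> / p - 1))
        \<le> ennreal (G powr \<tau>) * ennreal (inverse t)"
      using bound[of t t] assms t by (simp flip: ennreal_mult)
  next
    fix t assume t: "0 < t" "t < a"
    then show "enn_powr (rearrangement f t) \<tau> * ennreal (t powr (\<tau> / p - 1))
        \<le> ennreal ((G * a powr (- 1 / p)) powr \<tau>) * ennreal (t powr (\<tau> / p - 1))"
      using bound[of t a] assms(6) by (simp add: ennreal_mult)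
  qed measurable
  also have "\<dots> = ennreal ((G * a powr (- 1 / p)) powr \<tau>) * ennreal (a powr (\<tau> / p) / (\<tau> / p))
      + ennreal (G powr \<tau>) * ennreal (ln 1 - ln a)"
    using assms by (simp add: nn_integral_cmult mult.assoc nn_integral_powr_Ioo_0 nn_integral_inverse_Ioo)
  also have "\<dots> = ennreal ((G * a powr (- 1 / p)) powr \<tau> * (a powr (\<tau> / p) / (\<tau> / p)) + G powr \<tau> * ln (1 / a))"
  proof -
    have "ln 1 - ln a = ln (1 / a)" "0 \<le> ln (1 / a)"
      using assms by (auto simp: ln_div)
    then show ?thesis
      using assms by (simp del: ln_one add: mult_nonneg_nonneg flip: ennreal_mult ennreal_plus)
  qed
  also have "(G * a powr (- 1 / p)) powr \<tau> * (a powr (\<tau> / p) / (\<tau> / p)) = G powr \<tau> * (p / \<tau>)"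
    using assms by (simp add: powr_mult powr_divide powr_powr powr_minus divide_simps)
  finally have "ennreal (\<tau> / p) * (\<integral>\<^sup>+t\<in>{0<..<1}. enn_powr (rearrangement f t) \<tau> * ennreal (t powr (\<tau> / p - 1)) \<partial>lborel)
    \<le> ennreal (\<tau> / p) * ennreal (G powr \<tau> * (p / \<tau>) + G powr \<tau> * ln (1 / a))"
    by (intro mult_left_mono) auto
  also have "\<dots> = ennreal (G powr \<tau> * (1 + \<tau> / p * ln (1 / a)))"
    using assms by (subst ennreal_mult[symmetric]) (auto simp: algebra_simps intro!: add_nonneg_nonneg mult_nonneg_nonneg)
  finally show ?thesis
    using assms by (simp add: lorentz_norm_powr)
qed

lemma lorentz_norm_finite:
  assumes "\<And>x. norm (f x) \<le> S" "0 < p" "0 < \<tau>"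
  shows "lorentz_norm p \<tau> f < top"
proof -
  have "0 \<le> S"
    using norm_ge_zero order_trans assms(1) by blast
  then have "enn_powr (lorentz_norm p \<tau> f) \<tau> \<le> ennreal (S powr \<tau> * (1 + \<tau> / p * ln (1 / 1)))"
    using assms rearrangement_bounded[of f S] by (intro lorentz_norm_le_log) auto
  then have "enn_powr (lorentz_norm p \<tau> f) \<tau> \<noteq> top"
    by (auto simp: top_unique)
  then show ?thesis
    by (simp add: enn_powr_eq_top_iff less_top)
qed

lemma lorentz_norm_zero:
  assumes "\<And>x. norm (f x) \<le> 0" "0 < p" "0 < \<tau>"
  shows "lorentz_norm p \<tau> f = 0"
proof -
  have "rearrangement f t = 0" for t
    using rearrangement_bounded[of f 0] assms by simp
  then show ?thesis
    by (simp add: lorentz_norm_def)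
qed

lemma lorentz_norm_scale:
  fixes f :: "real ^ 'm \<Rightarrow> 'a::real_normed_vector" and g :: "real ^ 'm \<Rightarrow> 'b::real_normed_vector"
  assumes "0 < c" "0 < \<tau>" "\<And>x. norm (g x) = c * norm (f x)"
  shows "lorentz_norm p \<tau> g = ennreal c * lorentz_norm p \<tau> f"
proof -
  have "(\<integral>\<^sup>+t\<in>{0<..<1}. enn_powr (rearrangement g t) \<tau> * ennreal (t powr (\<tau> / p - 1)) \<partial>lborel)
     = (\<integral>\<^sup>+t. ennreal (c powr \<tau>) * (enn_powr (rearrangement f t) \<tau> * ennreal (t powr (\<tau> / p - 1)) * indicator {0<..<1} t) \<partial>lborel)"
    using assms by (simp add: rearrangement_scale[of c g f] enn_powr_mult mult.assoc)
  also have "\<dots> = ennreal (c powr \<tau>) * (\<integral>\<^sup>+t\<in>{0<..<1}. enn_powr (rearrangement f t) \<tau> * ennreal (t powr (\<tau> / p - 1)) \<partial>lborel)"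
    by (rule nn_integral_cmult) measurable
  finally have "lorentz_norm p \<tau> g = enn_powr (ennreal (c powr \<tau>) * (ennreal (\<tau> / p) * (\<integral>\<^sup>+t\<in>{0<..<1}. enn_powr (rearrangement f t) \<tau> * ennreal (t powr (\<tau> / p - 1)) \<partial>lborel))) (1 / \<tau>)"
    by (simp add: lorentz_norm_def ac_simps)
  then show ?thesis
    using assms by (subst (asm) enn_powr_mult) (simp_all add: lorentz_norm_def powr_powr)
qed

text \<open>Hoelder's inequality between the two Lorentz norms with respect to the measure \<open>dt/t\<close> on \<open>(a,1)\<close>
  is replaced by the pointwise bound \<open>x\<close>\<open>\<^sup>\<theta> \<le> (x + Y) Y\<close>\<open>\<^sup>\<theta>\<^sup>-\<^sup>1\<close> with \<open>Y = K\<close>\<open>\<^sup>\<tau>\<^sup>1 / W\<close>.\<close>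
lemma lorentz_norm_change_index:
  fixes f :: "real ^ 'm \<Rightarrow> 'a::real_normed_vector"
  assumes "0 < p" "0 < \<tau>\<^sub>2" "\<tau>\<^sub>2 < \<tau>\<^sub>1" "0 < a" "a \<le> 1" "1 \<le> W" "ln (1 / a) \<le> W" "0 \<le> A"
    and S: "\<And>x. norm (f x) \<le> S" "0 \<le> S" "S powr p * a \<le> A * K powr p"
    and K: "lorentz_norm p \<tau>\<^sub>1 f = ennreal K" "0 \<le> K"
  defines "C \<equiv> A powr (\<tau>\<^sub>2 / p) + \<tau>\<^sub>2 / p * (p / \<tau>\<^sub>1 + 1)"
  shows "lorentz_norm p \<tau>\<^sub>2 f \<le> ennreal (C powr (1 / \<tau>\<^sub>2) * W powr (1 / \<tau>\<^sub>2 - 1 / \<tau>\<^sub>1)) * ennreal K"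
proof (cases "K = 0")
  case True
  then have "S powr p * a \<le> 0"
    using S assms(1) by simp
  then have "S = 0"
    using \<open>0 < a\<close> by (simp add: mult_le_0_iff)
  then show ?thesis
    using assms lorentz_norm_zero[of f p \<tau>\<^sub>2] by simp
next
  case False
  then have "0 < K"
    using K by simp
  define \<theta> where "\<theta> = \<tau>\<^sub>2 / \<tau>\<^sub>1"
  \<comment> \<open>This value balances the two terms: integrated against \<open>dt/t\<close>, the
    term \<open>x powr \<tau>\<^sub>1\<close> gives a multiple of
    \<open>K powr \<tau>\<^sub>1\<close>, and the constant \<open>Y\<close> over a logarithmic
    length at most \<open>W\<close> gives no more than \<open>K powr \<tau>\<^sub>1\<close>.\<close>
  define Y where "Y = K powr \<tau>\<^sub>1 / W"
  have "0 < Y" "0 < \<theta>" "\<theta> < 1" "\<tau>\<^sub>1 * \<theta> = \<tau>\<^sub>2" "0 < \<tau>\<^sub>1"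
    using assms \<open>0 < K\<close> by (auto simp: Y_def \<theta>_def)
  have interpol: "x powr \<tau>\<^sub>2 \<le> (x powr \<tau>\<^sub>1 + Y) * Y powr (\<theta> - 1)" if "0 \<le> x" for x
  proof -
    have "x powr \<tau>\<^sub>2 = (x powr \<tau>\<^sub>1) powr \<theta>"
      using \<open>\<tau>\<^sub>1 * \<theta> = \<tau>\<^sub>2\<close> by (simp add: powr_powr)
    also have "\<dots> \<le> (x powr \<tau>\<^sub>1 + Y) powr \<theta>"
      using \<open>0 < \<theta>\<close> \<open>0 < Y\<close> by (intro powr_mono2) auto
    also have "\<dots> = (x powr \<tau>\<^sub>1 + Y) * (x powr \<tau>\<^sub>1 + Y) powr (\<theta> - 1)"
      using \<open>0 < Y\<close> powr_ge_zero[of x \<tau>\<^sub>1] by (simp add: powr_mult_base del: powr_ge_zero)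
    also have "\<dots> \<le> (x powr \<tau>\<^sub>1 + Y) * Y powr (\<theta> - 1)"
      using \<open>0 < Y\<close> \<open>\<theta> < 1\<close> by (intro mult_left_mono powr_mono2') auto
    finally show ?thesis .
  qed
  have pointwise: "enn_powr (rearrangement f t) \<tau>\<^sub>2 * ennreal (t powr (\<tau>\<^sub>2 / p - 1))
      \<le> ennreal (Y powr (\<theta> - 1)) * (enn_powr (rearrangement f t) \<tau>\<^sub>1 * ennreal (t powr (\<tau>\<^sub>1 / p - 1))
          + ennreal Y * ennreal (inverse t))" if "0 < t" for t
  proof -
    have "rearrangement f t < top"
      using rearrangement_bounded[of f S t] S by (simp add: le_less_trans)
    then obtain r where r: "0 \<le> r" "rearrangement f t = ennreal r"
      by (cases "rearrangement f t") auto
    \<comment> \<open>In the variable \<open>r * t powr (1 / p)\<close> both Lorentz integrands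
      become pure powers against \<open>dt/t\<close>, to which \<open>interpol\<close>
      applies.\<close>
    have e: "(r * t powr (1 / p)) powr \<tau> * inverse t = r powr \<tau> * t powr (\<tau> / p - 1)" for \<tau>
      using that r by (simp add: powr_mult powr_powr powr_diff divide_inverse mult.commute[of "inverse p"])
    have "r powr \<tau>\<^sub>2 * t powr (\<tau>\<^sub>2 / p - 1) = (r * t powr (1 / p)) powr \<tau>\<^sub>2 * inverse t"
      by (simp add: e)
    also have "\<dots> \<le> (((r * t powr (1 / p)) powr \<tau>\<^sub>1 + Y) * Y powr (\<theta> - 1)) * inverse t"
      using that r by (intro mult_right_mono interpol) auto
    also have "\<dots> = Y powr (\<theta> - 1) * ((r * t powr (1 / p)) powr \<tau>\<^sub>1 * inverse t + Y * inverse t)"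
      by (simp add: algebra_simps)
    also have "\<dots> = Y powr (\<theta> - 1) * (r powr \<tau>\<^sub>1 * t powr (\<tau>\<^sub>1 / p - 1) + Y * inverse t)"
      by (simp add: e)
    finally show ?thesis
      using that \<open>0 < Y\<close> r by (simp add: enn_powr_ennreal ennreal_leI flip: ennreal_mult ennreal_plus)
  qed
  let ?I = "\<integral>\<^sup>+t\<in>{0<..<1}. enn_powr (rearrangement f t) \<tau>\<^sub>1 * ennreal (t powr (\<tau>\<^sub>1 / p - 1)) \<partial>lborel"
  have "ennreal (p / \<tau>\<^sub>1) * (ennreal (\<tau>\<^sub>1 / p) * ?I) = ennreal (p / \<tau>\<^sub>1) * ennreal (K powr \<tau>\<^sub>1)"
    using lorentz_norm_powr[of \<tau>\<^sub>1 p f] K \<open>0 < \<tau>\<^sub>1\<close> by (simp add: enn_powr_ennreal)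
  then have I: "?I = ennreal (p / \<tau>\<^sub>1 * K powr \<tau>\<^sub>1)"
    using \<open>0 < \<tau>\<^sub>1\<close> assms(1) by (simp add: mult.assoc[symmetric] flip: ennreal_mult)
  have "(\<integral>\<^sup>+t\<in>{0<..<1}. enn_powr (rearrangement f t) \<tau>\<^sub>2 * ennreal (t powr (\<tau>\<^sub>2 / p - 1)) \<partial>lborel)
      \<le> (\<integral>\<^sup>+t\<in>{0<..<a}. ennreal (S powr \<tau>\<^sub>2) * ennreal (t powr (\<tau>\<^sub>2 / p - 1)) \<partial>lborel)
        + (\<integral>\<^sup>+t\<in>{a<..<1}. ennreal (Y powr (\<theta> - 1)) * (enn_powr (rearrangement f t) \<tau>\<^sub>1 * ennreal (t powr (\<tau>\<^sub>1 / p - 1))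
          + ennreal Y * ennreal (inverse t)) \<partial>lborel)"
  proof (rule nn_integral_unit_interval_split)
    fix t assume "0 < t" "t < a"
    show "enn_powr (rearrangement f t) \<tau>\<^sub>2 * ennreal (t powr (\<tau>\<^sub>2 / p - 1))
        \<le> ennreal (S powr \<tau>\<^sub>2) * ennreal (t powr (\<tau>\<^sub>2 / p - 1))"
      using enn_powr_mono[OF rearrangement_bounded[of f S t], of \<tau>\<^sub>2] S assms
      by (auto simp: enn_powr_ennreal intro!: mult_right_mono)
  qed (use pointwise assms in auto)
  also have "(\<integral>\<^sup>+t\<in>{0<..<a}. ennreal (S powr \<tau>\<^sub>2) * ennreal (t powr (\<tau>\<^sub>2 / p - 1)) \<partial>lborel)
      = ennreal (S powr \<tau>\<^sub>2) * ennreal (a powr (\<tau>\<^sub>2 / p) / (\<tau>\<^sub>2 / p))"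
    using assms by (simp add: nn_integral_cmult mult.assoc nn_integral_powr_Ioo_0)
  also have "\<dots> = ennreal (p / \<tau>\<^sub>2 * (S powr p * a) powr (\<tau>\<^sub>2 / p))"
    using assms by (simp add: powr_mult powr_powr mult_ac flip: ennreal_mult)
  also have "\<dots> \<le> ennreal (p / \<tau>\<^sub>2 * (A * K powr p) powr (\<tau>\<^sub>2 / p))"
    using assms by (intro ennreal_leI mult_left_mono powr_mono2) auto
  also have "\<dots> = ennreal (p / \<tau>\<^sub>2 * (A powr (\<tau>\<^sub>2 / p) * K powr \<tau>\<^sub>2))"
    using assms by (simp add: powr_mult powr_powr)
  also have "(\<integral>\<^sup>+t\<in>{a<..<1}. ennreal (Y powr (\<theta> - 1)) * (enn_powr (rearrangement f t) \<tau>\<^sub>1 * ennreal (t powr (\<tau>\<^sub>1 / p - 1))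
          + ennreal Y * ennreal (inverse t)) \<partial>lborel)
      = ennreal (Y powr (\<theta> - 1)) * ((\<integral>\<^sup>+t\<in>{a<..<1}. enn_powr (rearrangement f t) \<tau>\<^sub>1 * ennreal (t powr (\<tau>\<^sub>1 / p - 1)) \<partial>lborel)
          + ennreal Y * ennreal (ln 1 - ln a))"
    using assms by (simp add: nn_integral_cmult nn_integral_add mult.assoc distrib_right nn_integral_inverse_Ioo del: ln_one)
  also have "\<dots> \<le> ennreal (Y powr (\<theta> - 1)) * (?I + ennreal Y * ennreal W)"
    using assms \<open>0 < Y\<close> by (intro mult_left_mono add_mono nn_integral_mono ennreal_leI)
       (auto simp: indicator_def ln_div)
  also have "\<dots> = ennreal (Y powr (\<theta> - 1) * (p / \<tau>\<^sub>1 * K powr \<tau>\<^sub>1 + K powr \<tau>\<^sub>1))"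
    using assms \<open>0 < Y\<close> \<open>0 < \<tau>\<^sub>1\<close> unfolding I by (simp add: Y_def flip: ennreal_mult ennreal_plus)
  also have "Y powr (\<theta> - 1) * (p / \<tau>\<^sub>1 * K powr \<tau>\<^sub>1 + K powr \<tau>\<^sub>1)
      = (p / \<tau>\<^sub>1 + 1) * K powr \<tau>\<^sub>2 * W powr (1 - \<theta>)"
  proof -
    have "Y powr (\<theta> - 1) = K powr (\<tau>\<^sub>2 - \<tau>\<^sub>1) * W powr (1 - \<theta>)"
      using \<open>0 < K\<close> assms \<open>\<tau>\<^sub>1 * \<theta> = \<tau>\<^sub>2\<close>
      by (simp add: Y_def powr_divide powr_powr right_diff_distrib powr_diff field_simps)
    moreover have "K powr (\<tau>\<^sub>2 - \<tau>\<^sub>1) * K powr \<tau>\<^sub>1 = K powr \<tau>\<^sub>2"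
      by (simp flip: powr_add)
    ultimately have "Y powr (\<theta> - 1) * K powr \<tau>\<^sub>1 = K powr \<tau>\<^sub>2 * W powr (1 - \<theta>)"
      by (metis mult.assoc mult.commute)
    moreover have "Y powr (\<theta> - 1) * (p / \<tau>\<^sub>1 * K powr \<tau>\<^sub>1 + K powr \<tau>\<^sub>1)
        = (p / \<tau>\<^sub>1 + 1) * (Y powr (\<theta> - 1) * K powr \<tau>\<^sub>1)"
      by (simp add: algebra_simps)
    ultimately show ?thesis
      by simp
  qed
  \<comment> \<open>The part below \<open>a\<close> does not grow with \<open>W\<close>; since
    \<open>1 \<le> W\<close> and \<theta> < 1 the factor can be inserted to match the other
    part.\<close>
  also have "ennreal (p / \<tau>\<^sub>2 * (A powr (\<tau>\<^sub>2 / p) * K powr \<tau>\<^sub>2)) \<le> ennreal (p / \<tau>\<^sub>2 * (A powr (\<tau>\<^sub>2 / p) * (K powr \<tau>\<^sub>2 * W powr (1 - \<theta>))))"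
    using assms \<open>\<theta> < 1\<close> by (intro ennreal_leI mult_left_mono) (auto intro!: ge_one_powr_ge_zero mult_right_le_one_le simp: mult_le_cancel_left1)
  finally have "(\<integral>\<^sup>+t\<in>{0<..<1}. enn_powr (rearrangement f t) \<tau>\<^sub>2 * ennreal (t powr (\<tau>\<^sub>2 / p - 1)) \<partial>lborel)
      \<le> ennreal (p / \<tau>\<^sub>2 * (A powr (\<tau>\<^sub>2 / p) * (K powr \<tau>\<^sub>2 * W powr (1 - \<theta>)))) + ennreal ((p / \<tau>\<^sub>1 + 1) * K powr \<tau>\<^sub>2 * W powr (1 - \<theta>))"
    by (simp add: add_right_mono)
  then have "ennreal (\<tau>\<^sub>2 / p) * (\<integral>\<^sup>+t\<in>{0<..<1}. enn_powr (rearrangement f t) \<tau>\<^sub>2 * ennreal (t powr (\<tau>\<^sub>2 / p - 1)) \<partial>lborel)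
      \<le> ennreal (\<tau>\<^sub>2 / p) * (ennreal (p / \<tau>\<^sub>2 * (A powr (\<tau>\<^sub>2 / p) * (K powr \<tau>\<^sub>2 * W powr (1 - \<theta>)))) + ennreal ((p / \<tau>\<^sub>1 + 1) * K powr \<tau>\<^sub>2 * W powr (1 - \<theta>)))"
    by (intro mult_left_mono) auto
  also have "\<dots> = ennreal (C * (K powr \<tau>\<^sub>2 * W powr (1 - \<theta>)))"
    using assms \<open>0 < \<tau>\<^sub>1\<close> by (simp add: C_def field_simps flip: ennreal_mult ennreal_plus)
  finally have "enn_powr (lorentz_norm p \<tau>\<^sub>2 f) \<tau>\<^sub>2 \<le> ennreal (C * (K powr \<tau>\<^sub>2 * W powr (1 - \<theta>)))"
    using assms by (simp add: lorentz_norm_powr)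
  moreover have "0 \<le> C"
    using assms \<open>0 < \<tau>\<^sub>1\<close> by (simp add: C_def)
  ultimately have "lorentz_norm p \<tau>\<^sub>2 f \<le> ennreal ((C * (K powr \<tau>\<^sub>2 * W powr (1 - \<theta>))) powr (1 / \<tau>\<^sub>2))"
    using assms by (intro le_of_enn_powr_le) auto
  also have "(C * (K powr \<tau>\<^sub>2 * W powr (1 - \<theta>))) powr (1 / \<tau>\<^sub>2) = C powr (1 / \<tau>\<^sub>2) * W powr (1 / \<tau>\<^sub>2 - 1 / \<tau>\<^sub>1) * K"
  proof -
    have "(1 - \<theta>) * (1 / \<tau>\<^sub>2) = 1 / \<tau>\<^sub>2 - 1 / \<tau>\<^sub>1"
      using assms \<open>0 < \<tau>\<^sub>1\<close> by (simp add: \<theta>_def field_simps)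
    then show ?thesis
      using assms \<open>0 < K\<close> \<open>0 \<le> C\<close> by (simp add: powr_mult powr_powr)
  qed
  finally show ?thesis
    using K by (simp add: ennreal_mult)
qed

text \<open>For a given \<open>t\<close> only one of the two rearrangements is known to be large,
  and which one may change with \<open>t\<close>. Adding the \<tau>-th powers lets the bound be
  integrated without selecting a function first.\<close>

lemma lorentz_norm_pair_ge_log:
  assumes "0 < p" "0 < \<tau>" "0 \<le> G" "0 < a" "a \<le> b" "b \<le> 1"
    and "\<And>t. a < t \<Longrightarrow> t < b \<Longrightarrow> ennreal (G * t powr (- \<tau> / p))
      \<le> enn_powr (rearrangement f t) \<tau> + enn_powr (rearrangement g t) \<tau>"
  shows "ennreal (\<tau> / p * (G * (ln b - ln a)))
    \<le> enn_powr (lorentz_norm p \<tau> f) \<tau> + enn_powr (lorentz_norm p \<tau> g) \<tau>"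
proof -
  have "ennreal (\<tau> / p * (G * (ln b - ln a)))
      = ennreal (\<tau> / p) * (ennreal G * (\<integral>\<^sup>+t\<in>{a<..<b}. ennreal (inverse t) \<partial>lborel))"
    using assms by (subst nn_integral_inverse_Ioo) (simp_all flip: ennreal_mult)
  also have "\<dots> = ennreal (\<tau> / p) * (\<integral>\<^sup>+t. ennreal G * (ennreal (inverse t) * indicator {a<..<b} t) \<partial>lborel)"
    by (subst nn_integral_cmult) auto
  also have "\<dots> \<le> ennreal (\<tau> / p) * (\<integral>\<^sup>+t.
          enn_powr (rearrangement f t) \<tau> * ennreal (t powr (\<tau> / p - 1)) * indicator {0<..<1} t
        + enn_powr (rearrangement g t) \<tau> * ennreal (t powr (\<tau> / p - 1)) * indicator {0<..<1} t \<partial>lborel)"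
  proof (intro mult_left_mono nn_integral_mono)
    fix t :: real
    show "ennreal G * (ennreal (inverse t) * indicator {a<..<b} t)
       \<le> enn_powr (rearrangement f t) \<tau> * ennreal (t powr (\<tau> / p - 1)) * indicator {0<..<1} t
        + enn_powr (rearrangement g t) \<tau> * ennreal (t powr (\<tau> / p - 1)) * indicator {0<..<1} t"
    proof (cases "t \<in> {a<..<b}")
      case True
      then have "0 < t"
        using assms by auto
      then have "ennreal G * ennreal (inverse t) = ennreal (G * t powr (- \<tau> / p)) * ennreal (t powr (\<tau> / p - 1))"
        using powr_mult_divide_cancel[of t "\<tau> / p"] assms by (simp add: mult.assoc flip: ennreal_mult)
      also have "\<dots> \<le> (enn_powr (rearrangement f t) \<tau> + enn_powr (rearrangement g t) \<tau>) * ennreal (t powr (\<tau> / p - 1))"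
        using True assms(7) by (intro mult_right_mono) auto
      finally show ?thesis
        using True assms by (auto simp: distrib_right)
    qed simp
  qed simp
  also have "\<dots> = enn_powr (lorentz_norm p \<tau> f) \<tau> + enn_powr (lorentz_norm p \<tau> g) \<tau>"
    using assms by (simp add: lorentz_norm_powr distrib_left nn_integral_add)
  finally show ?thesis .
qed

section \<open>Trigonometric polynomials\<close>

lemma prod_vec_Basis:
  fixes F :: "'m::finite \<Rightarrow> real \<Rightarrow> complex"
  shows "(\<Prod>i\<in>UNIV. F i (g (axis i 1 :: real ^ 'm))) = (\<Prod>b\<in>Basis. F (axis_index b) (g b))"
proof (rule prod.reindex_bij_witness[of _ axis_index "\<lambda>i. axis i 1"])
  show "axis (axis_index b) 1 = b" if "b \<in> Basis" for b :: "real ^ 'm"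
    using axis_index[OF that] by simp
qed (auto simp: axis_in_Basis_iff)

text \<open>Fubini for products: \<open>lborel\<close> on \<open>real ^ 'm\<close> is the image
  under \<open>?T\<close> of a product of one-dimensional measures indexed by \<open>Basis\<close>,
  whence the translation of coordinates into basis vectors.\<close>

lemma has_bochner_integral_prod_vec:
  fixes F :: "'m::finite \<Rightarrow> real \<Rightarrow> complex"
  assumes "\<And>i. integrable lborel (F i)"
  shows "has_bochner_integral lborel (\<lambda>x :: real ^ 'm. \<Prod>i\<in>UNIV. F i (x $ i)) (\<Prod>i\<in>UNIV. LINT t|lborel. F i t)"
proof -
  interpret product_sigma_finite "\<lambda>_ :: real ^ 'm. lborel :: real measure"
    by standard
  let ?M = "\<Pi>\<^sub>M b\<in>(Basis :: (real ^ 'm) set). lborel :: real measure"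
  let ?T = "\<lambda>f. \<Sum>b\<in>Basis. f b *\<^sub>R b :: real ^ 'm"
  have [measurable]: "F i \<in> borel_measurable borel" for i
    using assms[of i] by (auto dest: borel_measurable_integrable)
  have meas: "(\<lambda>x :: real ^ 'm. \<Prod>i\<in>UNIV. F i (x $ i)) \<in> borel_measurable borel"
    by measurable
  have T: "?T \<in> measurable ?M borel"
    by measurable
  have comp: "?T f $ i = f (axis i 1)" for f i
    by (simp add: cart_eq_inner_axis inner_sum_left inner_Basis if_distrib axis_in_Basis_iff cong: if_cong)
  have eq: "(\<Prod>i\<in>UNIV. F i (?T f $ i)) = (\<Prod>b\<in>Basis. F (axis_index b) (f b))" for f
    unfolding comp by (rule prod_vec_Basis)
  have "integrable ?M (\<lambda>f. \<Prod>b\<in>Basis. F (axis_index b) (f b))"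
    by (rule product_integrable_prod) (use assms in auto)
  then have "integrable lborel (\<lambda>x :: real ^ 'm. \<Prod>i\<in>UNIV. F i (x $ i))"
    by (subst lborel_eq) (simp only: integrable_distr_eq[OF T meas] eq)
  moreover have "(LINT x|lborel. (\<Prod>i\<in>UNIV. F i ((x :: real ^ 'm) $ i))) = (LINT f|?M. (\<Prod>b\<in>Basis. F (axis_index b) (f b)))"
    by (subst lborel_eq) (simp only: integral_distr[OF T meas] eq)
  moreover have "\<dots> = (\<Prod>b\<in>(Basis :: (real ^ 'm) set). LINT t|lborel. F (axis_index b) t)"
    by (rule product_integral_prod) (use assms in auto)
  moreover have "\<dots> = (\<Prod>i\<in>UNIV. LINT t|lborel. F i t)"
    using prod_vec_Basis[of "\<lambda>i _. LINT t|lborel. F i t"] by simp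
  ultimately show ?thesis
    by (simp add: has_bochner_integral_iff)
qed

section \<open>Characters and their orthogonality\<close>

definition character :: "int ^ 'm \<Rightarrow> real ^ 'm \<Rightarrow> complex" where
  "character n x = exp (\<i> * complex_of_real (freq_inner n x))"

lemma freq_inner_add: "freq_inner (n + n') x = freq_inner n x + freq_inner n' x"
  by (simp add: freq_inner_def algebra_simps sum.distrib)

lemma freq_inner_minus: "freq_inner (- n) x = - freq_inner n x"
  by (simp add: freq_inner_def sum_negf)

lemma character_add: "character (n + n') x = character n x * character n' x"
  by (simp add: character_def freq_inner_add algebra_simps exp_add)

lemma character_0 [simp]: "character 0 x = 1"
  by (simp add: character_def freq_inner_def)

lemma character_minus: "character (- n) x = cnj (character n x)"
  by (simp add: character_def freq_inner_minus exp_cnj)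

lemma norm_character [simp]: "norm (character n x) = 1"
  by (simp add: character_def)

lemma character_prod: "character n x = (\<Prod>i\<in>UNIV. exp (\<i> * complex_of_real (real_of_int (n $ i) * x $ i)))"
  unfolding character_def freq_inner_def by (simp add: exp_sum sum_distrib_left)

lemma continuous_on_character: "continuous_on S (character n)"
  unfolding character_def freq_inner_def by (intro continuous_intros)

lemma exp_int_period: "exp (\<i> * complex_of_real (real_of_int k * (2 * pi))) = 1"
proof -
  have "\<i> * complex_of_real (real_of_int k * (2 * pi)) = of_int (2 * k) * complex_of_real pi * \<i>"
    by (simp add: algebra_simps)
  then show ?thesis
    using exp_integer_2pi[of "of_int k"] by (simp add: algebra_simps)
qed

lemma character_periodic: "character n (x + axis j (2 * pi)) = character n x"
proof -
  have "freq_inner n (x + axis j (2 * pi)) = freq_inner n x + real_of_int (n $ j) * (2 * pi)"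
  proof -
    have "(\<Sum>i\<in>UNIV. real_of_int (n $ i) * axis j (2 * pi) $ i) = real_of_int (n $ j) * (2 * pi)"
      by (simp add: axis_def if_distrib cong: if_cong)
    then show ?thesis
      by (simp add: freq_inner_def distrib_left sum.distrib)
  qed
  then show ?thesis
    using exp_int_period[of "n $ j"]
    by (simp only: character_def of_real_add distrib_left exp_add mult_1_right)
qed

text \<open>The side \<open>c\<close> is kept general because two cells occur: side
  \<open>2 * pi\<close> in Fourier coefficients and side 1 in rearrangements. The fundamental
  theorem of calculus gives the closed interval, which differs from the half-open one by a null
  set.\<close>

lemma has_bochner_integral_exp_period:
  fixes k :: int and c :: real
  assumes "0 < c"
  shows "has_bochner_integral lborel (\<lambda>t. indicator {0..<c} t *\<^sub>R exp (\<i> * complex_of_real (real_of_int k * (2 * pi / c * t))))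
    (if k = 0 then complex_of_real c else 0)"
proof -
  let ?e = "\<lambda>t. exp (\<i> * complex_of_real (real_of_int k * (2 * pi / c * t)))"
  have "((\<lambda>t. ?e t) has_integral (if k = 0 then complex_of_real c else 0)) {0..c}"
  proof (cases "k = 0")
    case True
    then show ?thesis
      using has_integral_const_real[of "1 :: complex" 0 c] assms
      by (simp add: scaleR_conv_of_real)
  next
    case False
    define w where "w = \<i> * complex_of_real (real_of_int k * (2 * pi / c))"
    have "w \<noteq> 0"
      using False assms by (simp add: w_def)
    have e: "?e = (\<lambda>t. exp (w * complex_of_real t))"
      unfolding w_def by (simp only: of_real_mult mult.assoc)
    have "((\<lambda>t. exp (w * complex_of_real t)) has_integral (exp (w * complex_of_real c) / w - exp (w * complex_of_real 0) / w)) {0..c}"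
    proof (rule fundamental_theorem_of_calculus)
      fix t
      have "((\<lambda>z. exp (w * z) / w) has_field_derivative (exp (w * complex_of_real t) * w) / w) (at (complex_of_real t))"
        by (intro DERIV_cdivide DERIV_fun_exp) (auto intro!: derivative_eq_intros)
      then have "((\<lambda>z. exp (w * z) / w) has_field_derivative exp (w * complex_of_real t)) (at (complex_of_real t))"
        using \<open>w \<noteq> 0\<close> by simp
      then show "((\<lambda>t. exp (w * complex_of_real t) / w) has_vector_derivative exp (w * complex_of_real t)) (at t within {0..c})"
        using has_vector_derivative_real_field[of "\<lambda>z. exp (w * z) / w"] by simp
    qed (use assms in simp)
    moreover have "w * complex_of_real c = \<i> * complex_of_real (real_of_int k * (2 * pi))"
      using assms by (simp add: w_def)
    then have "exp (w * complex_of_real c) = 1"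
      by (simp only: exp_int_period)
    ultimately show ?thesis
      using False by (simp only: e) simp
  qed
  moreover have si: "set_integrable lborel {0..c} ?e"
    using assms by (intro borel_integrable_atLeastAtMost' continuous_on_exp continuous_on_mult
      continuous_on_of_real continuous_on_const continuous_on_id)
  ultimately have "(LINT t:{0..c}|lborel. ?e t) = (if k = 0 then complex_of_real c else 0)"
    using set_borel_integral_eq_integral(2)[OF si] by (simp add: integral_unique)
  then have "has_bochner_integral lborel (\<lambda>t. indicator {0..c} t *\<^sub>R ?e t) (if k = 0 then complex_of_real c else 0)"
    using si by (simp add: has_bochner_integral_iff set_lebesgue_integral_def set_integrable_def)
  moreover have ae: "AE t in lborel. indicator {0..c} t *\<^sub>R ?e t = indicator {0..<c} t *\<^sub>R ?e t"
    using AE_lborel_singleton[of c] by eventually_elim (auto simp: indicator_def)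
  moreover have "?e \<in> borel_measurable borel"
    by (intro borel_measurable_continuous_onI continuous_on_exp continuous_on_mult
      continuous_on_of_real continuous_on_const continuous_on_id)
  then have m: "(\<lambda>t. indicator {0..c} t *\<^sub>R ?e t) \<in> borel_measurable lborel"
      "(\<lambda>t. indicator {0..<c} t *\<^sub>R ?e t) \<in> borel_measurable lborel"
    by simp_all
  ultimately show ?thesis
    using has_bochner_integral_cong_AE[OF m ae] by simp
qed

lemma scaleR_indicator_complex: "indicator A y *\<^sub>R z = indicator A y * (z :: complex)"
  by (simp add: indicator_def)

lemma indicator_cell:
  "indicator {x :: real ^ 'm. \<forall>i. 0 \<le> x $ i \<and> x $ i < c} x = (\<Prod>i\<in>UNIV. indicator {0..<c} (x $ i) :: complex)"
proof (cases "\<forall>i. 0 \<le> x $ i \<and> x $ i < c")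
  case False
  then obtain i where "\<not> (0 \<le> x $ i \<and> x $ i < c)"
    by blast
  then have "(\<Prod>i\<in>UNIV. indicator {0..<c} (x $ i) :: complex) = 0"
    by (intro prod_zero bexI[of _ i]) auto
  with False show ?thesis
    by simp
qed simp

lemma has_bochner_integral_character:
  fixes n :: "int ^ 'm"
  assumes "0 < c"
  shows "has_bochner_integral lborel
    (\<lambda>x. indicator {x. \<forall>i. 0 \<le> x $ i \<and> x $ i < c} x *\<^sub>R character n ((2 * pi / c) *\<^sub>R x))
    (if n = 0 then complex_of_real (c ^ CARD('m)) else 0)"
proof -
  let ?F = "\<lambda>i t. indicator {0..<c} t *\<^sub>R exp (\<i> * complex_of_real (real_of_int (n $ i) * (2 * pi / c * t)))"
  have "has_bochner_integral lborel (\<lambda>x :: real ^ 'm. \<Prod>i\<in>UNIV. ?F i (x $ i)) (\<Prod>i\<in>UNIV. LINT t|lborel. ?F i t)"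
    using has_bochner_integral_exp_period[OF assms]
    by (intro has_bochner_integral_prod_vec) (auto simp: has_bochner_integral_iff)
  moreover have "(\<Prod>i\<in>UNIV. LINT t|lborel. ?F i t) = (if n = 0 then complex_of_real (c ^ CARD('m)) else 0)"
    using has_bochner_integral_exp_period[OF assms]
    by (auto simp: has_bochner_integral_iff vec_eq_iff)
  moreover have "(\<Prod>i\<in>UNIV. ?F i (x $ i))
      = indicator {x. \<forall>i. 0 \<le> x $ i \<and> x $ i < c} x *\<^sub>R character n ((2 * pi / c) *\<^sub>R x)" for x :: "real ^ 'm"
    unfolding scaleR_indicator_complex indicator_cell character_prod prod.distrib by simp
  ultimately show ?thesis
    by simp
qed

text \<open>For infinite \<open>A\<close> the sum defaults to 0, so that only the zero function
  qualifies; this keeps finiteness of the spectrum out of many statements.\<close>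

definition trig_poly :: "(int ^ 'm) set \<Rightarrow> (real ^ 'm \<Rightarrow> complex) \<Rightarrow> bool" where
  "trig_poly A f \<longleftrightarrow> (\<exists>c. f = (\<lambda>x. \<Sum>n\<in>A. c n * character n x))"

lemma trig_poly_0 [simp]: "trig_poly A (\<lambda>x. 0)"
  by (auto simp: trig_poly_def intro!: exI[of _ "\<lambda>_. 0"])

lemma trig_poly_add: "trig_poly A f \<Longrightarrow> trig_poly A g \<Longrightarrow> trig_poly A (\<lambda>x. f x + g x)"
  unfolding trig_poly_def
proof safe
  fix c d
  show "\<exists>e. (\<lambda>x. (\<Sum>n\<in>A. c n * character n x) + (\<Sum>n\<in>A. d n * character n x)) = (\<lambda>x. \<Sum>n\<in>A. e n * character n x)"
    by (rule exI[of _ "\<lambda>n. c n + d n"]) (simp add: sum.distrib distrib_right)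
qed

lemma trig_poly_scale: "trig_poly A f \<Longrightarrow> trig_poly A (\<lambda>x. a * f x)"
  unfolding trig_poly_def
proof safe
  fix c
  show "\<exists>e. (\<lambda>x. a * (\<Sum>n\<in>A. c n * character n x)) = (\<lambda>x. \<Sum>n\<in>A. e n * character n x)"
    by (rule exI[of _ "\<lambda>n. a * c n"]) (simp add: sum_distrib_left mult.assoc)
qed

lemma trig_poly_sum:
  "(\<And>i. i \<in> I \<Longrightarrow> trig_poly A (f i)) \<Longrightarrow> trig_poly A (\<lambda>x. \<Sum>i\<in>I. f i x)"
  by (induction I rule: infinite_finite_induct) (auto intro: trig_poly_add)

lemma trig_poly_character:
  assumes "finite A" "n \<in> A"
  shows "trig_poly A (character n)"
  unfolding trig_poly_def
proof (intro exI)
  have "(\<Sum>k\<in>A. of_bool (k = n) * character k x) = (\<Sum>k\<in>A. if k = n then character k x else 0)" for x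
    by (intro sum.cong) auto
  then show "character n = (\<lambda>x. \<Sum>k\<in>A. of_bool (k = n) * character k x)"
    using assms by simp
qed

lemma trig_poly_mult:
  assumes "trig_poly A f" "trig_poly B g" "finite C" "\<And>m n. m \<in> A \<Longrightarrow> n \<in> B \<Longrightarrow> m + n \<in> C"
  shows "trig_poly C (\<lambda>x. f x * g x)"
proof -
  obtain c d where c: "f = (\<lambda>x. \<Sum>n\<in>A. c n * character n x)" and d: "g = (\<lambda>x. \<Sum>n\<in>B. d n * character n x)"
    using assms(1,2) by (auto simp: trig_poly_def)
  have "f x * g x = (\<Sum>m\<in>A. \<Sum>n\<in>B. (c m * d n) * character (m + n) x)" for x
    by (simp add: c d sum_product character_add mult_ac)
  then show ?thesis
    using assms(3,4) by (simp add: trig_poly_sum trig_poly_scale trig_poly_character)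
qed

lemma trig_poly_continuous: "trig_poly A f \<Longrightarrow> continuous_on S f"
  unfolding trig_poly_def by (auto intro!: continuous_intros continuous_on_character)

lemma trig_poly_borel: "trig_poly A f \<Longrightarrow> f \<in> borel_measurable borel"
  by (intro borel_measurable_continuous_onI trig_poly_continuous)

lemma trig_poly_bounded:
  assumes "trig_poly A f"
  shows "\<exists>S. \<forall>x. norm (f x) \<le> S"
proof -
  obtain c where c: "f = (\<lambda>x. \<Sum>n\<in>A. c n * character n x)"
    using assms by (auto simp: trig_poly_def)
  have "norm (f x) \<le> (\<Sum>n\<in>A. norm (c n))" for x
    unfolding c by (rule order_trans[OF norm_sum]) (simp add: norm_mult)
  then show ?thesis
    by blast
qed

lemma trig_poly_periodic: "trig_poly A f \<Longrightarrow> f (x + axis j (2 * pi)) = f x"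
  unfolding trig_poly_def by (auto simp: character_periodic)

lemma trig_poly_delta_block: "trig_poly (dyadic_block s) (delta_block s f)"
  unfolding trig_poly_def delta_block_def character_def by auto

text \<open>By orthogonality only the frequency \<open>n\<close> survives after multiplication by
  the conjugate character. The integral is computed for \<open>lborel\<close> and carried over to
  the completion, in which \<open>fourier_coeff\<close> is defined.\<close>

lemma fourier_coeff_trig_poly:
  fixes f :: "real ^ 'm \<Rightarrow> real"
  assumes "finite A" "(\<lambda>x. complex_of_real (f x)) = (\<lambda>x. \<Sum>n\<in>A. c n * character n x)"
  shows "fourier_coeff f n = (if n \<in> A then c n else 0)"
proof -
  let ?Q = "{x :: real ^ 'm. \<forall>i. 0 \<le> x $ i \<and> x $ i < 2 * pi}"
  have f: "complex_of_real (f x) = (\<Sum>n\<in>A. c n * character n x)" for x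
    using assms(2) by meson
  have *: "has_bochner_integral lborel (\<lambda>x. indicator ?Q x *\<^sub>R character (k - n) x)
      (if k - n = 0 then complex_of_real ((2 * pi) ^ CARD('m)) else 0)" for k
    using has_bochner_integral_character[of "2 * pi" "k - n"] by simp
  have "has_bochner_integral lborel (\<lambda>x. \<Sum>k\<in>A. c k * (indicator ?Q x *\<^sub>R character (k - n) x))
    (\<Sum>k\<in>A. c k * (if k - n = 0 then complex_of_real ((2 * pi) ^ CARD('m)) else 0))"
    by (intro has_bochner_integral_sum has_bochner_integral_mult_right *)
  moreover have "(\<Sum>k\<in>A. c k * (indicator ?Q x *\<^sub>R character (k - n) x))
      = indicator ?Q x *\<^sub>R (complex_of_real (f x) * exp (- (\<i> * complex_of_real (freq_inner n x))))" for x
  proof -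
    have "character (k - n) x = character k x * exp (- (\<i> * complex_of_real (freq_inner n x)))" for k
      using character_add[of k "- n" x] by (simp add: character_def[of "- n"] freq_inner_minus)
    then show ?thesis
      by (cases "x \<in> ?Q") (simp_all add: f sum_distrib_left sum_distrib_right mult_ac)
  qed
  moreover have "(\<Sum>k\<in>A. c k * (if k - n = 0 then complex_of_real ((2 * pi) ^ CARD('m)) else 0))
      = (if n \<in> A then c n else 0) * complex_of_real ((2 * pi) ^ CARD('m))"
    using assms(1) by (simp add: if_distrib sum.delta' cong: if_cong)
  ultimately have hb: "has_bochner_integral lborel
      (\<lambda>x. indicator ?Q x *\<^sub>R (complex_of_real (f x) * exp (- (\<i> * complex_of_real (freq_inner n x)))))
      ((if n \<in> A then c n else 0) * complex_of_real ((2 * pi) ^ CARD('m)))"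
    by simp
  have "integral\<^sup>L lebesgue (\<lambda>x. indicator ?Q x *\<^sub>R (complex_of_real (f x) * exp (- (\<i> * complex_of_real (freq_inner n x)))))
      = (if n \<in> A then c n else 0) * complex_of_real ((2 * pi) ^ CARD('m))"
    using hb by (subst integral_completion) (auto simp: has_bochner_integral_iff dest: borel_measurable_integrable)
  then show ?thesis
    unfolding fourier_coeff_def set_lebesgue_integral_def by simp
qed

text \<open>With the other coordinates frozen, the character is a constant \<open>C\<close> times a
  nonconstant exponential in \<open>t\<close>. This yields the vanishing means required by
  \<open>lorentz_space0\<close>.\<close>

lemma integral_character_coordinate:
  assumes "n $ j \<noteq> 0"
  shows "has_bochner_integral lebesgue (\<lambda>t. indicator {0..<2 * pi} t *\<^sub>R character n (\<chi> i. if i = j then t else x $ i)) 0"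
proof -
  define C where "C = exp (\<i> * complex_of_real (\<Sum>i\<in>UNIV - {j}. real_of_int (n $ i) * x $ i))"
  have "freq_inner n (\<chi> i. if i = j then t else x $ i)
      = real_of_int (n $ j) * t + (\<Sum>i\<in>UNIV - {j}. real_of_int (n $ i) * x $ i)" for t
    by (simp add: freq_inner_def sum.remove[of UNIV j])
  then have "character n (\<chi> i. if i = j then t else x $ i) = C * exp (\<i> * complex_of_real (real_of_int (n $ j) * (2 * pi / (2 * pi) * t)))" for t
    by (simp add: character_def C_def distrib_left exp_add mult.commute)
  moreover have "has_bochner_integral lborel (\<lambda>t. C * (indicator {0..<2 * pi} t *\<^sub>R exp (\<i> * complex_of_real (real_of_int (n $ j) * (2 * pi / (2 * pi) * t)))))
      (C * 0)"
    using has_bochner_integral_exp_period[of "2 * pi" "n $ j"] assms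
    by (intro has_bochner_integral_mult_right) simp
  ultimately have "has_bochner_integral lborel (\<lambda>t. indicator {0..<2 * pi} t *\<^sub>R character n (\<chi> i. if i = j then t else x $ i)) 0"
    by simp
  then show ?thesis
    by (auto simp: has_bochner_integral_iff integrable_completion integral_completion dest: borel_measurable_integrable)
qed

text \<open>Cauchy-Schwarz bounds the squared sum of the moduli of the coefficients by
  \<open>card A\<close> times the sum of their squares, and Parseval identifies that sum with the
  mean square over \<open>unit_cell\<close>.\<close>

lemma trig_poly_norm_le_L2:
  fixes f :: "real ^ 'm \<Rightarrow> complex"
  assumes "trig_poly A f"
  shows "ennreal ((norm (f x0))\<^sup>2) \<le> of_nat (card A) * (\<integral>\<^sup>+x\<in>unit_cell. ennreal ((norm (f ((2 * pi) *\<^sub>R x)))\<^sup>2) \<partial>lborel)"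
proof (cases "finite A")
  case True
  obtain c where c: "f = (\<lambda>x. \<Sum>n\<in>A. c n * character n x)"
    using assms by (auto simp: trig_poly_def)
  let ?I = "\<lambda>n x. indicator unit_cell x *\<^sub>R character n ((2 * pi) *\<^sub>R x) :: complex"
  have *: "has_bochner_integral lborel (?I n) (if n = 0 then complex_of_real (1 ^ CARD('m)) else 0)" for n :: "int ^ 'm"
    using has_bochner_integral_character[of 1 n] unfolding unit_cell_def by (simp only: div_by_1)
  have "has_bochner_integral lborel (\<lambda>x. \<Sum>m\<in>A. \<Sum>n\<in>A. (c m * cnj (c n)) * ?I (m - n) x)
      (\<Sum>m\<in>A. \<Sum>n\<in>A. (c m * cnj (c n)) * (if m - n = 0 then complex_of_real (1 ^ CARD('m)) else 0))"
    by (intro has_bochner_integral_sum has_bochner_integral_mult_right *)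
  moreover have "(\<Sum>m\<in>A. \<Sum>n\<in>A. (c m * cnj (c n)) * ?I (m - n) x)
      = complex_of_real ((norm (f ((2 * pi) *\<^sub>R x)))\<^sup>2 * indicator unit_cell x)" for x
  proof -
    have "character (m - n) y = character m y * cnj (character n y)" for m n :: "int ^ 'm" and y
      using character_add[of m "- n" y] by (simp add: character_minus)
    then have "(\<Sum>m\<in>A. \<Sum>n\<in>A. (c m * cnj (c n)) * character (m - n) y) = f y * cnj (f y)" for y
      by (simp add: c sum_product mult_ac)
    then have "(\<Sum>m\<in>A. \<Sum>n\<in>A. (c m * cnj (c n)) * character (m - n) y) = complex_of_real ((norm (f y))\<^sup>2)" for y
      by (simp add: complex_norm_square del: of_real_power)
    then show ?thesis
      by (cases "x \<in> unit_cell") simp_all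
  qed
  moreover have "(\<Sum>m\<in>A. \<Sum>n\<in>A. (c m * cnj (c n)) * (if m - n = 0 then complex_of_real (1 ^ CARD('m)) else 0)) = complex_of_real (\<Sum>n\<in>A. (norm (c n))\<^sup>2)"
    using True by (simp add: if_distrib sum.delta complex_norm_square cong: if_cong del: of_real_power)
  ultimately have "has_bochner_integral lborel (\<lambda>x. complex_of_real ((norm (f ((2 * pi) *\<^sub>R x)))\<^sup>2 * indicator unit_cell x))
      (complex_of_real (\<Sum>n\<in>A. (norm (c n))\<^sup>2))"
    by simp
  then have "has_bochner_integral lborel (\<lambda>x. (norm (f ((2 * pi) *\<^sub>R x)))\<^sup>2 * indicator unit_cell x) (\<Sum>n\<in>A. (norm (c n))\<^sup>2)"
    using has_bochner_integral_bounded_linear[OF bounded_linear_Re] by force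
  then have "(\<integral>\<^sup>+x. ennreal ((norm (f ((2 * pi) *\<^sub>R x)))\<^sup>2 * indicator unit_cell x) \<partial>lborel) = ennreal (\<Sum>n\<in>A. (norm (c n))\<^sup>2)"
    by (subst nn_integral_eq_integral) (auto simp: has_bochner_integral_iff)
  moreover have "(\<integral>\<^sup>+x\<in>unit_cell. ennreal ((norm (f ((2 * pi) *\<^sub>R x)))\<^sup>2) \<partial>lborel)
      = (\<integral>\<^sup>+x. ennreal ((norm (f ((2 * pi) *\<^sub>R x)))\<^sup>2 * indicator unit_cell x) \<partial>lborel)"
    by (intro nn_integral_cong) (auto simp: indicator_def)
  moreover have "(norm (f x0))\<^sup>2 \<le> real (card A) * (\<Sum>n\<in>A. (norm (c n))\<^sup>2)"
  proof -
    have "norm (f x0) \<le> (\<Sum>n\<in>A. norm (c n))"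
      unfolding c by (rule order_trans[OF norm_sum]) (simp add: norm_mult)
    then have "(norm (f x0))\<^sup>2 \<le> (\<Sum>n\<in>A. norm (c n))\<^sup>2"
      by (rule power_mono) simp
    also have "\<dots> \<le> real (card A) * (\<Sum>n\<in>A. (norm (c n))\<^sup>2)"
      using sum_squared_le_sum_of_squares[of "\<lambda>n. norm (c n)" A] by (simp add: mult.commute)
    finally show ?thesis .
  qed
  ultimately show ?thesis
    by (simp add: ennreal_of_nat_eq_real_of_nat sum_nonneg ennreal_leI flip: ennreal_mult)
next
  case False
  then show ?thesis
    using assms by (auto simp: trig_poly_def)
qed

section \<open>Nikol'skii's inequality and the change of the second index\<close>

text \<open>A box that holds the spectrum of the \<open>r\<close>-th power of a polynomial from
  block \<open>s\<close>. Its cardinality exceeds that of the block only by a factor depending on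
  \<open>r\<close> and the dimension.\<close>

definition freq_box :: "nat \<Rightarrow> nat ^ 'm \<Rightarrow> (int ^ 'm) set" where
  "freq_box r s = {k. \<forall>j. \<bar>k $ j\<bar> \<le> int (r * 2 ^ (s $ j))}"

lemma freq_box_finite_card:
  fixes s :: "nat ^ 'm"
  shows "finite (freq_box r s)" "card (freq_box r s) \<le> (2 * r + 1) ^ CARD('m) * 2 ^ (\<Sum>j\<in>UNIV. s $ j)"
proof -
  let ?P = "PiE UNIV (\<lambda>j :: 'm. {- int (r * 2 ^ (s $ j))..int (r * 2 ^ (s $ j))})"
  have inj: "inj_on (\<lambda>k :: int ^ 'm. vec_nth k) (freq_box r s)"
    by (auto simp: inj_on_def vec_nth_inject)
  have sub: "vec_nth ` freq_box r s \<subseteq> ?P"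
    by (auto simp: freq_box_def abs_le_iff minus_le_iff)
  have "finite ?P"
    by (intro finite_PiE) auto
  then show "finite (freq_box r s)"
    using finite_imageD[OF finite_subset[OF sub] inj] by blast
  have "card (freq_box r s) \<le> card ?P"
    using card_inj_on_le[OF inj sub \<open>finite ?P\<close>] .
  also have "card ?P = (\<Prod>j\<in>UNIV. 2 * (r * 2 ^ (s $ j)) + 1)"
  proof -
    have "card {- int n..int n} = 2 * n + 1" for n
      by simp
    then show ?thesis
      by (simp only: card_PiE[OF finite])
  qed
  also have "\<dots> \<le> (\<Prod>j\<in>UNIV. (2 * r + 1) * 2 ^ (s $ j))"
    by (intro prod_mono) (auto simp: algebra_simps)
  also have "\<dots> = (2 * r + 1) ^ CARD('m) * 2 ^ (\<Sum>j\<in>UNIV. s $ j)"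
    by (simp only: prod.distrib prod_constant power_sum)
  finally show "card (freq_box r s) \<le> (2 * r + 1) ^ CARD('m) * 2 ^ (\<Sum>j\<in>UNIV. s $ j)" .
qed

lemma dyadic_block_subset_freq_box: "dyadic_block s \<subseteq> freq_box 1 s"
  by (auto simp: dyadic_block_def freq_box_def intro: less_imp_le)

lemma finite_dyadic_block: "finite (dyadic_block s)"
  using finite_subset[OF dyadic_block_subset_freq_box freq_box_finite_card(1)] .

lemma trig_poly_power:
  fixes s :: "nat ^ 'm"
  assumes "trig_poly (dyadic_block s) f"
  shows "trig_poly (freq_box r s) (\<lambda>x. f x ^ r)"
proof (induction r)
  case 0
  have "character 0 = (\<lambda>x :: real ^ 'm. 1)"
    by auto
  then show ?case
    using trig_poly_character[OF freq_box_finite_card(1), of 0 0 s] by (simp add: freq_box_def)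
next
  case (Suc r)
  have "trig_poly (freq_box (Suc r) s) (\<lambda>x. f x * f x ^ r)"
  proof (rule trig_poly_mult[OF assms Suc.IH freq_box_finite_card(1)])
    fix m n assume "m \<in> dyadic_block s" "n \<in> freq_box r s"
    then have "\<bar>m $ j\<bar> < 2 ^ (s $ j)" "\<bar>n $ j\<bar> \<le> int r * 2 ^ (s $ j)" for j
      by (auto simp: dyadic_block_def freq_box_def)
    then have "\<bar>m $ j + n $ j\<bar> \<le> (1 + int r) * 2 ^ (s $ j)" for j
      unfolding distrib_right mult_1 by (meson abs_triangle_ineq add_mono less_imp_le order_trans)
    then show "m + n \<in> freq_box (Suc r) s"
      by (simp add: freq_box_def distrib_right)
  qed
  then show ?case
    by simp
qed

section \<open>Level sets in the unit cell and weak-type bounds\<close>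

lemma emeasure_unit_cell_coordinate:
  fixes j :: "'m::finite"
  assumes [measurable]: "B \<in> sets borel"
  shows "emeasure lebesgue {x :: real ^ 'm \<in> unit_cell. x $ j \<in> B} = emeasure lborel (B \<inter> {0..<1})"
proof -
  let ?A = "\<lambda>b :: real ^ 'm. if b = axis j 1 then B \<inter> {0..<1} else {0..<1}"
  let ?S = "{x :: real ^ 'm \<in> unit_cell. x $ j \<in> B}"
  have S: "x \<in> ?S \<longleftrightarrow> (\<forall>b\<in>Basis. x \<bullet> b \<in> ?A b)" for x :: "real ^ 'm"
    by (auto simp: unit_cell_def Basis_vec_def inner_axis axis_eq_axis)
  have ind: "indicator ?S x = (\<Prod>b\<in>Basis. indicator (?A b) (x \<bullet> b) :: ennreal)" for x :: "real ^ 'm"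
  proof (cases "x \<in> ?S")
    case True
    then have "(\<Prod>b\<in>Basis. indicator (?A b) (x \<bullet> b) :: ennreal) = (\<Prod>b\<in>(Basis :: (real ^ 'm) set). 1)"
      unfolding S by (intro prod.cong) (auto simp: indicator_def)
    with True show ?thesis
      by simp
  next
    case False
    then obtain b where "b \<in> Basis" "x \<bullet> b \<notin> ?A b"
      unfolding S by blast
    then have "(\<Prod>b\<in>Basis. indicator (?A b) (x \<bullet> b) :: ennreal) = 0"
      by (intro prod_zero bexI[of _ b]) auto
    with False show ?thesis
      by simp
  qed
  have "(\<lambda>x :: real ^ 'm. x $ j) -` B \<inter> space borel \<in> sets borel"
    by (rule measurable_sets[OF borel_measurable_continuous_onI assms]) (intro continuous_intros)
  moreover have "?S = unit_cell \<inter> ((\<lambda>x. x $ j) -` B \<inter> space borel)"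
    by auto
  ultimately have [measurable]: "?S \<in> sets borel"
    by (simp only: sets.Int unit_cell_borel)
  have "emeasure lebesgue ?S = (\<integral>\<^sup>+x. indicator ?S x \<partial>lborel)"
    by simp
  also have "\<dots> = (\<integral>\<^sup>+x. (\<Prod>b\<in>Basis. indicator (?A b) (x \<bullet> b)) \<partial>lborel)"
    by (simp only: ind)
  also have "\<dots> = (\<Prod>b\<in>Basis. \<integral>\<^sup>+t. indicator (?A b) t \<partial>lborel)"
    by (rule nn_integral_lborel_prod) auto
  also have "\<dots> = (\<Prod>b\<in>Basis. emeasure lborel (?A b))"
    by (intro prod.cong) auto
  also have "\<dots> = emeasure lborel (B \<inter> {0..<1}) * (\<Prod>b\<in>Basis - {axis j 1}. emeasure lborel (?A b))"
    by (subst prod.remove[of _ "axis j 1"]) (auto simp: axis_in_Basis_iff)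
  also have "(\<Prod>b\<in>Basis - {axis j 1}. emeasure lborel (?A b)) = 1"
    by (intro prod.neutral) auto
  finally show ?thesis
    by simp
qed

lemma emeasure_unit_cell: "emeasure lebesgue (unit_cell :: (real ^ 'm) set) = 1"
  using emeasure_unit_cell_coordinate[of UNIV "undefined :: 'm"] by simp

lemma distribution_le_1:
  fixes f :: "real ^ 'm \<Rightarrow> 'a::real_normed_vector"
  shows "distribution f y \<le> 1"
proof -
  have "distribution f y \<le> emeasure lebesgue (unit_cell :: (real ^ 'm) set)"
    unfolding distribution_def using sets_completionI_sets[of unit_cell lborel] by (intro emeasure_mono) auto
  then show ?thesis
    by (simp add: emeasure_unit_cell)
qed

lemma distribution_le_weak:
  fixes f :: "real ^ 'm \<Rightarrow> 'a::real_normed_vector"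
  assumes f: "f \<in> borel_measurable borel" and "0 < p" "0 < \<tau>"
    and K: "lorentz_norm p \<tau> f \<le> ennreal K" "0 \<le> K" and y: "0 < y"
  shows "distribution f (ennreal y) \<le> ennreal (K powr p / y powr p)"
proof -
  have "distribution f (ennreal y) < top"
    using distribution_le_1[of f "ennreal y"] by (rule le_less_trans) simp
  then obtain l where l: "0 \<le> l" "distribution f (ennreal y) = ennreal l"
    by (cases "distribution f (ennreal y)") auto
  then have "l \<le> 1"
    using distribution_le_1[of f "ennreal y"] by simp
  then have "y powr p * l \<le> K powr p"
    using lorentz_norm_weak_type[OF f assms(2,3) K, of y l] l y by (cases "l = 0") auto
  then show ?thesis
    using y l by (simp add: field_simps ennreal_leI)
qed

text \<open>The range of |f| is cut at the levels \<open>y i = S * (1 / 2) ^ i\<close>. On layer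
  \<open>i\<close> the integrand is at most \<open>y i ^ q\<close>, and the weak-type bound at level
  \<open>y (Suc i)\<close> controls the measure. The products behave like
  \<open>y i powr (q - p)\<close>, and \<open>q - p \<ge> 1\<close> makes them decay at least like
  \<open>(1 / 2) ^ i\<close>. The constant is \<open>2 powr p\<close> for passing from
  \<open>y (Suc i)\<close> to \<open>y i\<close>, times 2 for the geometric series.\<close>

lemma nn_integral_power_le_weak:
  fixes f :: "real ^ 'm \<Rightarrow> 'a::real_normed_vector"
  assumes [measurable]: "f \<in> borel_measurable borel" and "0 < p" "0 < \<tau>" "p + 1 \<le> real q"
    and K: "lorentz_norm p \<tau> f \<le> ennreal K" "0 \<le> K"
    and S: "\<And>x. norm (f x) \<le> S" "0 < S"
  shows "(\<integral>\<^sup>+x\<in>unit_cell. ennreal (norm (f ((2 * pi) *\<^sub>R x)) ^ q) \<partial>lborel)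
    \<le> ennreal (2 powr (p + 1) * K powr p * S powr (real q - p))"
proof -
  let ?g = "\<lambda>x. norm (f ((2 * pi) *\<^sub>R x))"
  define y where "y i = S * (1 / 2) ^ i" for i :: nat
  have "0 < y i" for i
    using S by (simp add: y_def)
  let ?E = "\<lambda>i. {x \<in> unit_cell. ennreal (y (Suc i)) < ennreal (?g x)}"
  have term_le: "F i \<le> suminf F" for F :: "nat \<Rightarrow> ennreal" and i
    using sum_le_suminf[of F "{i}"] by simp
  have layer: "ennreal (?g x ^ q) * indicator unit_cell x \<le> (\<Sum>i. ennreal (y i ^ q) * indicator (?E i) x)" for x
  proof (cases "x \<in> unit_cell \<and> ?g x \<noteq> 0")
    case True
    then have "0 < ?g x / S"
      using S by simp
    then obtain n where "(1 / 2) ^ n < ?g x / S"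
      using real_arch_pow_inv[of "?g x / S" "1 / 2"] by auto
    moreover have "(1 / 2 :: real) ^ Suc n \<le> (1 / 2) ^ n"
      by simp
    ultimately have "(1 / 2) ^ Suc n < ?g x / S"
      by linarith
    then have ex: "y (Suc n) < ?g x"
      using S by (simp add: y_def pos_less_divide_eq mult.commute)
    \<comment> \<open>The least such index places the value in layer \<open>i\<close>, above
      \<open>y (Suc i)\<close> and not above \<open>y i\<close>; for \<open>i = 0\<close> the upper
      bound is \<open>S\<close> itself.\<close>
    define i where "i = (LEAST i. y (Suc i) < ?g x)"
    have i: "y (Suc i) < ?g x"
      unfolding i_def by (rule LeastI[of "\<lambda>i. y (Suc i) < ?g x", OF ex])
    have "?g x \<le> y i"
    proof (cases i)
      case 0
      then show ?thesis
        using S by (simp add: y_def)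
    next
      case (Suc k)
      then have "\<not> y (Suc k) < ?g x"
        unfolding i_def by (intro not_less_Least) simp
      with Suc show ?thesis
        by simp
    qed
    then have "ennreal (?g x ^ q) * indicator unit_cell x \<le> ennreal (y i ^ q) * indicator (?E i) x"
      using True i \<open>0 < y (Suc i)\<close> by (auto simp: ennreal_less_iff intro!: ennreal_leI power_mono)
    also have "\<dots> \<le> (\<Sum>i. ennreal (y i ^ q) * indicator (?E i) x)"
      by (rule term_le)
    finally show ?thesis .
  next
    case False
    moreover have "0 < q"
      using assms by (intro gr0I) auto
    ultimately show ?thesis
      by auto
  qed
  have "(\<integral>\<^sup>+x\<in>unit_cell. ennreal (?g x ^ q) \<partial>lborel) \<le> (\<integral>\<^sup>+x. (\<Sum>i. ennreal (y i ^ q) * indicator (?E i) x) \<partial>lborel)"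
    by (intro nn_integral_mono layer)
  also have "\<dots> = (\<Sum>i. ennreal (y i ^ q) * emeasure lborel (?E i))"
    using levelset_borel[of f] by (simp add: nn_integral_suminf nn_integral_cmult_indicator)
  also have "\<dots> \<le> (\<Sum>i. ennreal (2 powr p * K powr p * S powr (real q - p)) * ennreal ((1 / 2) ^ i))"
  proof (intro suminf_le summableI)
    fix i
    have "emeasure lborel (?E i) = distribution f (ennreal (y (Suc i)))"
      using levelset_borel[of f] by (simp add: distribution_def)
    also have "\<dots> \<le> ennreal (K powr p / y (Suc i) powr p)"
      using assms \<open>0 < y (Suc i)\<close> by (intro distribution_le_weak) auto
    finally have "ennreal (y i ^ q) * emeasure lborel (?E i) \<le> ennreal (y i ^ q) * ennreal (K powr p / y (Suc i) powr p)"
      by (intro mult_left_mono) auto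
    also have "\<dots> = ennreal (y i ^ q * (K powr p / y (Suc i) powr p))"
      using \<open>0 < y i\<close> by (subst ennreal_mult[symmetric]) auto
    also have "y i ^ q * (K powr p / y (Suc i) powr p)
        = 2 powr p * K powr p * (y i powr (real q - p))"
    proof -
      have half: "y (Suc i) = y i / 2"
        by (simp add: y_def)
      show ?thesis
        unfolding half using \<open>0 < y i\<close> by (simp add: powr_divide powr_diff powr_realpow)
    qed
    also have "ennreal \<dots> \<le> ennreal (2 powr p * K powr p * (S powr (real q - p) * (1 / 2) ^ i))"
    proof (intro ennreal_leI mult_left_mono)
      have "y i powr (real q - p) = S powr (real q - p) * ((1 / 2) ^ i) powr (real q - p)"
        using S by (simp add: y_def powr_mult)
      also have "((1 / 2 :: real) ^ i) powr (real q - p) \<le> ((1 / 2) ^ i) powr 1"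
        using assms by (intro powr_mono') (auto simp: power_le_one)
      finally show "y i powr (real q - p) \<le> S powr (real q - p) * (1 / 2) ^ i"
        by (simp add: mult_left_mono)
    qed auto
    finally show "ennreal (y i ^ q) * emeasure lborel (?E i)
        \<le> ennreal (2 powr p * K powr p * S powr (real q - p)) * ennreal ((1 / 2) ^ i)"
      by (simp add: ennreal_mult mult.assoc)
  qed
  also have "\<dots> = ennreal (2 powr p * K powr p * S powr (real q - p)) * ennreal (\<Sum>i. (1 / 2) ^ i)"
    by (simp add: suminf_ennreal2 summable_geometric)
  also have "\<dots> = ennreal (2 powr (p + 1) * K powr p * S powr (real q - p))"
  proof -
    have "(\<Sum>i. (1 / 2) ^ i) = (2 :: real)"
      by (simp add: suminf_geometric)
    then show ?thesis
      by (subst ennreal_mult[symmetric]) (auto simp: powr_add mult_ac)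
  qed
  finally show ?thesis .
qed

text \<open>Nikol'skii's inequality: Parseval for a power \<open>f\<close>\<open>\<^sup>r\<close> with \<open>2 r > p\<close>, whose \<open>L\<close>\<open>\<^sub>2\<close> norm is controlled by
  the weak \<open>L\<close>\<open>\<^sub>p\<close> quasi-norm of \<open>f\<close> and by \<open>sup \<bar>f\<bar>\<close> itself.\<close>
lemma trig_poly_sup_le:
  fixes f :: "real ^ 'm \<Rightarrow> complex" and s :: "nat ^ 'm"
  assumes f: "trig_poly (dyadic_block s) f" and "0 < p" "0 < \<tau>" "p + 1 \<le> real (2 * r)"
    and K: "lorentz_norm p \<tau> f \<le> ennreal K" "0 \<le> K"
  shows "\<exists>S\<ge>0. (\<forall>x. norm (f x) \<le> S) \<and>
    S powr p * (1 / 2) ^ (\<Sum>j\<in>UNIV. s $ j) \<le> real ((2 * r + 1) ^ CARD('m)) * 2 powr (p + 1) * K powr p"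
proof -
  define S where "S = (SUP x. norm (f x))"
  have bdd: "bdd_above (range (\<lambda>x. norm (f x)))"
    using trig_poly_bounded[OF f] by (auto simp: bdd_above_def)
  have S: "norm (f x) \<le> S" for x
    unfolding S_def by (intro cSUP_upper bdd) simp
  then have "0 \<le> S"
    using norm_ge_zero order_trans by blast
  moreover have "S powr p * (1 / 2) ^ (\<Sum>j\<in>UNIV. s $ j) \<le> real ((2 * r + 1) ^ CARD('m)) * 2 powr (p + 1) * K powr p"
  proof (cases "S = 0")
    case False
    with \<open>0 \<le> S\<close> have "0 < S"
      by simp
    have "0 < r"
      using assms by (intro gr0I) auto
    define B where "B = 2 powr (p + 1) * K powr p * S powr (real (2 * r) - p)"
    define N where "N = (2 * r + 1) ^ CARD('m) * 2 ^ (\<Sum>j\<in>UNIV. s $ j)"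
    have "0 \<le> B"
      by (simp add: B_def)
    have "norm (f x) \<le> root (2 * r) (real N * B)" for x
    proof -
      have "ennreal ((norm (f x ^ r))\<^sup>2) \<le> of_nat (card (freq_box r s)) *
          (\<integral>\<^sup>+x\<in>unit_cell. ennreal ((norm (f ((2 * pi) *\<^sub>R x) ^ r))\<^sup>2) \<partial>lborel)"
        by (rule trig_poly_norm_le_L2[OF trig_poly_power[OF f]])
      also have "\<dots> \<le> of_nat N * ennreal B"
      proof (intro mult_mono)
        have "(norm (z ^ r))\<^sup>2 = norm z ^ (2 * r)" for z :: complex
          by (simp add: norm_power power_mult[symmetric] mult.commute)
        then show "(\<integral>\<^sup>+x\<in>unit_cell. ennreal ((norm (f ((2 * pi) *\<^sub>R x) ^ r))\<^sup>2) \<partial>lborel) \<le> ennreal B"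
          using nn_integral_power_le_weak[OF trig_poly_borel[OF f] assms(2,3,4) K S \<open>0 < S\<close>] by (simp add: B_def)
      qed (use freq_box_finite_card(2)[of r s] in \<open>auto simp: N_def simp flip: of_nat_le_iff[where 'a = ennreal]\<close>)
      also have "\<dots> = ennreal (real N * B)"
        using \<open>0 \<le> B\<close> by (simp add: ennreal_of_nat_eq_real_of_nat ennreal_mult)
      finally have "norm (f x) ^ (2 * r) \<le> real N * B"
        using \<open>0 \<le> B\<close> by (simp add: ennreal_le_iff norm_power power_mult[symmetric] mult.commute)
      then have "root (2 * r) (norm (f x) ^ (2 * r)) \<le> root (2 * r) (real N * B)"
        using \<open>0 < r\<close> by (intro real_root_le_mono) auto
      then show ?thesis
        using \<open>0 < r\<close> by (simp add: real_root_power_cancel)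
    qed
    then have "S \<le> root (2 * r) (real N * B)"
      unfolding S_def by (intro cSUP_least) auto
    then have "S ^ (2 * r) \<le> root (2 * r) (real N * B) ^ (2 * r)"
      using \<open>0 < S\<close> by (intro power_mono) auto
    also have "\<dots> = real N * B"
      using \<open>0 < r\<close> \<open>0 \<le> B\<close> by (intro real_root_pow_pos2) auto
    finally have "S powr real (2 * r) \<le> real N * B"
      using \<open>0 < S\<close> by (simp only: powr_realpow)
    \<comment> \<open>The bound on the power \<open>2 * r\<close> of \<open>S\<close> still contains
      a power of \<open>S\<close>, through \<open>B\<close>. As \<open>S\<close> is finite and
      positive that power cancels, and \<open>S powr p\<close> remains.\<close>
    moreover have "S powr real (2 * r) = S powr p * S powr (real (2 * r) - p)"
      by (simp flip: powr_add)
    ultimately have "S powr p * S powr (real (2 * r) - p) \<le> (real N * (2 powr (p + 1) * K powr p)) * S powr (real (2 * r) - p)"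
      by (simp only: B_def mult.assoc)
    then have "S powr p \<le> real N * (2 powr (p + 1) * K powr p)"
      using \<open>0 < S\<close> by (simp add: mult_le_cancel_right)
    then have "S powr p * (1 / 2) ^ (\<Sum>j\<in>UNIV. s $ j) \<le> real N * (2 powr (p + 1) * K powr p) * (1 / 2) ^ (\<Sum>j\<in>UNIV. s $ j)"
      by (intro mult_right_mono) auto
    then show ?thesis
      by (simp add: N_def power_one_over field_simps)
  qed simp
  ultimately show ?thesis
    using S by blast
qed

definition block_weight :: "nat ^ 'm \<Rightarrow> real" where
  "block_weight s = (\<Sum>j\<in>UNIV. real (s $ j) + 1)"

lemma block_weight_ge_1: "1 \<le> block_weight (s :: nat ^ 'm)"
proof -
  have "1 \<le> real CARD('m)"
    using zero_less_card_finite[where 'a = 'm] by linarith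
  then show ?thesis
    by (simp add: block_weight_def sum.distrib add_increasing sum_nonneg)
qed

lemma lorentz_norm_block_le:
  assumes "0 < p" "0 < \<tau>\<^sub>2" "\<tau>\<^sub>2 < \<tau>\<^sub>1"
  shows "\<exists>C>0. \<forall>(s :: nat ^ 'm) f. trig_poly (dyadic_block s) f \<longrightarrow>
    lorentz_norm p \<tau>\<^sub>2 f \<le> ennreal (C * block_weight s powr (1 / \<tau>\<^sub>2 - 1 / \<tau>\<^sub>1)) * lorentz_norm p \<tau>\<^sub>1 f"
proof -
  \<comment> \<open>Chosen so that \<open>p + 1 \<le> 2 * r\<close>, as the bound on the supremum
    requires. It depends on \<open>p\<close> alone, so \<open>A\<close> and \<open>D\<close> are
    independent of the block and of the polynomial.\<close>
  define r where "r = nat \<lceil>p\<rceil> + 1"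
  have "p \<le> real r - 1"
    using real_nat_ceiling_ge[of p] by (simp add: r_def)
  then have r: "p + 1 \<le> real (2 * r)"
    using assms(1) by simp
  define A where "A = real ((2 * r + 1) ^ CARD('m)) * 2 powr (p + 1)"
  define D where "D = A powr (\<tau>\<^sub>2 / p) + \<tau>\<^sub>2 / p * (p / \<tau>\<^sub>1 + 1)"
  have "0 < A"
    by (simp add: A_def)
  then have "0 < D"
    using assms by (simp add: D_def add_pos_pos)
  show ?thesis
  proof (intro exI[of _ "D powr (1 / \<tau>\<^sub>2)"] conjI allI impI)
    fix s :: "nat ^ 'm" and f assume f: "trig_poly (dyadic_block s) f"
    then obtain S0 where "\<forall>x. norm (f x) \<le> S0"
      using trig_poly_bounded by blast
    then have "lorentz_norm p \<tau>\<^sub>1 f < top"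
      using assms by (intro lorentz_norm_finite) auto
    then obtain K where K: "0 \<le> K" "lorentz_norm p \<tau>\<^sub>1 f = ennreal K"
      by (cases "lorentz_norm p \<tau>\<^sub>1 f") auto
    then obtain S where S: "S \<ge> 0" "\<And>x. norm (f x) \<le> S"
        "S powr p * (1 / 2) ^ (\<Sum>j\<in>UNIV. s $ j) \<le> A * K powr p"
      using trig_poly_sup_le[OF f assms(1) _ r, of \<tau>\<^sub>1 K] assms by (auto simp: A_def)
    \<comment> \<open>The cut \<open>a\<close> will be the reciprocal of the number of frequencies
      in the block, which is 2 to the power of the sum of the \<open>s $ j\<close>.\<close>
    have "ln (1 / (1 / 2) ^ (\<Sum>j\<in>UNIV. s $ j)) \<le> block_weight s"
    proof -
      have "ln (1 / (1 / 2 :: real) ^ (\<Sum>j\<in>UNIV. s $ j)) = real (\<Sum>j\<in>UNIV. s $ j) * ln 2"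
        by (simp add: power_one_over ln_realpow)
      also have "\<dots> \<le> real (\<Sum>j\<in>UNIV. s $ j) * 1"
        using ln_2_less_1 by (intro mult_left_mono) (auto intro!: sum_nonneg)
      also have "\<dots> \<le> block_weight s"
        by (simp add: block_weight_def sum_mono)
      finally show ?thesis .
    qed
    then have "lorentz_norm p \<tau>\<^sub>2 f \<le> ennreal (D powr (1 / \<tau>\<^sub>2) * block_weight s powr (1 / \<tau>\<^sub>2 - 1 / \<tau>\<^sub>1)) * ennreal K"
      unfolding D_def using S K assms \<open>0 < A\<close> block_weight_ge_1[of s]
      by (intro lorentz_norm_change_index[where a = "(1 / 2) ^ (\<Sum>j\<in>UNIV. s $ j)" and S = S])
         (auto simp: power_le_one)
    then show "lorentz_norm p \<tau>\<^sub>2 f \<le> ennreal (D powr (1 / \<tau>\<^sub>2) * block_weight s powr (1 / \<tau>\<^sub>2 - 1 / \<tau>\<^sub>1)) * lorentz_norm p \<tau>\<^sub>1 f"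
      by (simp add: K)
  qed (use \<open>0 < D\<close> in simp)
qed

section \<open>Extremal polynomials\<close>

definition dirichlet :: "nat \<Rightarrow> real \<Rightarrow> complex" where
  "dirichlet n t = (\<Sum>k<n. exp (\<i> * complex_of_real (real k * t)))"

text \<open>A superposition of Fejer kernels of degree below \<open>2\<close>\<open>\<^sup>L\<close> which behaves like \<open>\<bar>t\<bar>\<close>\<open>\<^sup>-\<^sup>1\<^sup>/\<^sup>p\<close>
  down to the scale \<open>2\<close>\<open>\<^sup>-\<^sup>L\<close>.\<close>
definition spike :: "real \<Rightarrow> nat \<Rightarrow> real \<Rightarrow> real" where
  "spike p L t = (\<Sum>l\<le>L. 2 powr (real l / p) * (norm (dirichlet (2 ^ l) t) / 2 ^ l)\<^sup>2)"

lemma spike_nonneg: "0 \<le> spike p L t"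
  unfolding spike_def by (intro sum_nonneg) auto

lemma norm_dirichlet_le: "norm (dirichlet n t) \<le> real n"
  unfolding dirichlet_def by (rule order_trans[OF norm_sum]) simp

lemma dirichlet_mult: "(exp (\<i> * complex_of_real t) - 1) * dirichlet n t = exp (\<i> * complex_of_real (real n * t)) - 1"
proof -
  have "dirichlet n t = (\<Sum>k<n. exp (\<i> * complex_of_real t) ^ k)"
    by (simp add: dirichlet_def mult_ac flip: exp_of_nat_mult)
  then have "(exp (\<i> * complex_of_real t) - 1) * dirichlet n t = exp (\<i> * complex_of_real t) ^ n - 1"
    by (simp add: power_diff_1_eq)
  then show ?thesis
    by (simp add: mult_ac flip: exp_of_nat_mult)
qed

text \<open>Jordan's inequality: by concavity the sine lies above its chord between 0 and
  \<open>pi / 2\<close>.\<close>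

lemma sin_ge_double:
  fixes x :: real
  assumes "0 \<le> x" "x \<le> 1 / 2"
  shows "2 * x \<le> sin (pi * x)"
proof -
  have "concave_on {0..pi} sin"
  proof (rule f''_le0_imp_concave)
    show "(cos has_real_derivative - sin x) (at x)" "(sin has_real_derivative cos x) (at x)" for x :: real
      by (auto intro!: derivative_eq_intros)
  qed (auto intro: sin_ge_zero)
  from concave_onD[OF this, of "2 * x" 0 "pi / 2"] show ?thesis
    using assms by (simp add: mult.commute)
qed

text \<open>In \<open>dirichlet_mult\<close> the right-hand side has modulus at most 2, while the
  factor of the kernel has modulus \<open>2 * sin (pi * x)\<close>, at least \<open>4 * d\<close>
  when \<open>x\<close> stays at distance \<open>d\<close> from the integers.\<close>

lemma norm_dirichlet_decay:
  assumes "0 < d" "d \<le> x" "x \<le> 1 - d"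
  shows "norm (dirichlet n (2 * pi * x)) \<le> 1 / d"
proof -
  have "2 * d \<le> sin (pi * x)"
  proof (cases "x \<le> 1 / 2")
    case True
    then show ?thesis
      using sin_ge_double[of x] assms by simp
  next
    case False
    have "sin (pi * (1 - x)) = sin (pi * x)"
      using sin_pi_minus[of "pi * x"] by (simp add: algebra_simps)
    then show ?thesis
      using False sin_ge_double[of "1 - x"] assms by simp
  qed
  then have "4 * d \<le> norm (exp (\<i> * complex_of_real (2 * pi * x)) - 1)"
    using assms unfolding dist_exp_i_1 by simp
  then have "4 * d * norm (dirichlet n (2 * pi * x))
      \<le> norm ((exp (\<i> * complex_of_real (2 * pi * x)) - 1) * dirichlet n (2 * pi * x))"
    unfolding norm_mult by (rule mult_right_mono) simp
  also have "\<dots> \<le> 2"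
    unfolding dirichlet_mult
    using norm_triangle_ineq4[of "exp (\<i> * complex_of_real (real n * (2 * pi * x)))" 1]
    by (simp only: norm_exp_i_times norm_one)
  finally show ?thesis
    using assms by (simp add: field_simps)
qed

text \<open>There is no cancellation yet at this scale: every angle is at most
  \<open>1 < pi / 3\<close>, so every term has real part at least \<open>1 / 2\<close>.\<close>

lemma norm_dirichlet_ge:
  assumes "0 \<le> t" "real n * t \<le> 1"
  shows "real n / 2 \<le> norm (dirichlet n t)"
proof -
  have "(1 / 2 :: real) \<le> cos (real k * t)" if "k < n" for k
  proof -
    have "real k * t \<le> real n * t"
      using that assms by (intro mult_right_mono) auto
    then have "real k * t \<le> 1"
      using assms by simp
    then have "real k * t \<le> pi / 3"
      using pi_gt3 by simp
    then have "cos (pi / 3) \<le> cos (real k * t)"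
      using assms pi_gt_zero by (intro cos_monotone_0_pi_le) auto
    then show ?thesis
      by (simp add: cos_60)
  qed
  then have "(\<Sum>k<n. 1 / 2) \<le> (\<Sum>k<n. cos (real k * t))"
    by (intro sum_mono) auto
  also have "\<dots> = Re (dirichlet n t)"
    by (simp add: dirichlet_def Re_exp)
  also have "\<dots> \<le> norm (dirichlet n t)"
    by (rule complex_Re_le_cmod)
  finally show ?thesis
    by simp
qed

text \<open>Truncated subtraction makes at least one exponent vanish, so the summand is
  \<open>q\<close> to the power of the distance between \<open>l\<close> and \<open>k\<close>. Each
  half of the two-sided series is at most \<open>1 / (1 - q)\<close>.\<close>

lemma sum_geometric_distance:
  fixes q :: real
  assumes "0 \<le> q" "q < 1"
  shows "(\<Sum>l\<le>L. q ^ (k - l) * q ^ (l - k)) \<le> 2 / (1 - q)"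
proof -
  have geo: "(\<Sum>i\<in>I. q ^ i) \<le> 1 / (1 - q)" if "finite I" for I :: "nat set"
    using sum_le_suminf[OF summable_geometric[of q] that] assms by (simp add: suminf_geometric)
  have "(\<Sum>l\<le>L. q ^ (k - l) * q ^ (l - k)) \<le> (\<Sum>l\<in>{..k} \<union> {k..k + L}. q ^ (k - l) * q ^ (l - k))"
    using assms by (intro sum_mono2) auto
  also have "\<dots> \<le> (\<Sum>l\<in>{..k}. q ^ (k - l) * q ^ (l - k)) + (\<Sum>l\<in>{k..k + L}. q ^ (k - l) * q ^ (l - k))"
    using assms by (subst sum.union_inter[symmetric]) (auto intro!: sum_nonneg)
  also have "(\<Sum>l\<in>{..k}. q ^ (k - l) * q ^ (l - k)) = (\<Sum>i\<in>{..k}. q ^ i)"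
    by (rule sum.reindex_bij_witness[of _ "\<lambda>i. k - i" "\<lambda>l. k - l"]) auto
  also have "(\<Sum>l\<in>{k..k + L}. q ^ (k - l) * q ^ (l - k)) = (\<Sum>i\<in>{..L}. q ^ i)"
    by (rule sum.reindex_bij_witness[of _ "\<lambda>i. i + k" "\<lambda>l. l - k"]) auto
  finally show ?thesis
    using geo[of "{..k}"] geo[of "{..L}"] by simp
qed

text \<open>Up to \<open>l = k\<close> the summands are dominated by a geometric series ending at
  \<open>2 powr (real k / p)\<close>. Beyond \<open>k\<close> the hypothesis brings in
  \<open>(1 / 4) ^ (l - k)\<close>, which beats the growth of the coefficients:
  \<open>1 / 2 \<le> q\<close>, a consequence of \<open>1 < p\<close>, bounds it by
  \<open>q ^ (2 * (l - k))\<close>, and half of that exponent pays for the growth. For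
  \<open>k = L\<close> the hypothesis is vacuous, which gives the global bound.\<close>

lemma spike_le:
  assumes "1 < p"
    and bound: "\<And>l. k < l \<Longrightarrow> l \<le> L \<Longrightarrow> norm (dirichlet (2 ^ l) t) \<le> 2 ^ k"
  shows "spike p L t \<le> 2 / (1 - 2 powr (- 1 / p)) * 2 powr (real k / p)"
proof -
  define q :: real where "q = 2 powr (- 1 / p)"
  have q: "0 \<le> q" "q < 1"
    using assms powr_less_mono[of "- 1 / p" 0 2] by (auto simp: q_def)
  have "1 / 2 \<le> q"
    using assms powr_mono[of "- 1" "- 1 / p" 2] by (simp add: q_def powr_minus)
  have qpow: "q ^ i = 2 powr (- (real i / p))" for i
    by (simp add: q_def powr_powr powr_realpow[symmetric])
  have "2 powr (real l / p) * (norm (dirichlet (2 ^ l) t) / 2 ^ l)\<^sup>2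
      \<le> 2 powr (real k / p) * (q ^ (k - l) * q ^ (l - k))" if "l \<le> L" for l
  proof (cases "l \<le> k")
    case True
    have "norm (dirichlet (2 ^ l) t) / 2 ^ l \<le> 1"
      using norm_dirichlet_le[of "2 ^ l" t] by simp
    then have "(norm (dirichlet (2 ^ l) t) / 2 ^ l)\<^sup>2 \<le> 1"
      by (intro power_le_one) auto
    then have "2 powr (real l / p) * (norm (dirichlet (2 ^ l) t) / 2 ^ l)\<^sup>2 \<le> 2 powr (real l / p)"
      by (simp add: mult_left_le)
    also have "\<dots> = 2 powr (real k / p) * q ^ (k - l)"
      using True by (simp add: qpow of_nat_diff diff_divide_distrib flip: powr_add)
    finally show ?thesis
      using True by simp
  next
    case False
    then have l: "k < l"
      by simp
    define i where "i = l - k"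
    have "l = k + i"
      using l by (simp add: i_def)
    have "norm (dirichlet (2 ^ l) t) / 2 ^ l \<le> 2 ^ k / 2 ^ l"
      using bound[OF l that] by (intro divide_right_mono) auto
    also have "\<dots> = (1 / 2) ^ i"
      by (simp add: \<open>l = k + i\<close> power_add power_one_over)
    finally have "(norm (dirichlet (2 ^ l) t) / 2 ^ l)\<^sup>2 \<le> ((1 / 2) ^ i)\<^sup>2"
      by (intro power_mono) auto
    then have "2 powr (real l / p) * (norm (dirichlet (2 ^ l) t) / 2 ^ l)\<^sup>2
        \<le> 2 powr (real l / p) * ((1 / 2) ^ i)\<^sup>2"
      by (intro mult_left_mono) auto
    also have "\<dots> \<le> 2 powr (real l / p) * (q ^ i)\<^sup>2"
      using \<open>1 / 2 \<le> q\<close> by (intro mult_left_mono power_mono) auto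
    also have "\<dots> = 2 powr (real k / p) * q ^ i"
      by (simp add: qpow power2_eq_square \<open>l = k + i\<close> add_divide_distrib flip: powr_add)
    finally show ?thesis
      using l by (simp add: i_def)
  qed
  then have "spike p L t \<le> (\<Sum>l\<le>L. 2 powr (real k / p) * (q ^ (k - l) * q ^ (l - k)))"
    unfolding spike_def by (intro sum_mono) auto
  also have "\<dots> \<le> 2 powr (real k / p) * (2 / (1 - q))"
    unfolding sum_distrib_left[symmetric] using q by (intro mult_left_mono sum_geometric_distance) auto
  finally show ?thesis
    by (simp add: q_def mult.commute)
qed

lemma spike_ge:
  assumes "k \<le> L" "0 \<le> t" "2 ^ k * t \<le> 1"
  shows "2 powr (real k / p) / 4 \<le> spike p L t"
proof -
  have "(1 / 2 :: real) \<le> norm (dirichlet (2 ^ k) t) / 2 ^ k"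
    using norm_dirichlet_ge[of t "2 ^ k"] assms by (simp add: field_simps)
  then have "(1 / 2 :: real)\<^sup>2 \<le> (norm (dirichlet (2 ^ k) t) / 2 ^ k)\<^sup>2"
    by (intro power_mono) auto
  then have "2 powr (real k / p) * (1 / 2)\<^sup>2 \<le> 2 powr (real k / p) * (norm (dirichlet (2 ^ k) t) / 2 ^ k)\<^sup>2"
    by (intro mult_left_mono) auto
  also have "\<dots> \<le> spike p L t"
    unfolding spike_def using assms
    by (intro member_le_sum[of k "{..L}" "\<lambda>l. 2 powr (real l / p) * (norm (dirichlet (2 ^ l) t) / 2 ^ l)\<^sup>2"]) auto
  finally show ?thesis
    by (simp add: power2_eq_square)
qed

lemma ex_dyadic_scale:
  fixes t :: real
  assumes "0 < t" "t \<le> 1"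
  obtains k where "(1 / 2) ^ k \<le> t" "t < 2 * (1 / 2) ^ k"
proof -
  obtain n where n: "(1 / 2) ^ n < t"
    using real_arch_pow_inv[OF assms(1), of "1 / 2"] by auto
  define k where "k = (LEAST k. (1 / 2) ^ k \<le> t)"
  have "(1 / 2) ^ k \<le> t"
    unfolding k_def by (rule LeastI[of "\<lambda>k. (1 / 2) ^ k \<le> t" n]) (use n in simp)
  moreover have "t < 2 * (1 / 2) ^ k"
  proof (cases k)
    case 0
    then show ?thesis
      using assms by simp
  next
    case (Suc i)
    then have "\<not> (1 / 2) ^ i \<le> t"
      unfolding k_def by (intro not_less_Least) simp
    with Suc show ?thesis
      by simp
  qed
  ultimately show ?thesis
    using that by blast
qed

text \<open>The first factor comes from the two-sided geometric series;
  \<open>4 powr (1 / p)\<close> pays for replacing \<open>2 ^ k\<close> by its upper bound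
  \<open>4 / t\<close> at the dyadic scale of \<open>t / 2\<close>.\<close>

definition spike_bound :: "real \<Rightarrow> real" where
  "spike_bound p = 2 / (1 - 2 powr (- 1 / p)) * 4 powr (1 / p)"

lemma spike_bound_pos: "1 < p \<Longrightarrow> 0 < spike_bound p"
  using powr_less_mono[of "- 1 / p" 0 2] by (auto simp: spike_bound_def)

text \<open>The kernels are estimated at the dyadic scale just below \<open>t / 2\<close>. The
  points of the unit interval left out have total measure \<open>t\<close>, which is what turns this
  into a bound on a rearrangement at \<open>t\<close>.\<close>

lemma spike_le_powr:
  assumes "1 < p" "0 < t" "t \<le> 1" "t / 2 \<le> x" "x \<le> 1 - t / 2"
  shows "spike p L (2 * pi * x) \<le> spike_bound p * t powr (- 1 / p)"
proof -
  obtain k where k: "(1 / 2) ^ k \<le> t / 2" "t / 2 < 2 * (1 / 2) ^ k"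
    using ex_dyadic_scale[of "t / 2"] assms by auto
  have "norm (dirichlet (2 ^ l) (2 * pi * x)) \<le> 2 ^ k" for l
    using norm_dirichlet_decay[of "(1 / 2) ^ k" x "2 ^ l"] k assms by (simp add: power_one_over)
  then have "spike p L (2 * pi * x) \<le> 2 / (1 - 2 powr (- 1 / p)) * 2 powr (real k / p)"
    using assms by (intro spike_le) auto
  also have "2 powr (real k / p) \<le> 4 powr (1 / p) * t powr (- 1 / p)"
  proof -
    have "(2 :: real) ^ k \<le> 4 / t"
      using k assms by (simp add: power_one_over field_simps)
    then have "((2 :: real) ^ k) powr (1 / p) \<le> (4 / t) powr (1 / p)"
      using assms by (intro powr_mono2) auto
    then show ?thesis
      using assms by (simp add: powr_divide powr_minus_divide powr_powr flip: powr_realpow)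
  qed
  then have "2 / (1 - 2 powr (- 1 / p)) * 2 powr (real k / p) \<le> 2 / (1 - 2 powr (- 1 / p)) * (4 powr (1 / p) * t powr (- 1 / p))"
    using assms powr_less_mono[of "- 1 / p" 0 2] by (intro mult_left_mono) auto
  finally show ?thesis
    by (simp add: spike_bound_def)
qed

lemma spike_le_top:
  assumes "1 < p"
  shows "spike p L t \<le> spike_bound p * 2 powr (real L / p)"
proof -
  have pos: "0 < 2 / (1 - 2 powr (- 1 / p))"
    using assms powr_less_mono[of "- 1 / p" 0 2] by auto
  have "spike p L t \<le> 2 / (1 - 2 powr (- 1 / p)) * 2 powr (real L / p)"
    using assms by (intro spike_le) auto
  also have "\<dots> \<le> (2 / (1 - 2 powr (- 1 / p)) * 4 powr (1 / p)) * 2 powr (real L / p)"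
    using assms pos ge_one_powr_ge_zero[of 4 "1 / p"] by (intro mult_right_mono mult_left_le[THEN order_trans] mult_le_cancel_left1[THEN iffD2]) auto
  finally show ?thesis
    by (simp add: spike_bound_def)
qed

text \<open>The squared modulus of a Dirichlet kernel is a double sum of exponentials whose
  frequencies are differences of numbers below \<open>2 ^ l\<close>, hence strictly between
  \<open>- (2 ^ L)\<close> and \<open>2 ^ L\<close>.\<close>

lemma spike_trig_poly:
  "trig_poly ((\<lambda>m. axis j m) ` {- int (2 ^ L) + 1..int (2 ^ L) - 1}) (\<lambda>x :: real ^ 'm. complex_of_real (spike p L (x $ j)))"
proof -
  let ?A = "(\<lambda>m. axis j m :: int ^ 'm) ` {- int (2 ^ L) + 1..int (2 ^ L) - 1}"
  have char: "character (axis j m) x = exp (\<i> * complex_of_real (real_of_int m * x $ j))" for m and x :: "real ^ 'm"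
  proof -
    have "freq_inner (axis j m) x = real_of_int m * x $ j"
      unfolding freq_inner_def by (subst sum.remove[of _ j]) (auto simp: axis_def intro!: sum.neutral)
    then show ?thesis
      by (simp add: character_def)
  qed
  have sq: "complex_of_real ((norm (dirichlet n t))\<^sup>2)
      = (\<Sum>k<n. \<Sum>k'<n. exp (\<i> * complex_of_real (real_of_int (int k - int k') * t)))" for n t
  proof -
    have "exp (\<i> * complex_of_real (real_of_int (int k - int k') * t))
        = exp (\<i> * complex_of_real (real k * t)) * cnj (exp (\<i> * complex_of_real (real k' * t)))" for k k'
      by (simp add: exp_cnj algebra_simps flip: exp_add)
    then show ?thesis
      unfolding complex_norm_square dirichlet_def by (simp add: sum_product)
  qed
  have "complex_of_real (spike p L (x $ j)) = (\<Sum>l\<le>L. complex_of_real (2 powr (real l / p) / (2 ^ l)\<^sup>2) *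
      (\<Sum>k<2 ^ l. \<Sum>k'<2 ^ l. character (axis j (int k - int k')) x))" for x :: "real ^ 'm"
    unfolding spike_def of_real_sum char sq[symmetric]
    by (intro sum.cong refl) (simp add: power_divide)
  moreover have "trig_poly ?A (\<lambda>x. \<Sum>l\<le>L. complex_of_real (2 powr (real l / p) / (2 ^ l)\<^sup>2) *
      (\<Sum>k<2 ^ l. \<Sum>k'<2 ^ l. character (axis j (int k - int k')) x))"
  proof (intro trig_poly_sum trig_poly_scale trig_poly_character imageI)
    fix l k k' :: nat assume "l \<in> {..L}" "k \<in> {..<2 ^ l}" "k' \<in> {..<2 ^ l}"
    moreover have "(2 :: nat) ^ l \<le> 2 ^ L"
      using \<open>l \<in> {..L}\<close> by (intro power_increasing) auto
    ultimately have "k < 2 ^ L" "k' < 2 ^ L"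
      by (auto intro: less_le_trans)
    then have "int k < int (2 ^ L)" "int k' < int (2 ^ L)"
      by (simp_all only: of_nat_less_iff)
    then show "int k - int k' \<in> {- int (2 ^ L) + 1..int (2 ^ L) - 1}"
      unfolding atLeastAtMost_iff by linarith
  qed simp
  ultimately show ?thesis
    by simp
qed

lemma lorentz_norm_le_of_spike:
  fixes F :: "real ^ 'm \<Rightarrow> real"
  assumes "1 < p" "0 < \<tau>" and F: "\<And>x. \<bar>F x\<bar> \<le> spike p L (x $ j)"
  shows "enn_powr (lorentz_norm p \<tau> F) \<tau> \<le> ennreal (spike_bound p powr \<tau> * (1 + \<tau> / p * (real L * ln 2)))"
proof -
  define a :: real where "a = (1 / 2) ^ L"
  have a: "0 < a" "a \<le> 1"
    by (auto simp: a_def power_le_one)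
  have "enn_powr (lorentz_norm p \<tau> F) \<tau> \<le> ennreal (spike_bound p powr \<tau> * (1 + \<tau> / p * ln (1 / a)))"
  proof (rule lorentz_norm_le_log)
    fix t
    have "a powr (- 1 / p) = 2 powr (real L / p)"
      by (simp add: a_def power_one_over powr_divide powr_minus_divide powr_powr flip: powr_realpow)
    then show "rearrangement F t \<le> ennreal (spike_bound p * a powr (- 1 / p))"
      using order_trans[OF F spike_le_top] assms by (intro rearrangement_bounded) simp
  next
    fix t assume "a < t" "t < 1"
    then have t: "0 < t" "t < 1"
      using a by auto
    let ?y = "spike_bound p * t powr (- 1 / p)"
    \<comment> \<open>The points within \<open>t / 2\<close> of 0 or 1. Elsewhere the spike does not
      exceed \<open>?y\<close>, and inside the unit interval this set has measure at most
      \<open>t\<close>.\<close>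
    let ?B = "{..<t / 2} \<union> {1 - t / 2<..}"
    have "distribution F (ennreal ?y) \<le> emeasure lebesgue {x :: real ^ 'm \<in> unit_cell. x $ j \<in> ?B}"
      unfolding distribution_def
    proof (rule emeasure_mono)
      show "{x \<in> unit_cell. ennreal ?y < ennreal (norm (F ((2 * pi) *\<^sub>R x)))} \<subseteq> {x \<in> unit_cell. x $ j \<in> ?B}"
      proof (intro subsetI CollectI conjI)
        fix x assume x: "x \<in> {x \<in> unit_cell. ennreal ?y < ennreal (norm (F ((2 * pi) *\<^sub>R x)))}"
        then show "x \<in> unit_cell"
          by simp
        show "x $ j \<in> ?B"
        proof (rule ccontr)
          assume "x $ j \<notin> ?B"
          then have "spike p L (2 * pi * x $ j) \<le> ?y"
            using assms t by (intro spike_le_powr) auto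
          then have "norm (F ((2 * pi) *\<^sub>R x)) \<le> ?y"
            using F[of "(2 * pi) *\<^sub>R x"] by simp
          then have "ennreal (norm (F ((2 * pi) *\<^sub>R x))) \<le> ennreal ?y"
            by (rule ennreal_leI)
          then show False
            using x by (auto dest: leD)
        qed
      qed
      have "(\<lambda>x :: real ^ 'm. x $ j) -` ?B \<inter> space borel \<in> sets borel"
        by (rule measurable_sets[OF borel_measurable_continuous_onI]) (auto intro: continuous_intros)
      moreover have "{x :: real ^ 'm \<in> unit_cell. x $ j \<in> ?B} = unit_cell \<inter> ((\<lambda>x. x $ j) -` ?B \<inter> space borel)"
        by auto
      ultimately have "{x :: real ^ 'm \<in> unit_cell. x $ j \<in> ?B} \<in> sets borel"
        by (simp only: sets.Int unit_cell_borel)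
      then show "{x :: real ^ 'm \<in> unit_cell. x $ j \<in> ?B} \<in> sets lebesgue"
        by (simp add: sets_completionI_sets)
    qed
    also have "\<dots> = emeasure lborel (?B \<inter> {0..<1})"
      by (rule emeasure_unit_cell_coordinate) simp
    also have "\<dots> \<le> emeasure lborel ({0..t / 2} \<union> {1 - t / 2..1})"
      by (intro emeasure_mono) auto
    also have "\<dots> \<le> emeasure lborel {0..t / 2} + emeasure lborel {1 - t / 2..1}"
      by (rule emeasure_subadditive) auto
    also have "\<dots> = ennreal t"
      using t by (simp flip: ennreal_plus)
    finally show "rearrangement F t \<le> ennreal ?y"
      by (rule rearrangement_le)
  qed (use assms spike_bound_pos[of p] a in auto)
  moreover have "ln (1 / a) = real L * ln 2"
    by (simp add: a_def power_one_over ln_realpow)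
  ultimately show ?thesis
    by simp
qed

lemma lorentz_norm_pair_ge_of_spike:
  fixes F G :: "real ^ 'm \<Rightarrow> real"
  assumes "0 < p" "0 < \<tau>" and [measurable]: "F \<in> borel_measurable borel" "G \<in> borel_measurable borel"
    and FG: "\<And>x. spike p L (x $ j) \<le> \<bar>F x\<bar> + \<bar>G x\<bar>"
  shows "ennreal (\<tau> / p * ((32 powr (- 1 / p) / 16) powr \<tau> * ((real L + 1) * ln 2)))
    \<le> enn_powr (lorentz_norm p \<tau> F) \<tau> + enn_powr (lorentz_norm p \<tau> G) \<tau>"
proof -
  \<comment> \<open>The 16 arises because the level \<open>?y\<close> used below is a quarter of the
    lower bound \<open>2 powr (real i / p) / 4\<close> for the spike, the 32 from
    \<open>(1 / 2) ^ i \<le> 32 * t\<close>. The range of \<open>t\<close> keeps the scale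
    admissible: below \<open>(1 / 2) ^ 4\<close> the case \<open>k = 0\<close> is impossible, and
    above \<open>a\<close> one has \<open>i \<le> L\<close>. Its logarithmic length is
    \<open>(L + 1) * ln 2\<close>.\<close>
  let ?c = "32 powr (- 1 / p) / 16 :: real"
  define a :: real where "a = (1 / 2) ^ (L + 5)"
  have "ennreal (\<tau> / p * (?c powr \<tau> * (ln ((1 / 2) ^ 4) - ln a)))
    \<le> enn_powr (lorentz_norm p \<tau> F) \<tau> + enn_powr (lorentz_norm p \<tau> G) \<tau>"
  proof (rule lorentz_norm_pair_ge_log)
    fix t assume t: "a < t" "t < (1 / 2) ^ 4"
    have "0 < a"
      by (simp add: a_def)
    with t have "0 < t"
      by simp
    obtain k where k: "(1 / 2) ^ k \<le> 16 * t" "16 * t < 2 * (1 / 2) ^ k"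
      using ex_dyadic_scale[of "16 * t"] t \<open>0 < t\<close> by (auto simp: power_one_over)
    text \<open>The scale used below is \<open>2\<close>\<open>\<^sup>-\<^sup>k\<close>\<open>\<^sup>+\<^sup>1\<close>, so that \<open>2 t\<close> is strictly below an eighth of it.\<close>
    obtain i where i: "k = Suc i"
      using k t by (cases k) (auto simp: power_one_over)
    have "i \<le> L"
    proof (rule ccontr)
      assume "\<not> i \<le> L"
      then have "(1 / 2 :: real) ^ k \<le> (1 / 2) ^ (L + 2)"
        unfolding i by (intro power_decreasing) auto
      also have "(1 / 2 :: real) ^ (L + 2) = (1 / 2) ^ L / 4"
        by (simp add: power_add power_one_over)
      finally have "16 * t < (1 / 2) ^ L / 2"
        using k by simp
      moreover have "a = (1 / 2) ^ L / 32"
        by (simp add: a_def power_add power_one_over)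
      ultimately show False
        using t by simp
    qed
    let ?y = "2 powr (real i / p) / 16 :: real"
    \<comment> \<open>On this strip \<open>2 * pi * x $ j \<le> 8 * x $ j \<le> (1 / 2) ^ i\<close>,
      so the spike is large there and the two level sets cover the strip. Its measure exceeds
      \<open>2 * t\<close>, so one of them has measure above \<open>t\<close>.\<close>
    let ?B = "{..<(1 / 2) ^ i / 8 :: real}"
    let ?D = "\<lambda>H :: real ^ 'm \<Rightarrow> real. {x \<in> unit_cell. ennreal ?y < ennreal (norm (H ((2 * pi) *\<^sub>R x)))}"
    have "emeasure lborel (?B \<inter> {0..<1}) = emeasure lborel {0..<(1 / 2) ^ i / 8 :: real}"
    proof -
      have "(1 / 2 :: real) ^ i \<le> 1"
        by (simp add: power_le_one)
      then show ?thesis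
        by (intro arg_cong[where f = "emeasure lborel"]) auto
    qed
    then have "emeasure lebesgue {x :: real ^ 'm \<in> unit_cell. x $ j \<in> ?B} = ennreal ((1 / 2) ^ i / 8)"
      by (subst emeasure_unit_cell_coordinate) auto
    moreover have "emeasure lebesgue {x :: real ^ 'm \<in> unit_cell. x $ j \<in> ?B} \<le> emeasure lebesgue (?D F \<union> ?D G)"
    proof (rule emeasure_mono)
      show "{x \<in> unit_cell. x $ j \<in> ?B} \<subseteq> ?D F \<union> ?D G"
      proof
        fix x :: "real ^ 'm" assume x: "x \<in> {x \<in> unit_cell. x $ j \<in> ?B}"
        then have "0 \<le> x $ j"
          by (auto simp: unit_cell_def)
        have "2 * pi * x $ j \<le> 8 * x $ j"
          using pi_less_4 \<open>0 \<le> x $ j\<close> by (intro mult_right_mono) auto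
        also have "\<dots> \<le> (1 / 2) ^ i"
          using x by simp
        finally have "2 ^ i * (2 * pi * x $ j) \<le> 2 ^ i * (1 / 2) ^ i"
          by (rule mult_left_mono) simp
        then have "2 ^ i * (2 * pi * x $ j) \<le> 1"
          by (simp flip: power_mult_distrib)
        then have "2 powr (real i / p) / 4 \<le> spike p L (2 * pi * x $ j)"
          using \<open>i \<le> L\<close> \<open>0 \<le> x $ j\<close> by (intro spike_ge) auto
        then have "4 * ?y \<le> \<bar>F ((2 * pi) *\<^sub>R x)\<bar> + \<bar>G ((2 * pi) *\<^sub>R x)\<bar>"
          using FG[of "(2 * pi) *\<^sub>R x"] by simp
        moreover have "0 < ?y"
          by simp
        ultimately have "?y < \<bar>F ((2 * pi) *\<^sub>R x)\<bar> \<or> ?y < \<bar>G ((2 * pi) *\<^sub>R x)\<bar>"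
          by linarith
        then show "x \<in> ?D F \<union> ?D G"
          using x by (auto simp: ennreal_less_iff)
      qed
    qed (use levelset_lebesgue[of F] levelset_lebesgue[of G] in auto)
    moreover have "emeasure lebesgue (?D F \<union> ?D G) \<le> distribution F (ennreal ?y) + distribution G (ennreal ?y)"
      unfolding distribution_def using levelset_lebesgue[of F] levelset_lebesgue[of G]
      by (intro emeasure_subadditive) auto
    ultimately have sum: "ennreal ((1 / 2) ^ i / 8) \<le> distribution F (ennreal ?y) + distribution G (ennreal ?y)"
      by simp
    have "ennreal t < distribution F (ennreal ?y) \<or> ennreal t < distribution G (ennreal ?y)"
    proof (rule ccontr)
      assume "\<not> ?thesis"
      then have "distribution F (ennreal ?y) + distribution G (ennreal ?y) \<le> ennreal t + ennreal t"
        by (intro add_mono) (auto simp: not_less)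
      also have "\<dots> = ennreal (2 * t)"
        using \<open>0 < t\<close> by (simp flip: ennreal_plus)
      finally have "(1 / 2) ^ i / 8 \<le> 2 * t"
        using sum \<open>0 < t\<close> by (meson ennreal_le_iff less_imp_le mult_nonneg_nonneg order_trans zero_le_numeral)
      then show False
        using k by (simp add: i)
    qed
    then have "ennreal ?y \<le> rearrangement F t \<or> ennreal ?y \<le> rearrangement G t"
      using rearrangement_ge[of F t "ennreal ?y"] rearrangement_ge[of G t "ennreal ?y"] by auto
    then have "enn_powr (ennreal ?y) \<tau> \<le> enn_powr (rearrangement F t) \<tau>
        \<or> enn_powr (ennreal ?y) \<tau> \<le> enn_powr (rearrangement G t) \<tau>"
      using enn_powr_mono \<open>0 < \<tau>\<close> by blast
    then have "enn_powr (ennreal ?y) \<tau> \<le> enn_powr (rearrangement F t) \<tau> + enn_powr (rearrangement G t) \<tau>"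
      by (meson add_increasing add_increasing2 zero_le)
    moreover have "enn_powr (ennreal ?y) \<tau> = ennreal (?y powr \<tau>)"
      by (rule enn_powr_ennreal) simp
    moreover have "?c powr \<tau> * t powr (- \<tau> / p) \<le> ?y powr \<tau>"
    proof -
      have "1 / (32 * t) \<le> 2 ^ i"
      proof -
        have "1 / (32 * t) \<le> 1 / (1 / 2) ^ i"
          using k \<open>0 < t\<close> by (intro divide_left_mono) (auto simp: i)
        then show ?thesis
          by (simp add: power_one_over)
      qed
      then have "(1 / (32 * t)) powr (1 / p) \<le> (2 ^ i) powr (1 / p)"
        using assms \<open>0 < t\<close> by (intro powr_mono2) auto
      then have "?c * t powr (- 1 / p) \<le> ?y"
        using \<open>0 < t\<close> by (simp add: powr_divide powr_mult powr_minus_divide powr_powr flip: powr_realpow)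
      then have "(?c * t powr (- 1 / p)) powr \<tau> \<le> ?y powr \<tau>"
        using assms by (intro powr_mono2) auto
      moreover have "(?c * t powr (- 1 / p)) powr \<tau> = ?c powr \<tau> * t powr (- \<tau> / p)"
        unfolding powr_mult[of ?c "t powr (- 1 / p)"] powr_powr by simp
      ultimately show ?thesis
        by simp
    qed
    ultimately show "ennreal (?c powr \<tau> * t powr (- \<tau> / p))
        \<le> enn_powr (rearrangement F t) \<tau> + enn_powr (rearrangement G t) \<tau>"
      by (metis ennreal_leI order_trans)
  next
    show "a \<le> (1 / 2) ^ 4"
      unfolding a_def by (intro power_decreasing) auto
  qed (use assms in \<open>auto simp: a_def power_le_one\<close>)
  moreover have "ln ((1 / 2) ^ n) = - real n * ln 2" for n
    by (simp add: ln_realpow ln_div)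
  then have "ln ((1 / 2) ^ 4) - ln a = (real L + 1) * ln 2"
    unfolding a_def by (simp only:) (simp add: algebra_simps)
  ultimately show ?thesis
    by simp
qed

section \<open>Placing spectra inside dyadic blocks\<close>

lemma floor_two_powr_pred:
  assumes "1 \<le> n"
  shows "\<lfloor>2 powr (real n - 1)\<rfloor> = 2 ^ (n - 1)"
proof -
  have "2 powr (real n - 1) = (2 :: real) ^ (n - 1)"
    using assms by (simp add: of_nat_diff flip: powr_realpow)
  also have "\<dots> = real_of_int (2 ^ (n - 1))"
    by simp
  finally show ?thesis
    by (simp only: floor_of_int)
qed

lemma dyadic_block_iff:
  assumes "\<And>j. 1 \<le> s $ j"
  shows "k \<in> dyadic_block s \<longleftrightarrow> (\<forall>j. 2 ^ (s $ j - 1) \<le> \<bar>k $ j\<bar> \<and> \<bar>k $ j\<bar> < 2 ^ (s $ j))"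
  using floor_two_powr_pred[OF assms] by (simp add: dyadic_block_def)

lemma uminus_dyadic_block: "k \<in> dyadic_block s \<Longrightarrow> - k \<in> dyadic_block s"
  by (simp add: dyadic_block_def)

text \<open>A frequency from a block with positive indices has no vanishing component, which rules
  out a zero in \<open>s'\<close>; after that the dyadic ranges are disjoint in each
  coordinate.\<close>

lemma dyadic_block_unique:
  assumes s: "\<And>j. 1 \<le> s $ j" and k: "k \<in> dyadic_block s" "k \<in> dyadic_block s'"
  shows "s = s'"
proof -
  have s': "1 \<le> s' $ j" for j
  proof (rule ccontr)
    assume "\<not> 1 \<le> s' $ j"
    then have "s' $ j = 0"
      by simp
    moreover have "\<bar>k $ j\<bar> < 2 ^ (s' $ j)"
      using k(2) by (simp add: dyadic_block_def)
    ultimately have "\<bar>k $ j\<bar> < 1"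
      by simp
    moreover have "2 ^ (s $ j - 1) \<le> \<bar>k $ j\<bar>"
      using k(1) s by (simp add: dyadic_block_iff)
    ultimately have "(2 :: int) ^ (s $ j - 1) < 1"
      by linarith
    moreover have "(1 :: int) \<le> 2 ^ (s $ j - 1)"
      by (rule one_le_power) simp
    ultimately show False
      by linarith
  qed
  have le: "s $ j \<le> s' $ j" if "\<And>j. 1 \<le> s $ j" "\<And>j. 1 \<le> s' $ j" "k \<in> dyadic_block s" "k \<in> dyadic_block s'" for s s' :: "nat ^ 'a" and j
  proof (rule ccontr)
    assume "\<not> s $ j \<le> s' $ j"
    then have "(2 :: int) ^ (s' $ j) \<le> 2 ^ (s $ j - 1)"
      by (intro power_increasing) auto
    also have "\<dots> \<le> \<bar>k $ j\<bar>"
      using that by (simp add: dyadic_block_iff)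
    also have "\<dots> < 2 ^ (s' $ j)"
      using that by (simp add: dyadic_block_iff)
    finally show False
      by simp
  qed
  show ?thesis
    using le[OF s s' k] le[OF s' s k(2,1)] by (auto simp: vec_eq_iff intro: antisym)
qed

text \<open>In direction \<open>j\<close> this is the midpoint of the dyadic range, which leaves
  room \<open>2 ^ (s $ j - 2)\<close> on either side for the spike. If \<open>s $ j = 1\<close>
  there is no room, but then the degree parameter \<open>s $ j - 2\<close> truncates to 0 and the
  spike is constant. The other coordinates sit at the lower end of their ranges.\<close>

definition block_center :: "'m \<Rightarrow> nat ^ 'm \<Rightarrow> int ^ 'm" where
  "block_center j s = (\<chi> i. if i = j \<and> 2 \<le> s $ j then 3 * 2 ^ (s $ j - 2) else 2 ^ (s $ i - 1))"

lemma block_center_shift: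
  fixes s :: "nat ^ 'm"
  assumes "\<And>i. 1 \<le> s $ i" "m \<in> {- int (2 ^ (s $ j - 2)) + 1..int (2 ^ (s $ j - 2)) - 1}"
  shows "axis j m + block_center j s \<in> dyadic_block s"
proof -
  have "2 ^ (s $ i - 1) \<le> \<bar>(axis j m + block_center j s) $ i\<bar> \<and> \<bar>(axis j m + block_center j s) $ i\<bar> < 2 ^ (s $ i)" for i
  proof (cases "i = j \<and> 2 \<le> s $ j")
    case True
    define n where "n = s $ j - 2"
    have "s $ j = n + 2"
      using True n_def by linarith
    then have "(2 :: int) ^ (s $ j - 1) = 2 * 2 ^ n" "(2 :: int) ^ (s $ j) = 4 * 2 ^ n"
      by simp_all
    moreover have "(axis j m + block_center j s) $ i = m + 3 * 2 ^ n"
      using True by (simp add: block_center_def axis_def n_def)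
    moreover have "- (2 ^ n) < m" "m < 2 ^ n"
      using assms(2) by (auto simp: n_def)
    ultimately show ?thesis
      using True by auto
  next
    \<comment> \<open>This includes \<open>i = j\<close> with \<open>s $ j = 1\<close>, where the
      admissible interval for \<open>m\<close> shrinks to 0.\<close>
    case False
    have "(axis j m + block_center j s) $ i = 2 ^ (s $ i - 1)"
    proof (cases "i = j")
      case True
      then have "s $ j = 1"
        using False assms(1)[of j] by simp
      then show ?thesis
        using True assms(2) by (simp add: block_center_def axis_def)
    qed (simp add: block_center_def axis_def)
    moreover have "(2 :: int) ^ (s $ i - 1) < 2 ^ (s $ i)"
      using assms(1)[of i] by (intro power_strict_increasing) auto
    ultimately show ?thesis
      by simp
  qed
  then show ?thesis
    using assms(1) by (simp add: dyadic_block_iff)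
qed

text \<open>The second function is the conjugate of the first, as the spike is real. It stays in the
  block because the block and the spectrum of the spike are symmetric; with both, real and imaginary
  parts are available.\<close>

lemma modulated_spike_trig_poly:
  fixes s :: "nat ^ 'm"
  assumes "\<And>i. 1 \<le> s $ i"
  shows "trig_poly (dyadic_block s) (\<lambda>x. complex_of_real (spike p (s $ j - 2) (x $ j)) * character (block_center j s) x)"
    and "trig_poly (dyadic_block s) (\<lambda>x. complex_of_real (spike p (s $ j - 2) (x $ j)) * cnj (character (block_center j s) x))"
proof -
  show "trig_poly (dyadic_block s) (\<lambda>x. complex_of_real (spike p (s $ j - 2) (x $ j)) * character (block_center j s) x)"
  proof (rule trig_poly_mult[OF spike_trig_poly _ finite_dyadic_block])
    show "trig_poly {block_center j s} (character (block_center j s))"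
      by (intro trig_poly_character) auto
  qed (use block_center_shift[OF assms] in auto)
  show "trig_poly (dyadic_block s) (\<lambda>x. complex_of_real (spike p (s $ j - 2) (x $ j)) * cnj (character (block_center j s) x))"
    unfolding character_minus[symmetric]
  proof (rule trig_poly_mult[OF spike_trig_poly _ finite_dyadic_block])
    show "trig_poly {- block_center j s} (character (- block_center j s))"
      by (intro trig_poly_character) auto
    fix m n assume "m \<in> axis j ` {- int (2 ^ (s $ j - 2)) + 1..int (2 ^ (s $ j - 2)) - 1}" "n \<in> {- block_center j s}"
    then obtain i where i: "i \<in> {- int (2 ^ (s $ j - 2)) + 1..int (2 ^ (s $ j - 2)) - 1}" "m + n = axis j i - block_center j s"
      by auto
    then have "- (axis j (- i) + block_center j s) \<in> dyadic_block s"
      by (intro uminus_dyadic_block block_center_shift assms) auto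
    moreover have "- (axis j (- i) + block_center j s) = m + n"
      unfolding i by (simp add: vec_eq_iff axis_def)
    ultimately show "m + n \<in> dyadic_block s"
      by simp
  qed
qed

text \<open>The real and the imaginary part of a modulated spike are both dominated by the spike, and at
  least one of them has a Lorentz norm comparable to it; this avoids estimating level sets of
  \<open>spike\<close> times a cosine.\<close>
lemma extremal_block_poly:
  assumes "1 < p" "0 < \<tau>\<^sub>1" "0 < \<tau>\<^sub>2"
  shows "\<exists>C>0. \<exists>c>0. \<forall>s :: nat ^ 'm. (\<forall>i. 1 \<le> s $ i) \<longrightarrow> (\<exists>T :: real ^ 'm \<Rightarrow> real.
     trig_poly (dyadic_block s) (\<lambda>x. complex_of_real (T x)) \<and>
     lorentz_norm p \<tau>\<^sub>1 T \<le> ennreal (C * block_weight s powr (1 / \<tau>\<^sub>1)) \<and>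
     ennreal (c * block_weight s powr (1 / \<tau>\<^sub>2)) \<le> lorentz_norm p \<tau>\<^sub>2 T)"
proof -
  define C0 where "C0 = spike_bound p powr \<tau>\<^sub>1 * (1 + \<tau>\<^sub>1 / p)"
  \<comment> \<open>The 6 is 3 from comparing \<open>block_weight s\<close> with
    \<open>L + 1\<close>, times 2 because the lower bound is shared by two functions.\<close>
  define c0 where "c0 = \<tau>\<^sub>2 / p * ((32 powr (- 1 / p) / 16) powr \<tau>\<^sub>2 * ln 2) / (6 * real CARD('m))"
  have "0 < C0" "0 < c0"
    using assms spike_bound_pos[of p] by (auto simp: C0_def c0_def intro!: mult_pos_pos add_pos_pos divide_pos_pos)
  have "\<exists>T :: real ^ 'm \<Rightarrow> real. trig_poly (dyadic_block s) (\<lambda>x. complex_of_real (T x)) \<and>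
     lorentz_norm p \<tau>\<^sub>1 T \<le> ennreal (C0 powr (1 / \<tau>\<^sub>1) * block_weight s powr (1 / \<tau>\<^sub>1)) \<and>
     ennreal (c0 powr (1 / \<tau>\<^sub>2) * block_weight s powr (1 / \<tau>\<^sub>2)) \<le> lorentz_norm p \<tau>\<^sub>2 T"
    if s: "\<forall>i. 1 \<le> s $ i" for s :: "nat ^ 'm"
  proof -
    have "Max (range (\<lambda>i. s $ i)) \<in> range (\<lambda>i. s $ i)"
      by (intro Max_in) auto
    then obtain j where "Max (range (\<lambda>i. s $ i)) = s $ j"
      by (rule imageE)
    then have j: "s $ i \<le> s $ j" for i
      by (metis Max_ge finite finite_imageI rangeI)
    define L where "L = s $ j - 2"
    have L_le: "real L + 1 \<le> block_weight s"
    proof -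
      have "real (s $ j) + 1 \<le> block_weight s"
        unfolding block_weight_def by (intro member_le_sum) auto
      then show ?thesis
        by (simp add: L_def)
    qed
    \<comment> \<open>The factor 3 is what \<open>s $ j = 2\<close> requires, where
      \<open>L = 0\<close>; for \<open>s $ j = 1\<close> truncation also gives
      \<open>L = 0\<close>.\<close>
    have le_L: "block_weight s \<le> 3 * real CARD('m) * (real L + 1)"
    proof -
      have "block_weight s \<le> (\<Sum>i\<in>(UNIV :: 'm set). real (s $ j) + 1)"
        unfolding block_weight_def using j by (intro sum_mono) simp
      also have "\<dots> = real CARD('m) * (real (s $ j) + 1)"
        by simp
      also have "real (s $ j) + 1 \<le> 3 * (real L + 1)"
        by (simp add: L_def)
      finally show ?thesis
        by (simp add: mult_ac)
    qed
    define E where "E x = complex_of_real (spike p L (x $ j)) * character (block_center j s) x" for x :: "real ^ 'm"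
    define T1 where "T1 x = Re (E x)" for x
    define T2 where "T2 x = Im (E x)" for x
    have E: "trig_poly (dyadic_block s) E" "trig_poly (dyadic_block s) (\<lambda>x. cnj (E x))"
      using modulated_spike_trig_poly[of s p j] s by (auto simp: E_def[abs_def] L_def)
    have normE: "norm (E x) = spike p L (x $ j)" for x
      using spike_nonneg[of p L "x $ j"] by (simp add: E_def norm_mult)
    have T_eq: "(\<lambda>x. complex_of_real (T1 x)) = (\<lambda>x. 1 / 2 * E x + 1 / 2 * cnj (E x))"
        "(\<lambda>x. complex_of_real (T2 x)) = (\<lambda>x. - \<i> / 2 * E x + \<i> / 2 * cnj (E x))"
      by (auto simp: T1_def T2_def complex_eq_iff)
    have T: "trig_poly (dyadic_block s) (\<lambda>x. complex_of_real (T1 x))" "trig_poly (dyadic_block s) (\<lambda>x. complex_of_real (T2 x))"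
      unfolding T_eq by (rule trig_poly_add[OF trig_poly_scale trig_poly_scale]; rule E)+
    have "continuous_on UNIV T1" "continuous_on UNIV T2"
      unfolding T1_def[abs_def] T2_def[abs_def] by (rule continuous_on_Re continuous_on_Im, rule trig_poly_continuous[OF E(1)])+
    then have meas: "T1 \<in> borel_measurable borel" "T2 \<in> borel_measurable borel"
      by (auto intro: borel_measurable_continuous_onI)
    have upper: "lorentz_norm p \<tau>\<^sub>1 F \<le> ennreal (C0 powr (1 / \<tau>\<^sub>1) * block_weight s powr (1 / \<tau>\<^sub>1))"
      if "F = T1 \<or> F = T2" for F
    proof -
      have "enn_powr (lorentz_norm p \<tau>\<^sub>1 F) \<tau>\<^sub>1 \<le> ennreal (spike_bound p powr \<tau>\<^sub>1 * (1 + \<tau>\<^sub>1 / p * (real L * ln 2)))"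
      proof (rule lorentz_norm_le_of_spike)
        show "\<bar>F x\<bar> \<le> spike p L (x $ j)" for x
          using that abs_Re_le_cmod[of "E x"] abs_Im_le_cmod[of "E x"] by (auto simp: T1_def T2_def normE)
      qed (use assms in auto)
      also have "\<dots> \<le> ennreal (C0 * block_weight s)"
      proof (rule ennreal_leI)
        have "real L * ln 2 \<le> block_weight s"
          using L_le ln_2_less_1 mult_left_mono[of "ln 2" 1 "real L"] by simp
        then have "1 + \<tau>\<^sub>1 / p * (real L * ln 2) \<le> block_weight s + \<tau>\<^sub>1 / p * block_weight s"
          using assms block_weight_ge_1[of s] by (intro add_mono mult_left_mono) auto
        then show "spike_bound p powr \<tau>\<^sub>1 * (1 + \<tau>\<^sub>1 / p * (real L * ln 2)) \<le> C0 * block_weight s"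
          unfolding C0_def mult.assoc by (intro mult_left_mono) (auto simp: distrib_right)
      qed
      finally have "lorentz_norm p \<tau>\<^sub>1 F \<le> ennreal ((C0 * block_weight s) powr (1 / \<tau>\<^sub>1))"
        using assms \<open>0 < C0\<close> block_weight_ge_1[of s] by (intro le_of_enn_powr_le) auto
      then show ?thesis
        by (simp add: powr_mult)
    qed
    have "ennreal (c0 * block_weight s) + ennreal (c0 * block_weight s)
        \<le> ennreal (\<tau>\<^sub>2 / p * ((32 powr (- 1 / p) / 16) powr \<tau>\<^sub>2 * ((real L + 1) * ln 2)))"
    proof -
      have "c0 * block_weight s + c0 * block_weight s \<le> c0 * (6 * real CARD('m) * (real L + 1))"
        using mult_left_mono[OF le_L, of "2 * c0"] \<open>0 < c0\<close> by (simp add: algebra_simps)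
      also have "\<dots> = \<tau>\<^sub>2 / p * ((32 powr (- 1 / p) / 16) powr \<tau>\<^sub>2 * ((real L + 1) * ln 2))"
        by (simp add: c0_def)
      finally show ?thesis
        using \<open>0 < c0\<close> block_weight_ge_1[of s] by (simp add: ennreal_leI flip: ennreal_plus)
    qed
    also have "\<dots> \<le> enn_powr (lorentz_norm p \<tau>\<^sub>2 T1) \<tau>\<^sub>2 + enn_powr (lorentz_norm p \<tau>\<^sub>2 T2) \<tau>\<^sub>2"
    proof (rule lorentz_norm_pair_ge_of_spike)
      show "spike p L (x $ j) \<le> \<bar>T1 x\<bar> + \<bar>T2 x\<bar>" for x
        using cmod_le[of "E x"] by (simp add: T1_def T2_def normE)
    qed (use assms meas in auto)
    finally have "\<not> (enn_powr (lorentz_norm p \<tau>\<^sub>2 T1) \<tau>\<^sub>2 < ennreal (c0 * block_weight s)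
        \<and> enn_powr (lorentz_norm p \<tau>\<^sub>2 T2) \<tau>\<^sub>2 < ennreal (c0 * block_weight s))"
      using add_strict_mono leD by blast
    then obtain F where F: "F = T1 \<or> F = T2" "ennreal (c0 * block_weight s) \<le> enn_powr (lorentz_norm p \<tau>\<^sub>2 F) \<tau>\<^sub>2"
      using not_le by blast
    have "ennreal ((c0 * block_weight s) powr (1 / \<tau>\<^sub>2)) \<le> enn_powr (enn_powr (lorentz_norm p \<tau>\<^sub>2 F) \<tau>\<^sub>2) (1 / \<tau>\<^sub>2)"
      using enn_powr_mono[OF F(2), of "1 / \<tau>\<^sub>2"] assms \<open>0 < c0\<close> block_weight_ge_1[of s]
      by (simp add: enn_powr_ennreal)
    then have "ennreal (c0 powr (1 / \<tau>\<^sub>2) * block_weight s powr (1 / \<tau>\<^sub>2)) \<le> lorentz_norm p \<tau>\<^sub>2 F"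
      using assms by (simp add: enn_powr_enn_powr powr_mult)
    then show ?thesis
      using F(1) T upper[OF F(1)] by blast
  qed
  moreover have "0 < C0 powr (1 / \<tau>\<^sub>1)" "0 < c0 powr (1 / \<tau>\<^sub>2)"
    using \<open>0 < C0\<close> \<open>0 < c0\<close> by auto
  ultimately show ?thesis
    by blast
qed

section \<open>Weighted sequence norms\<close>

lemma infsum_ennreal_eq_SUP: "infsum (f :: 'a \<Rightarrow> ennreal) A = (SUP F\<in>{F. finite F \<and> F \<subseteq> A}. sum f F)"
  by (rule nonneg_infsum_complete) simp

lemma sum_le_infsum_ennreal: "finite F \<Longrightarrow> F \<subseteq> A \<Longrightarrow> sum f F \<le> infsum (f :: 'a \<Rightarrow> ennreal) A"
  unfolding infsum_ennreal_eq_SUP by (intro SUP_upper) simp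

lemma infsum_ennreal_leI: "(\<And>F. finite F \<Longrightarrow> F \<subseteq> A \<Longrightarrow> sum f F \<le> b) \<Longrightarrow> infsum (f :: 'a \<Rightarrow> ennreal) A \<le> b"
  unfolding infsum_ennreal_eq_SUP by (intro SUP_least) simp

lemma infsum_ennreal_mono: "(\<And>x. x \<in> A \<Longrightarrow> f x \<le> g x) \<Longrightarrow> infsum (f :: 'a \<Rightarrow> ennreal) A \<le> infsum g A"
  unfolding infsum_ennreal_eq_SUP by (intro SUP_mono) (auto intro!: sum_mono)

lemma infsum_ennreal_cmult: "infsum (\<lambda>x. c * f x) A = c * infsum (f :: 'a \<Rightarrow> ennreal) A"
  unfolding infsum_ennreal_eq_SUP by (simp add: SUP_mult_left_ennreal sum_distrib_left)

lemma sum_le_of_infsum_le: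
  assumes "\<And>x. 0 \<le> g x" "finite F" "F \<subseteq> A" "infsum (\<lambda>x. ennreal (g x)) A \<le> ennreal B" "0 \<le> B"
  shows "sum g F \<le> B"
proof -
  have "ennreal (sum g F) \<le> ennreal B"
    using order_trans[OF sum_le_infsum_ennreal[OF assms(2,3), of "\<lambda>x. ennreal (g x)"] assms(4)] assms(1)
    by simp
  then show ?thesis
    using assms(5) by (simp add: ennreal_le_iff)
qed

text \<open>The case distinction copies that of \<open>besov_norm\<close>, so that a Besov norm
  becomes an instance once the smoothness weights are moved inside the power.\<close>

definition lq_norm :: "ereal \<Rightarrow> ('a \<Rightarrow> ennreal) \<Rightarrow> ennreal" where
  "lq_norm \<theta> N = (if \<theta> = \<infinity> then (SUP s. N s)
     else enn_powr (\<Sum>\<^sub>\<infinity>s. enn_powr (N s) (real_of_ereal \<theta>)) (1 / real_of_ereal \<theta>))"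

lemma lq_norm_infinity: "lq_norm \<infinity> N = (SUP s. N s)"
  by (simp add: lq_norm_def)

lemma lq_norm_ereal: "lq_norm (ereal q) N = enn_powr (\<Sum>\<^sub>\<infinity>s. enn_powr (N s) q) (1 / q)"
  by (simp add: lq_norm_def)

lemma pos_ereal_cases:
  assumes "0 < (\<theta> :: ereal)"
  obtains "\<theta> = \<infinity>" | q where "0 < q" "\<theta> = ereal q"
  using assms by (cases \<theta>) auto

lemma lq_norm_mono:
  assumes "0 < \<theta>" "\<And>s. N s \<le> M s"
  shows "lq_norm \<theta> N \<le> lq_norm \<theta> M"
  using assms(1)
proof (cases rule: pos_ereal_cases)
  case 1
  then show ?thesis
    using assms by (simp add: lq_norm_infinity SUP_mono')
next
  case (2 q)
  then show ?thesis
    using assms by (auto simp: lq_norm_ereal intro!: enn_powr_mono infsum_ennreal_mono)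
qed

lemma lq_norm_cmult:
  assumes "0 < \<theta>" "0 \<le> c"
  shows "lq_norm \<theta> (\<lambda>s. ennreal c * N s) = ennreal c * lq_norm \<theta> N"
  using assms(1)
proof (cases rule: pos_ereal_cases)
  case 1
  then show ?thesis
    by (simp add: lq_norm_infinity SUP_mult_left_ennreal)
next
  case (2 q)
  then show ?thesis
    using assms by (simp add: lq_norm_ereal enn_powr_mult infsum_ennreal_cmult powr_powr)
qed

lemma component_le_lq_norm:
  assumes "0 < \<theta>"
  shows "N s \<le> lq_norm \<theta> N"
  using assms
proof (cases rule: pos_ereal_cases)
  case 1
  then show ?thesis
    by (simp add: lq_norm_infinity SUP_upper)
next
  case (2 q)
  have "enn_powr (N s) q \<le> (\<Sum>\<^sub>\<infinity>s. enn_powr (N s) q)"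
    using sum_le_infsum_ennreal[of "{s}" UNIV "\<lambda>s. enn_powr (N s) q"] by simp
  then have "enn_powr (enn_powr (N s) q) (1 / q) \<le> lq_norm \<theta> N"
    unfolding 2 lq_norm_ereal using 2 by (intro enn_powr_mono) auto
  then show ?thesis
    using 2 by (simp add: enn_powr_enn_powr)
qed

text \<open>Finiteness turns the extended-valued family into a real one with bounded partial sums,
  so that inequalities can be proved for finite real sums only.\<close>

lemma lq_norm_finite_cases:
  assumes "0 < q" "lq_norm (ereal q) N < top"
  obtains n U where "N = (\<lambda>s. ennreal (n s))" "\<And>s. 0 \<le> n s" "0 \<le> U"
    "lq_norm (ereal q) N = ennreal (U powr (1 / q))" "\<And>F. finite F \<Longrightarrow> (\<Sum>s\<in>F. n s powr q) \<le> U"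
proof -
  have "N s < top" for s
    using component_le_lq_norm[of "ereal q" N s] assms by (simp add: le_less_trans)
  then have N: "N s = ennreal (enn2real (N s))" for s
    by simp
  have "infsum (\<lambda>s. enn_powr (N s) q) UNIV < top"
    using assms(2) by (simp add: lq_norm_ereal enn_powr_eq_top_iff less_top[symmetric])
  then obtain U where U: "0 \<le> U" "infsum (\<lambda>s. enn_powr (N s) q) UNIV = ennreal U"
    by (cases "infsum (\<lambda>s. enn_powr (N s) q) UNIV") auto
  have "enn_powr (N s) q = ennreal (enn2real (N s) powr q)" for s
    by (subst N) (simp add: enn_powr_ennreal)
  then have "(\<Sum>s\<in>F. enn2real (N s) powr q) \<le> U" if "finite F" for F
    using U that by (intro sum_le_of_infsum_le[of _ F UNIV]) auto
  moreover have "lq_norm (ereal q) N = ennreal (U powr (1 / q))"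
    using U by (simp add: lq_norm_ereal enn_powr_ennreal)
  ultimately show ?thesis
    using that[of "\<lambda>s. enn2real (N s)" U] N U by auto
qed

lemma lq_norm_le_ennrealI:
  assumes "0 < q" "\<And>s. 0 \<le> n s" "0 \<le> B" "\<And>F. finite F \<Longrightarrow> (\<Sum>s\<in>F. n s powr q) \<le> B"
  shows "lq_norm (ereal q) (\<lambda>s. ennreal (n s)) \<le> ennreal (B powr (1 / q))"
proof -
  have "infsum (\<lambda>s. enn_powr (ennreal (n s)) q) UNIV \<le> ennreal B"
    using assms by (intro infsum_ennreal_leI) (simp add: enn_powr_ennreal ennreal_leI)
  then have "enn_powr (infsum (\<lambda>s. enn_powr (ennreal (n s)) q) UNIV) (1 / q) \<le> enn_powr (ennreal B) (1 / q)"
    using assms by (intro enn_powr_mono) auto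
  then show ?thesis
    using assms by (simp add: lq_norm_ereal enn_powr_ennreal)
qed

text \<open>Each single term \<open>n s powr q1\<close> is at most the bound \<open>U\<close> for
  all partial sums, so the excess power in \<open>n s powr q2\<close> costs at most
  \<open>U powr (q2 / q1 - 1)\<close>.\<close>

lemma lq_norm_antimono:
  assumes "0 < \<theta>\<^sub>1" "\<theta>\<^sub>1 \<le> \<theta>\<^sub>2"
  shows "lq_norm \<theta>\<^sub>2 N \<le> lq_norm \<theta>\<^sub>1 N"
proof (cases "\<theta>\<^sub>2 = \<infinity>")
  case True
  then show ?thesis
    using component_le_lq_norm[OF assms(1), of N] by (auto simp: lq_norm_infinity intro: SUP_least)
next
  case False
  then obtain q1 q2 where q: "\<theta>\<^sub>1 = ereal q1" "\<theta>\<^sub>2 = ereal q2" "0 < q1" "q1 \<le> q2"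
    using assms by (cases \<theta>\<^sub>1; cases \<theta>\<^sub>2) auto
  show ?thesis
  proof (cases "lq_norm \<theta>\<^sub>1 N < top")
    case True
    then obtain n U where n: "N = (\<lambda>s. ennreal (n s))" "\<And>s. 0 \<le> n s" "0 \<le> U"
      "lq_norm (ereal q1) N = ennreal (U powr (1 / q1))" "\<And>F. finite F \<Longrightarrow> (\<Sum>s\<in>F. n s powr q1) \<le> U"
      using lq_norm_finite_cases[OF q(3), of N] unfolding q by blast
    have "(\<Sum>s\<in>F. n s powr q2) \<le> U powr (q2 / q1)" if "finite F" for F
    proof -
      have "n s powr q2 \<le> n s powr q1 * U powr (q2 / q1 - 1)" for s
      proof -
        have "n s powr q1 \<le> U"
          using n(5)[of "{s}"] by simp
        then have "(n s powr q1) powr (q2 / q1 - 1) \<le> U powr (q2 / q1 - 1)"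
          using q by (intro powr_mono2) auto
        then have "n s powr q1 * (n s powr q1) powr (q2 / q1 - 1) \<le> n s powr q1 * U powr (q2 / q1 - 1)"
          by (rule mult_left_mono) simp
        moreover have "n s powr q1 * (n s powr q1) powr (q2 / q1 - 1) = n s powr q2"
          using q by (simp add: powr_powr right_diff_distrib flip: powr_add)
        ultimately show ?thesis
          by simp
      qed
      then have "(\<Sum>s\<in>F. n s powr q2) \<le> (\<Sum>s\<in>F. n s powr q1) * U powr (q2 / q1 - 1)"
        unfolding sum_distrib_right by (rule sum_mono)
      also have "\<dots> \<le> U * U powr (q2 / q1 - 1)"
        using n(5)[OF that] by (rule mult_right_mono) simp
      also have "\<dots> = U powr (q2 / q1)"
        using n(3) by (simp add: powr_mult_base)
      finally show ?thesis .
    qed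
    then have "lq_norm \<theta>\<^sub>2 N \<le> ennreal ((U powr (q2 / q1)) powr (1 / q2))"
      unfolding q n(1) using n q by (intro lq_norm_le_ennrealI) auto
    then show ?thesis
      unfolding q n(4) using q by (simp add: powr_powr)
  next
    case False
    then show ?thesis
      by (simp add: less_top[symmetric])
  qed
qed

text \<open>Young's inequality with its weights \<alpha> and 1 - \<alpha> dropped; constants do not
  matter below.\<close>

lemma powr_mult_powr_le_add:
  fixes x y \<alpha> :: real
  assumes "0 \<le> x" "0 \<le> y" "0 \<le> \<alpha>" "\<alpha> \<le> 1"
  shows "x powr \<alpha> * y powr (1 - \<alpha>) \<le> x + y"
proof -
  have "x powr \<alpha> * y powr (1 - \<alpha>) \<le> (x + y) powr \<alpha> * (x + y) powr (1 - \<alpha>)"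
    using assms by (intro mult_mono powr_mono2) auto
  also have "\<dots> = x + y"
    using assms by (simp flip: powr_add)
  finally show ?thesis .
qed

text \<open>\<open>\<kappa>\<close> stands for \<open>1/\<theta>\<^sub>1\<close>, which is \<open>0\<close> for \<open>\<theta>\<^sub>1 = \<infinity>\<close>.\<close>
definition inverse_index :: "ereal \<Rightarrow> real \<Rightarrow> bool" where
  "inverse_index \<theta> \<kappa> \<longleftrightarrow> \<theta> = \<infinity> \<and> \<kappa> = 0 \<or> 0 < \<kappa> \<and> \<theta> = ereal (1 / \<kappa>)"

text \<open>For \<kappa> > 0 Young's inequality is applied termwise with exponents \<alpha> = q
  \<kappa> and 1 - \<alpha>; the relation between \<open>q\<close>, \<open>r\<close> and \<kappa> is
  exactly \<open>r * (1 - \<alpha>) = q\<close>. For \<kappa> = 0 one has \<open>r = q\<close>, and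
  \<open>N\<close> is simply replaced by its supremum.\<close>

lemma lq_norm_Hoelder:
  assumes "0 < q" "0 < r" "inverse_index \<theta> \<kappa>" "1 / r = 1 / q - \<kappa>"
    and v: "\<And>s. 0 \<le> v s" "\<And>F. finite F \<Longrightarrow> (\<Sum>s\<in>F. v s powr r) \<le> V"
  shows "\<exists>C>0. \<forall>N. lq_norm (ereal q) (\<lambda>s. ennreal (v s) * N s) \<le> ennreal C * lq_norm \<theta> N"
proof -
  \<comment> \<open>\<open>V\<close> may be 0, and the argument divides by it.\<close>
  define V' where "V' = V + 1"
  have "0 \<le> V"
    using v(2)[of "{}"] by simp
  then have "0 < V'" "V \<le> V'"
    by (auto simp: V'_def)
  define C where "C = (2 * V') powr (1 / q) * V' powr (- \<kappa>)"
  have "0 < C"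
    using \<open>0 < V'\<close> by (simp add: C_def)
  have "lq_norm (ereal q) (\<lambda>s. ennreal (v s) * N s) \<le> ennreal C * lq_norm \<theta> N" for N
  proof (cases "lq_norm \<theta> N < top")
    case False
    then show ?thesis
      using \<open>0 < C\<close> by (simp add: less_top[symmetric] ennreal_mult_top)
  next
    case fin: True
    consider "\<theta> = \<infinity>" "\<kappa> = 0" | "0 < \<kappa>" "\<theta> = ereal (1 / \<kappa>)"
      using assms(3) by (auto simp: inverse_index_def)
    then show ?thesis
    proof cases
      case 1
      then have "r = q"
        using assms by simp
      obtain B where B: "0 \<le> B" "lq_norm \<theta> N = ennreal B"
        using fin by (cases "lq_norm \<theta> N") auto
      have "N s \<le> ennreal B" for s
        using component_le_lq_norm[of \<theta> N s] B 1 by simp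
      then have "lq_norm (ereal q) (\<lambda>s. ennreal (v s) * N s) \<le> lq_norm (ereal q) (\<lambda>s. ennreal B * ennreal (v s))"
        using assms by (intro lq_norm_mono) (auto simp: mult.commute intro!: mult_right_mono)
      also have "\<dots> = ennreal B * lq_norm (ereal q) (\<lambda>s. ennreal (v s))"
        using assms B by (intro lq_norm_cmult) auto
      also have "\<dots> \<le> ennreal B * ennreal ((2 * V') powr (1 / q))"
      proof (intro mult_left_mono lq_norm_le_ennrealI)
        fix F :: "'a set" assume "finite F"
        then show "(\<Sum>s\<in>F. v s powr q) \<le> 2 * V'"
          using v(2)[of F] \<open>0 < V'\<close> \<open>V \<le> V'\<close> \<open>r = q\<close> by simp
      qed (use assms v \<open>0 < V'\<close> in auto)
      finally show ?thesis
        using \<open>0 < V'\<close> unfolding C_def B(2) \<open>\<kappa> = 0\<close> by (simp add: mult.commute)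
    next
      case 2
      define q1 where "q1 = 1 / \<kappa>"
      have q1: "0 < q1" "\<theta> = ereal q1" "\<kappa> = 1 / q1"
        using 2 by (auto simp: q1_def)
      define \<alpha> where "\<alpha> = q / q1"
      have "1 / q - \<kappa> > 0"
        using assms(2) by (simp flip: assms(4))
      then have "q < q1"
        using assms(1) q1 by (simp add: field_simps)
      then have \<alpha>: "0 < \<alpha>" "\<alpha> < 1"
        using assms(1) q1 by (auto simp: \<alpha>_def)
      have "r * (1 - \<alpha>) = q"
        using assms q1 by (simp add: \<alpha>_def field_simps)
      obtain n U where n: "N = (\<lambda>s. ennreal (n s))" "\<And>s. 0 \<le> n s" "0 \<le> U"
        "lq_norm \<theta> N = ennreal (U powr (1 / q1))" "\<And>F. finite F \<Longrightarrow> (\<Sum>s\<in>F. n s powr q1) \<le> U"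
        using lq_norm_finite_cases[OF q1(1), of N] fin unfolding q1(2) by blast
      have "(\<Sum>s\<in>F. (v s * n s) powr q) \<le> 2 * V' * (U / V') powr \<alpha>" if "finite F" for F
      proof (cases "U = 0")
        case True
        then have "n s powr q1 \<le> 0" for s
          using n(5)[of "{s}"] by simp
        then have "n s = 0" for s
          using powr_le_cancel_iff by (metis less_le_not_le n(2) order_le_less powr_gt_zero)
        then show ?thesis
          using \<open>0 < V'\<close> by simp
      next
        case False
        then have "0 < U"
          using n by simp
        \<comment> \<open>With this scaling \<open>c * U = V'\<close>, so the two sums have the same
          bound; it replaces normalising both sequences.\<close>
        define c where "c = V' / U"
        have "0 < c"
          using \<open>0 < U\<close> \<open>0 < V'\<close> by (simp add: c_def)
        have "(v s * n s) powr q \<le> c powr (- \<alpha>) * (c * n s powr q1 + v s powr r)" for s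
        proof -
          have "(v s * n s) powr q = (n s powr q1) powr \<alpha> * (v s powr r) powr (1 - \<alpha>)"
            using \<open>r * (1 - \<alpha>) = q\<close> q1 by (simp add: powr_mult powr_powr \<alpha>_def mult.commute)
          also have "\<dots> = c powr (- \<alpha>) * ((c * n s powr q1) powr \<alpha> * (v s powr r) powr (1 - \<alpha>))"
            using \<open>0 < c\<close> by (simp add: powr_mult powr_minus)
          also have "\<dots> \<le> c powr (- \<alpha>) * (c * n s powr q1 + v s powr r)"
            using \<open>0 < c\<close> \<alpha> by (intro mult_left_mono powr_mult_powr_le_add) auto
          finally show ?thesis .
        qed
        then have "(\<Sum>s\<in>F. (v s * n s) powr q) \<le> (\<Sum>s\<in>F. c powr (- \<alpha>) * (c * n s powr q1 + v s powr r))"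
          by (rule sum_mono)
        also have "\<dots> = c powr (- \<alpha>) * (c * (\<Sum>s\<in>F. n s powr q1) + (\<Sum>s\<in>F. v s powr r))"
          by (simp add: sum.distrib flip: sum_distrib_left)
        also have "\<dots> \<le> c powr (- \<alpha>) * (c * U + V')"
          using n(5)[OF that] v(2)[OF that] \<open>0 < c\<close> \<open>V \<le> V'\<close> by (intro mult_left_mono add_mono) auto
        also have "\<dots> = 2 * V' * (U / V') powr \<alpha>"
          using \<open>0 < U\<close> \<open>0 < V'\<close> by (simp add: c_def powr_minus powr_divide)
        finally show ?thesis .
      qed
      then have "lq_norm (ereal q) (\<lambda>s. ennreal (v s * n s)) \<le> ennreal ((2 * V' * (U / V') powr \<alpha>) powr (1 / q))"
        using assms n v \<open>0 < V'\<close> by (intro lq_norm_le_ennrealI) auto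
      also have "(2 * V' * (U / V') powr \<alpha>) powr (1 / q) = C * U powr (1 / q1)"
      proof -
        have "\<alpha> * (1 / q) = \<kappa>"
          using assms(1) q1 by (simp add: \<alpha>_def)
        then have "(2 * V' * (U / V') powr \<alpha>) powr (1 / q) = (2 * V') powr (1 / q) * (U / V') powr \<kappa>"
          by (simp add: powr_mult powr_powr)
        moreover have "(U / V') powr \<kappa> = V' powr (- \<kappa>) * U powr \<kappa>"
          by (simp add: powr_divide powr_minus_divide)
        ultimately show ?thesis
          unfolding q1(3)[symmetric] by (simp only: C_def mult.assoc)
      qed
      finally show ?thesis
        using v n \<open>0 < C\<close> by (simp add: ennreal_mult)
    qed
  qed
  then show ?thesis
    using \<open>0 < C\<close> by blast
qed

text \<open>The extremal coefficients of Hoelder's inequality: \<open>u = v\<close>\<open>\<^sup>r\<^sup>\<kappa>\<close>.\<close>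
lemma lq_Hoelder_converse:
  assumes "0 < q" "0 < r" "inverse_index \<theta> \<kappa>" "1 / r = 1 / q - \<kappa>" "0 \<le> D"
    and F: "finite F" "F \<noteq> {}" and v: "\<And>s. s \<in> F \<Longrightarrow> 0 < v s"
    and D: "lq_norm (ereal q) (\<lambda>s. ennreal (if s \<in> F then v s * v s powr (r * \<kappa>) else 0))
      \<le> ennreal D * lq_norm \<theta> (\<lambda>s. ennreal (if s \<in> F then v s powr (r * \<kappa>) else 0))"
  shows "(\<Sum>s\<in>F. v s powr r) \<le> D powr r"
proof -
  define S where "S = (\<Sum>s\<in>F. v s powr r)"
  have "0 < S"
    unfolding S_def using F v by (intro sum_pos) (auto simp: order_less_imp_not_eq2)
  have sumF: "infsum (\<lambda>s. enn_powr (ennreal (if s \<in> F then g s else 0)) a) UNIV = ennreal (\<Sum>s\<in>F. g s powr a)"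
    if "\<And>s. s \<in> F \<Longrightarrow> 0 \<le> g s" for g :: "'a \<Rightarrow> real" and a
  proof -
    have "infsum (\<lambda>s. enn_powr (ennreal (if s \<in> F then g s else 0)) a) UNIV = infsum (\<lambda>s. ennreal (g s powr a)) F"
      using that by (intro infsum_cong_neutral) (auto simp: enn_powr_ennreal)
    then show ?thesis
      using F by simp
  qed
  have "lq_norm (ereal q) (\<lambda>s. ennreal (if s \<in> F then v s * v s powr (r * \<kappa>) else 0)) = ennreal (S powr (1 / q))"
  proof -
    have "(1 + r * \<kappa>) * q = r"
      using assms(1,2,4) by (simp add: field_simps)
    then have "(v s * v s powr (r * \<kappa>)) powr q = v s powr r" if "s \<in> F" for s
      using v[OF that] by (simp add: powr_mult_base powr_powr)
    then show ?thesis
      using v \<open>0 < S\<close> unfolding lq_norm_ereal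
      by (subst sumF) (auto simp: less_imp_le S_def[symmetric] enn_powr_ennreal cong: sum.cong)
  qed
  moreover have "lq_norm \<theta> (\<lambda>s. ennreal (if s \<in> F then v s powr (r * \<kappa>) else 0)) \<le> ennreal (S powr \<kappa>)"
  proof -
    consider "\<theta> = \<infinity>" "\<kappa> = 0" | "0 < \<kappa>" "\<theta> = ereal (1 / \<kappa>)"
      using assms(3) by (auto simp: inverse_index_def)
    then show ?thesis
    proof cases
      case 1
      then show ?thesis
        using v \<open>0 < S\<close> by (auto simp: lq_norm_infinity intro!: SUP_least)
    next
      case 2
      then have "lq_norm \<theta> (\<lambda>s. ennreal (if s \<in> F then v s powr (r * \<kappa>) else 0))
          = enn_powr (ennreal (\<Sum>s\<in>F. (v s powr (r * \<kappa>)) powr (1 / \<kappa>))) \<kappa>"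
        unfolding 2(2) lq_norm_ereal by (subst sumF) auto
      also have "(\<Sum>s\<in>F. (v s powr (r * \<kappa>)) powr (1 / \<kappa>)) = S"
        using 2 by (simp add: S_def powr_powr)
      finally show ?thesis
        using \<open>0 < S\<close> by (simp add: enn_powr_ennreal)
    qed
  qed
  ultimately have "ennreal (S powr (1 / q)) \<le> ennreal D * ennreal (S powr \<kappa>)"
    using D mult_left_mono order_trans by (metis zero_le)
  then have "S powr (1 / q) \<le> D * S powr \<kappa>"
    using assms(5) by (simp add: ennreal_le_iff flip: ennreal_mult)
  moreover have "S powr (1 / q) = S powr (1 / r) * S powr \<kappa>"
    using assms(4) by (simp flip: powr_add)
  ultimately have "S powr (1 / r) \<le> D"
    using \<open>0 < S\<close> by simp
  then have "(S powr (1 / r)) powr r \<le> D powr r"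
    using assms by (intro powr_mono2) auto
  then show ?thesis
    using assms(2) \<open>0 < S\<close> by (simp add: powr_powr S_def)
qed

section \<open>Besov norms\<close>

definition smoothness_weight :: "real ^ 'm \<Rightarrow> nat ^ 'm \<Rightarrow> real" where
  "smoothness_weight b s = (\<Prod>j\<in>UNIV. (real (s $ j) + 1) powr (b $ j))"

lemma smoothness_weight_pos: "0 < smoothness_weight b s"
  unfolding smoothness_weight_def by (intro prod_pos) (auto simp: add_nonneg_pos)

lemma smoothness_weight_diff: "smoothness_weight (b - b') s = smoothness_weight b s / smoothness_weight b' s"
  unfolding smoothness_weight_def by (simp add: powr_diff add_nonneg_pos prod_dividef)

lemma smoothness_weight_powr: "smoothness_weight b s powr r = (\<Prod>j\<in>UNIV. (real (s $ j) + 1) powr (b $ j * r))"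
  unfolding smoothness_weight_def by (simp add: prod_powr_distrib powr_powr)

lemma besov_norm_eq_lq_norm:
  "besov_norm p \<tau> \<theta> b f = lq_norm \<theta> (\<lambda>s. ennreal (smoothness_weight b s) * lorentz_norm p \<tau> (delta_block s f))"
  using smoothness_weight_pos[of b]
  by (simp add: besov_norm_def lq_norm_def Let_def enn_powr_mult smoothness_weight_powr less_imp_le smoothness_weight_def[symmetric])

text \<open>Up to constants, the largest factor by which the component \<open>s\<close> of the
  target norm can exceed that of the source norm: the quotient of the smoothness weights times the
  cost of changing the second Lorentz index.\<close>

definition embedding_weight :: "real ^ 'm \<Rightarrow> real \<Rightarrow> nat ^ 'm \<Rightarrow> real" where
  "embedding_weight \<beta> \<gamma> s = smoothness_weight \<beta> s * block_weight s powr \<gamma>"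

lemma embedding_weight_pos: "0 < embedding_weight \<beta> \<gamma> s"
  using smoothness_weight_pos[of \<beta> s] block_weight_ge_1[of s] by (simp add: embedding_weight_def)

lemma besov_component_le:
  fixes b\<^sub>1 b\<^sub>2 :: "real ^ 'm"
  assumes "0 < p" "0 < \<tau>\<^sub>2" "\<tau>\<^sub>2 < \<tau>\<^sub>1"
  shows "\<exists>C>0. \<forall>f s. ennreal (smoothness_weight b\<^sub>2 s) * lorentz_norm p \<tau>\<^sub>2 (delta_block s f)
    \<le> ennreal C * (ennreal (embedding_weight (b\<^sub>2 - b\<^sub>1) (1 / \<tau>\<^sub>2 - 1 / \<tau>\<^sub>1) s) *
        (ennreal (smoothness_weight b\<^sub>1 s) * lorentz_norm p \<tau>\<^sub>1 (delta_block s f)))"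
proof -
  obtain C where "C > 0" and C: "\<And>(s :: nat ^ 'm) f. trig_poly (dyadic_block s) f \<Longrightarrow>
      lorentz_norm p \<tau>\<^sub>2 f \<le> ennreal (C * block_weight s powr (1 / \<tau>\<^sub>2 - 1 / \<tau>\<^sub>1)) * lorentz_norm p \<tau>\<^sub>1 f"
    using lorentz_norm_block_le[OF assms] by blast
  have "ennreal (smoothness_weight b\<^sub>2 s) * lorentz_norm p \<tau>\<^sub>2 (delta_block s f)
    \<le> ennreal C * (ennreal (embedding_weight (b\<^sub>2 - b\<^sub>1) (1 / \<tau>\<^sub>2 - 1 / \<tau>\<^sub>1) s) *
        (ennreal (smoothness_weight b\<^sub>1 s) * lorentz_norm p \<tau>\<^sub>1 (delta_block s f)))" for f :: "real ^ 'm \<Rightarrow> real" and s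
  proof -
    have "ennreal (smoothness_weight b\<^sub>2 s) * lorentz_norm p \<tau>\<^sub>2 (delta_block s f)
        \<le> ennreal (smoothness_weight b\<^sub>2 s) * (ennreal (C * block_weight s powr (1 / \<tau>\<^sub>2 - 1 / \<tau>\<^sub>1)) * lorentz_norm p \<tau>\<^sub>1 (delta_block s f))"
      by (intro mult_left_mono C trig_poly_delta_block) simp
    also have "\<dots> = ennreal (smoothness_weight b\<^sub>2 s * (C * block_weight s powr (1 / \<tau>\<^sub>2 - 1 / \<tau>\<^sub>1))) * lorentz_norm p \<tau>\<^sub>1 (delta_block s f)"
      using \<open>C > 0\<close> smoothness_weight_pos[of b\<^sub>2 s] by (simp add: ennreal_mult mult.assoc)
    also have "smoothness_weight b\<^sub>2 s * (C * block_weight s powr (1 / \<tau>\<^sub>2 - 1 / \<tau>\<^sub>1))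
        = C * (embedding_weight (b\<^sub>2 - b\<^sub>1) (1 / \<tau>\<^sub>2 - 1 / \<tau>\<^sub>1) s * smoothness_weight b\<^sub>1 s)"
      using smoothness_weight_pos[of b\<^sub>1 s] by (simp add: embedding_weight_def smoothness_weight_diff)
    also have "ennreal (C * (embedding_weight (b\<^sub>2 - b\<^sub>1) (1 / \<tau>\<^sub>2 - 1 / \<tau>\<^sub>1) s * smoothness_weight b\<^sub>1 s))
        = ennreal C * (ennreal (embedding_weight (b\<^sub>2 - b\<^sub>1) (1 / \<tau>\<^sub>2 - 1 / \<tau>\<^sub>1) s) * ennreal (smoothness_weight b\<^sub>1 s))"
      using \<open>C > 0\<close> smoothness_weight_pos[of b\<^sub>1 s] embedding_weight_pos[of "b\<^sub>2 - b\<^sub>1" "1 / \<tau>\<^sub>2 - 1 / \<tau>\<^sub>1" s]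
      by (simp add: ennreal_mult)
    finally show ?thesis
      by (simp only: mult.assoc)
  qed
  with \<open>C > 0\<close> show ?thesis
    by blast
qed

lemma besov_embedding_of_lq_norm:
  fixes b\<^sub>1 b\<^sub>2 :: "real ^ 'm"
  assumes "0 < p" "0 < \<tau>\<^sub>2" "\<tau>\<^sub>2 < \<tau>\<^sub>1" "0 < \<theta>\<^sub>2" "0 \<le> D"
    and D: "\<And>N. lq_norm \<theta>\<^sub>2 (\<lambda>s. ennreal (embedding_weight (b\<^sub>2 - b\<^sub>1) (1 / \<tau>\<^sub>2 - 1 / \<tau>\<^sub>1) s) * N s) \<le> ennreal D * lq_norm \<theta>\<^sub>1 N"
  shows "besov_embedding p \<tau>\<^sub>1 \<theta>\<^sub>1 b\<^sub>1 \<tau>\<^sub>2 \<theta>\<^sub>2 b\<^sub>2"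
proof -
  let ?v = "embedding_weight (b\<^sub>2 - b\<^sub>1) (1 / \<tau>\<^sub>2 - 1 / \<tau>\<^sub>1)"
  let ?N = "\<lambda>b \<tau> f s. ennreal (smoothness_weight b s) * lorentz_norm p \<tau> (delta_block s f)"
  obtain C where C: "C > 0" "\<And>f s. ?N b\<^sub>2 \<tau>\<^sub>2 f s \<le> ennreal C * (ennreal (?v s) * ?N b\<^sub>1 \<tau>\<^sub>1 f s)"
    using besov_component_le[OF assms(1-3), of b\<^sub>2 b\<^sub>1] by blast
  have "besov_norm p \<tau>\<^sub>2 \<theta>\<^sub>2 b\<^sub>2 f \<le> ennreal (C * D) * besov_norm p \<tau>\<^sub>1 \<theta>\<^sub>1 b\<^sub>1 f" for f
  proof -
    have "lq_norm \<theta>\<^sub>2 (?N b\<^sub>2 \<tau>\<^sub>2 f) \<le> lq_norm \<theta>\<^sub>2 (\<lambda>s. ennreal C * (ennreal (?v s) * ?N b\<^sub>1 \<tau>\<^sub>1 f s))"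
      using assms C by (intro lq_norm_mono) auto
    also have "\<dots> = ennreal C * lq_norm \<theta>\<^sub>2 (\<lambda>s. ennreal (?v s) * ?N b\<^sub>1 \<tau>\<^sub>1 f s)"
      using assms C by (intro lq_norm_cmult) auto
    also have "\<dots> \<le> ennreal C * (ennreal D * lq_norm \<theta>\<^sub>1 (?N b\<^sub>1 \<tau>\<^sub>1 f))"
      by (intro mult_left_mono D) auto
    finally show ?thesis
      unfolding besov_norm_eq_lq_norm using C assms by (simp add: ennreal_mult mult.assoc)
  qed
  then show ?thesis
    unfolding besov_embedding_def by blast
qed

section \<open>Test functions and necessity of the summability condition\<close>

lemma trig_poly_in_lorentz_space0:
  fixes f :: "real ^ 'm \<Rightarrow> real"
  assumes f: "trig_poly A (\<lambda>x. complex_of_real (f x))" and A: "\<And>n j. n \<in> A \<Longrightarrow> n $ j \<noteq> 0"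
    and "0 < p" "0 < \<tau>"
  shows "f \<in> lorentz_space0 p \<tau>"
proof -
  have "continuous_on UNIV (\<lambda>x. Re (complex_of_real (f x)))"
    by (intro continuous_on_Re trig_poly_continuous[OF f])
  then have "f \<in> borel_measurable borel"
    by (intro borel_measurable_continuous_onI) simp
  then have "f \<in> borel_measurable lebesgue"
    by (intro measurable_completion) simp
  moreover have "f (x + axis j (2 * pi)) = f x" for x j
    using trig_poly_periodic[OF f, of x j] by simp
  moreover obtain S where "\<And>x. norm (complex_of_real (f x)) \<le> S"
    using trig_poly_bounded[OF f] by blast
  then have "lorentz_norm p \<tau> f < \<infinity>"
    using lorentz_norm_finite[of f S p \<tau>] assms by simp
  moreover have "(LINT t:{0..<2 * pi}|lebesgue. f (\<chi> i. if i = j then t else x $ i)) = 0" for x j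
  proof -
    obtain c where c: "(\<lambda>x. complex_of_real (f x)) = (\<lambda>x. \<Sum>n\<in>A. c n * character n x)"
      using f by (auto simp: trig_poly_def)
    have "has_bochner_integral lebesgue (\<lambda>t. \<Sum>n\<in>A. c n * (indicator {0..<2 * pi} t *\<^sub>R character n (\<chi> i. if i = j then t else x $ i)))
        (\<Sum>n\<in>A. c n * 0)"
      by (intro has_bochner_integral_sum has_bochner_integral_mult_right integral_character_coordinate A)
    moreover have "(\<Sum>n\<in>A. c n * (indicator {0..<2 * pi} t *\<^sub>R character n (\<chi> i. if i = j then t else x $ i)))
        = complex_of_real (indicator {0..<2 * pi} t *\<^sub>R f (\<chi> i. if i = j then t else x $ i))" for t
      using fun_cong[OF c, of "\<chi> i. if i = j then t else x $ i"] by (cases "t \<in> {0..<2 * pi}") simp_all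
    ultimately have "has_bochner_integral lebesgue
        (\<lambda>t. complex_of_real (indicator {0..<2 * pi} t *\<^sub>R f (\<chi> i. if i = j then t else x $ i))) 0"
      by simp
    from has_bochner_integral_Re[OF this] show ?thesis
      unfolding set_lebesgue_integral_def by (simp add: has_bochner_integral_iff)
  qed
  ultimately show ?thesis
    by (simp add: lorentz_space0_def lorentz_space_def)
qed

text \<open>Positive indices make the spectra of the summands disjoint, so the coefficients of the
  sum on each block come from one summand at most. The index \<open>s\<close> is arbitrary: a block
  with a zero index meets none of the spectra and gives 0.\<close>

lemma delta_block_sum:
  fixes T :: "nat ^ 'm \<Rightarrow> real ^ 'm \<Rightarrow> real"
  assumes F: "finite F" "\<And>s j. s \<in> F \<Longrightarrow> 1 \<le> s $ j"
    and T: "\<And>s. s \<in> F \<Longrightarrow> trig_poly (dyadic_block s) (\<lambda>x. complex_of_real (T s x))"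
  defines "f \<equiv> \<lambda>x. \<Sum>s\<in>F. T s x"
  shows "delta_block s f x = (if s \<in> F then complex_of_real (T s x) else 0)"
    and "trig_poly (\<Union>s\<in>F. dyadic_block s) (\<lambda>x. complex_of_real (f x))"
proof -
  let ?A = "\<Union>s\<in>F. dyadic_block s"
  have "finite ?A"
    using F(1) finite_dyadic_block by blast
  have "\<forall>s\<in>F. \<exists>c. (\<lambda>x. complex_of_real (T s x)) = (\<lambda>x. \<Sum>n\<in>dyadic_block s. c n * character n x)"
    using T by (simp add: trig_poly_def)
  then obtain c where c: "\<And>s. s \<in> F \<Longrightarrow> (\<lambda>x. complex_of_real (T s x)) = (\<lambda>x. \<Sum>n\<in>dyadic_block s. c s n * character n x)"
    by metis
  define d where "d n = (\<Sum>s\<in>F. if n \<in> dyadic_block s then c s n else 0)" for n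
  have f: "(\<lambda>x. complex_of_real (f x)) = (\<lambda>x. \<Sum>n\<in>?A. d n * character n x)"
  proof
    fix x
    have "complex_of_real (f x) = (\<Sum>s\<in>F. \<Sum>n\<in>dyadic_block s. c s n * character n x)"
      unfolding f_def of_real_sum using fun_cong[OF c] by (intro sum.cong) auto
    also have "\<dots> = (\<Sum>s\<in>F. \<Sum>n\<in>?A. (if n \<in> dyadic_block s then c s n else 0) * character n x)"
      using \<open>finite ?A\<close> by (intro sum.cong sum.mono_neutral_cong_left) auto
    also have "\<dots> = (\<Sum>n\<in>?A. d n * character n x)"
      unfolding d_def sum_distrib_right by (rule sum.swap)
    finally show "complex_of_real (f x) = (\<Sum>n\<in>?A. d n * character n x)" .
  qed
  then show "trig_poly ?A (\<lambda>x. complex_of_real (f x))"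
    unfolding trig_poly_def by blast
  have "fourier_coeff f n = (if s \<in> F then c s n else 0)" if n: "n \<in> dyadic_block s" for n
  proof -
    have eq: "n \<in> dyadic_block s' \<longleftrightarrow> s' = s" if "s' \<in> F" for s'
      using dyadic_block_unique[of s' n s] F(2)[OF that] n by blast
    have "d n = (\<Sum>s'\<in>F. if s' = s then c s' n else 0)"
      unfolding d_def using eq by (intro sum.cong) auto
    also have "\<dots> = (if s \<in> F then c s n else 0)"
      using F(1) by simp
    finally have d: "d n = (if s \<in> F then c s n else 0)" .
    have "n \<in> ?A \<longleftrightarrow> s \<in> F"
      using eq n by blast
    then show ?thesis
      using fourier_coeff_trig_poly[OF \<open>finite ?A\<close> f, of n] d by auto
  qed
  then have "delta_block s f x = (\<Sum>n\<in>dyadic_block s. (if s \<in> F then c s n else 0) * character n x)"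
    unfolding delta_block_def character_def by (intro sum.cong) auto
  then show "delta_block s f x = (if s \<in> F then complex_of_real (T s x) else 0)"
    using fun_cong[OF c, of s x] by (cases "s \<in> F") simp_all
qed

lemma lq_norm_finite_support:
  assumes "0 < \<theta>" "finite F" "\<And>s. s \<in> F \<Longrightarrow> 0 \<le> g s"
  shows "lq_norm \<theta> (\<lambda>s. ennreal (if s \<in> F then g s else 0)) < top"
  using assms(1)
proof (cases rule: pos_ereal_cases)
  case 1
  have "ennreal (if s \<in> F then g s else 0) \<le> ennreal (sum g F)" for s
    using assms by (auto intro!: ennreal_leI member_le_sum sum_nonneg)
  then have "lq_norm \<theta> (\<lambda>s. ennreal (if s \<in> F then g s else 0)) \<le> ennreal (sum g F)"
    by (simp only: 1 lq_norm_infinity) (rule SUP_least)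
  then show ?thesis
    by (rule le_less_trans) simp
next
  case (2 q)
  have "lq_norm \<theta> (\<lambda>s. ennreal (if s \<in> F then g s else 0)) \<le> ennreal ((\<Sum>s\<in>F. g s powr q) powr (1 / q))"
    unfolding 2(2)
  proof (rule lq_norm_le_ennrealI[OF 2(1)])
    fix G :: "'a set" assume "finite G"
    have "(\<Sum>s\<in>G. (if s \<in> F then g s else 0) powr q) = (\<Sum>s\<in>G \<inter> F. g s powr q)"
      using \<open>finite G\<close> by (intro sum.mono_neutral_cong_right) auto
    also have "\<dots> \<le> (\<Sum>s\<in>F. g s powr q)"
      using assms by (intro sum_mono2) auto
    finally show "(\<Sum>s\<in>G. (if s \<in> F then g s else 0) powr q) \<le> (\<Sum>s\<in>F. g s powr q)" .
  qed (use assms in \<open>auto intro: sum_nonneg\<close>)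
  then show ?thesis
    by (rule le_less_trans) simp
qed

text \<open>For a finite set \<open>F\<close> the test function is a combination of extremal
  polynomials whose source components are at most \<open>C1 * ?u s\<close> and whose target
  components are at least \<open>c2 * (?v s * ?u s)\<close>. The embedding then becomes the
  hypothesis of the converse of Hoelder's inequality, with \<open>D\<close> independent of
  \<open>F\<close>.\<close>

lemma besov_embedding_imp_summable:
  fixes b\<^sub>1 b\<^sub>2 :: "real ^ 'm"
  assumes "1 < p" "0 < \<tau>\<^sub>1" "0 < \<tau>\<^sub>2" "0 < \<theta>\<^sub>1"
    and idx: "0 < q" "0 < r" "inverse_index \<theta>\<^sub>1 \<kappa>" "1 / r = 1 / q - \<kappa>"
    and emb: "besov_embedding p \<tau>\<^sub>1 \<theta>\<^sub>1 b\<^sub>1 \<tau>\<^sub>2 (ereal q) b\<^sub>2"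
  shows "\<exists>V. \<forall>F. finite F \<and> F \<subseteq> {s. \<forall>j. 1 \<le> s $ j} \<longrightarrow>
    (\<Sum>s\<in>F. embedding_weight (b\<^sub>2 - b\<^sub>1) (1 / \<tau>\<^sub>2 - 1 / \<tau>\<^sub>1) s powr r) \<le> V"
proof -
  let ?v = "embedding_weight (b\<^sub>2 - b\<^sub>1) (1 / \<tau>\<^sub>2 - 1 / \<tau>\<^sub>1)"
  obtain C where C: "\<And>f. f \<in> besov_space p \<tau>\<^sub>1 \<theta>\<^sub>1 b\<^sub>1 \<Longrightarrow>
      besov_norm p \<tau>\<^sub>2 (ereal q) b\<^sub>2 f \<le> ennreal C * besov_norm p \<tau>\<^sub>1 \<theta>\<^sub>1 b\<^sub>1 f"
    using emb unfolding besov_embedding_def by blast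
  obtain C1 c2 where "C1 > 0" "c2 > 0" and "\<forall>s :: nat ^ 'm. (\<forall>i. 1 \<le> s $ i) \<longrightarrow> (\<exists>T :: real ^ 'm \<Rightarrow> real.
     trig_poly (dyadic_block s) (\<lambda>x. complex_of_real (T x)) \<and>
     lorentz_norm p \<tau>\<^sub>1 T \<le> ennreal (C1 * block_weight s powr (1 / \<tau>\<^sub>1)) \<and>
     ennreal (c2 * block_weight s powr (1 / \<tau>\<^sub>2)) \<le> lorentz_norm p \<tau>\<^sub>2 T)"
    using extremal_block_poly[OF assms(1-3)] by blast
  then obtain T :: "nat ^ 'm \<Rightarrow> real ^ 'm \<Rightarrow> real" where T: "\<And>s. (\<forall>i. 1 \<le> s $ i) \<Longrightarrow>
     trig_poly (dyadic_block s) (\<lambda>x. complex_of_real (T s x)) \<and>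
     lorentz_norm p \<tau>\<^sub>1 (T s) \<le> ennreal (C1 * block_weight s powr (1 / \<tau>\<^sub>1)) \<and>
     ennreal (c2 * block_weight s powr (1 / \<tau>\<^sub>2)) \<le> lorentz_norm p \<tau>\<^sub>2 (T s)"
    by metis
  \<comment> \<open>The embedding constant may be any real; \<open>ennreal\<close> sends negative
    values to 0, so nothing is lost, and \<open>D\<close> becomes nonnegative.\<close>
  define C' where "C' = max C 0"
  define D where "D = C' * C1 / c2"
  have "0 \<le> D"
    using \<open>C1 > 0\<close> \<open>c2 > 0\<close> by (simp add: D_def C'_def)
  have "(\<Sum>s\<in>F. ?v s powr r) \<le> D powr r" if F: "finite F" "F \<subseteq> {s. \<forall>j. 1 \<le> s $ j}" "F \<noteq> {}" for F
  proof (rule lq_Hoelder_converse[OF idx \<open>0 \<le> D\<close> F(1,3) embedding_weight_pos])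
    let ?u = "\<lambda>s. ?v s powr (r * \<kappa>)"
    \<comment> \<open>Dividing by the smoothness weight and by the growth of the source norm of
      \<open>T s\<close> leaves \<open>?u s\<close>; the target component then carries the quotient
      of both weights, which is \<open>?v s\<close>.\<close>
    define l where "l s = ?u s / (smoothness_weight b\<^sub>1 s * block_weight s powr (1 / \<tau>\<^sub>1))" for s
    have W: "0 < block_weight s powr a" for s :: "nat ^ 'm" and a
      using block_weight_ge_1[of s] by simp
    have l: "0 < l s" for s
      using embedding_weight_pos[of "b\<^sub>2 - b\<^sub>1" "1 / \<tau>\<^sub>2 - 1 / \<tau>\<^sub>1" s] smoothness_weight_pos[of b\<^sub>1 s] W[of s]
      by (simp add: l_def)
    define f where "f x = (\<Sum>s\<in>F. l s * T s x)" for x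
    have T1: "trig_poly (dyadic_block s) (\<lambda>x. complex_of_real (l s * T s x))" if "s \<in> F" for s
      using T[of s] that F(2) trig_poly_scale[of "dyadic_block s" "\<lambda>x. complex_of_real (T s x)" "complex_of_real (l s)"] by auto
    have delta: "delta_block s f x = (if s \<in> F then complex_of_real (l s * T s x) else 0)" for s x
      unfolding f_def by (rule delta_block_sum(1)[OF F(1) _ T1]) (use F(2) in auto)
    have poly: "trig_poly (\<Union>s\<in>F. dyadic_block s) (\<lambda>x. complex_of_real (f x))"
      unfolding f_def by (rule delta_block_sum(2)[OF F(1) _ T1]) (use F(2) in auto)
    have norm_in: "lorentz_norm p \<tau> (delta_block s f) = ennreal (l s) * lorentz_norm p \<tau> (T s)" if "s \<in> F" "0 < \<tau>" for s \<tau>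
      using l[of s] that by (intro lorentz_norm_scale) (auto simp: delta norm_mult)
    have norm_out: "lorentz_norm p \<tau> (delta_block s f) = 0" if "s \<notin> F" "0 < \<tau>" for s \<tau>
      using that assms(1) by (intro lorentz_norm_zero) (auto simp: delta)
    have n1: "ennreal (smoothness_weight b\<^sub>1 s) * lorentz_norm p \<tau>\<^sub>1 (delta_block s f)
        \<le> ennreal C1 * ennreal (if s \<in> F then ?u s else 0)" for s
    proof (cases "s \<in> F")
      case True
      have "ennreal (smoothness_weight b\<^sub>1 s) * lorentz_norm p \<tau>\<^sub>1 (delta_block s f)
          \<le> ennreal (smoothness_weight b\<^sub>1 s) * (ennreal (l s) * ennreal (C1 * block_weight s powr (1 / \<tau>\<^sub>1)))"
        unfolding norm_in[OF True assms(2)] using T[of s] True F(2) by (intro mult_left_mono) auto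
      also have "\<dots> = ennreal (smoothness_weight b\<^sub>1 s * (l s * (C1 * block_weight s powr (1 / \<tau>\<^sub>1))))"
        using smoothness_weight_pos[of b\<^sub>1 s] l[of s] \<open>C1 > 0\<close> by (simp add: ennreal_mult)
      also have "smoothness_weight b\<^sub>1 s * (l s * (C1 * block_weight s powr (1 / \<tau>\<^sub>1))) = C1 * ?u s"
        using smoothness_weight_pos[of b\<^sub>1 s] W[of s "1 / \<tau>\<^sub>1"] by (simp add: l_def)
      finally show ?thesis
        using True \<open>C1 > 0\<close> by (simp add: ennreal_mult)
    qed (use norm_out assms(2) in simp)
    have n2: "ennreal c2 * ennreal (if s \<in> F then ?v s * ?u s else 0)
        \<le> ennreal (smoothness_weight b\<^sub>2 s) * lorentz_norm p \<tau>\<^sub>2 (delta_block s f)" for s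
    proof (cases "s \<in> F")
      case True
      have "?v s * ?u s * c2 = smoothness_weight b\<^sub>2 s * (l s * (c2 * block_weight s powr (1 / \<tau>\<^sub>2)))"
        using smoothness_weight_pos[of b\<^sub>1 s] W[of s "1 / \<tau>\<^sub>1"]
        by (simp add: l_def embedding_weight_def smoothness_weight_diff powr_diff)
      then have "ennreal c2 * ennreal (?v s * ?u s)
          = ennreal (smoothness_weight b\<^sub>2 s) * (ennreal (l s) * ennreal (c2 * block_weight s powr (1 / \<tau>\<^sub>2)))"
        using smoothness_weight_pos[of b\<^sub>2 s] l[of s] \<open>c2 > 0\<close> embedding_weight_pos[of "b\<^sub>2 - b\<^sub>1" "1 / \<tau>\<^sub>2 - 1 / \<tau>\<^sub>1" s]
        by (simp add: mult.commute flip: ennreal_mult)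
      also have "\<dots> \<le> ennreal (smoothness_weight b\<^sub>2 s) * lorentz_norm p \<tau>\<^sub>2 (delta_block s f)"
        unfolding norm_in[OF True assms(3)] using T[of s] True F(2) by (intro mult_left_mono) auto
      finally show ?thesis
        using True by simp
    qed simp
    have up: "besov_norm p \<tau>\<^sub>1 \<theta>\<^sub>1 b\<^sub>1 f \<le> ennreal C1 * lq_norm \<theta>\<^sub>1 (\<lambda>s. ennreal (if s \<in> F then ?u s else 0))"
    proof -
      have "besov_norm p \<tau>\<^sub>1 \<theta>\<^sub>1 b\<^sub>1 f \<le> lq_norm \<theta>\<^sub>1 (\<lambda>s. ennreal C1 * ennreal (if s \<in> F then ?u s else 0))"
        unfolding besov_norm_eq_lq_norm by (intro lq_norm_mono n1 assms(4))
      also have "\<dots> = ennreal C1 * lq_norm \<theta>\<^sub>1 (\<lambda>s. ennreal (if s \<in> F then ?u s else 0))"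
        using \<open>C1 > 0\<close> by (intro lq_norm_cmult assms(4)) simp
      finally show ?thesis .
    qed
    also have "\<dots> < top"
      using lq_norm_finite_support[OF assms(4) F(1), of ?u] by (simp add: ennreal_mult_less_top)
    finally have "besov_norm p \<tau>\<^sub>1 \<theta>\<^sub>1 b\<^sub>1 f < \<infinity>"
      by simp
    moreover have "f \<in> lorentz_space0 p \<tau>\<^sub>1"
    proof (rule trig_poly_in_lorentz_space0[OF poly])
      fix n j assume "n \<in> (\<Union>s\<in>F. dyadic_block s)"
      then obtain s where "s \<in> F" "n \<in> dyadic_block s"
        by blast
      then have "2 ^ (s $ j - 1) \<le> \<bar>n $ j\<bar>"
        using F(2) dyadic_block_iff[of s n] by auto
      moreover have "(0 :: int) < 2 ^ (s $ j - 1)"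
        by simp
      ultimately show "n $ j \<noteq> 0"
        by linarith
    qed (use assms in auto)
    ultimately have f: "f \<in> besov_space p \<tau>\<^sub>1 \<theta>\<^sub>1 b\<^sub>1"
      by (simp add: besov_space_def)
    have "ennreal c2 * lq_norm (ereal q) (\<lambda>s. ennreal (if s \<in> F then ?v s * ?u s else 0))
        = lq_norm (ereal q) (\<lambda>s. ennreal c2 * ennreal (if s \<in> F then ?v s * ?u s else 0))"
      using \<open>c2 > 0\<close> idx(1) by (intro lq_norm_cmult[symmetric]) auto
    also have "\<dots> \<le> besov_norm p \<tau>\<^sub>2 (ereal q) b\<^sub>2 f"
      unfolding besov_norm_eq_lq_norm using idx(1) by (intro lq_norm_mono n2) simp
    also have "\<dots> \<le> ennreal C * besov_norm p \<tau>\<^sub>1 \<theta>\<^sub>1 b\<^sub>1 f"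
      by (rule C[OF f])
    also have "\<dots> \<le> ennreal C' * besov_norm p \<tau>\<^sub>1 \<theta>\<^sub>1 b\<^sub>1 f"
      by (intro mult_right_mono ennreal_leI) (auto simp: C'_def)
    also have "\<dots> \<le> ennreal C' * (ennreal C1 * lq_norm \<theta>\<^sub>1 (\<lambda>s. ennreal (if s \<in> F then ?u s else 0)))"
      by (intro mult_left_mono up) simp
    finally have "ennreal (1 / c2) * (ennreal c2 * lq_norm (ereal q) (\<lambda>s. ennreal (if s \<in> F then ?v s * ?u s else 0)))
        \<le> ennreal (1 / c2) * (ennreal C' * (ennreal C1 * lq_norm \<theta>\<^sub>1 (\<lambda>s. ennreal (if s \<in> F then ?u s else 0))))"
      by (rule mult_left_mono) simp
    moreover have "ennreal (1 / c2) * (ennreal c2 * X) = X" for X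
      using \<open>c2 > 0\<close> by (simp add: mult.assoc[symmetric] flip: ennreal_mult)
    moreover have "ennreal (1 / c2) * (ennreal C' * (ennreal C1 * X)) = ennreal D * X" for X
      using \<open>c2 > 0\<close> \<open>C1 > 0\<close> by (simp add: mult.assoc[symmetric] D_def C'_def flip: ennreal_mult)
    ultimately show "lq_norm (ereal q) (\<lambda>s. ennreal (if s \<in> F then ?v s * ?u s else 0))
        \<le> ennreal D * lq_norm \<theta>\<^sub>1 (\<lambda>s. ennreal (if s \<in> F then ?u s else 0))"
      by simp
  qed
  then have "(\<Sum>s\<in>F. ?v s powr r) \<le> D powr r" if "finite F" "F \<subseteq> {s. \<forall>j. 1 \<le> s $ j}" for F
    using that by (cases "F = {}") auto
  then show ?thesis
    by blast
qed

text \<open>The weight of the theorem is evaluated at \<open>s\<close> instead of \<open>s + 1\<close>. The shift \<open>s \<mapsto> s + 1\<close> maps all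
  indices onto the indices of the sum in the theorem, so that the blocks with a vanishing \<open>s\<^sub>j\<close> need no
  separate treatment.\<close>
lemma embedding_weight_summable:
  fixes \<beta> :: "real ^ 'm"
  assumes "0 < r" "0 \<le> \<gamma>"
  defines "w \<equiv> \<lambda>s. (\<Prod>j\<in>UNIV. real (s $ j) powr (\<beta> $ j * r)) * block_weight s powr (\<gamma> * r)"
  shows "(\<Sum>\<^sub>\<infinity>s\<in>{s. \<forall>j. 1 \<le> s $ j}. ennreal (w s)) < top \<Longrightarrow>
      \<exists>V. \<forall>F. finite F \<longrightarrow> (\<Sum>s\<in>F. embedding_weight \<beta> \<gamma> s powr r) \<le> V"
    and "\<forall>F. finite F \<and> F \<subseteq> {s. \<forall>j. 1 \<le> s $ j} \<longrightarrow> (\<Sum>s\<in>F. embedding_weight \<beta> \<gamma> s powr r) \<le> V \<Longrightarrow>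
      (\<Sum>\<^sub>\<infinity>s\<in>{s. \<forall>j. 1 \<le> s $ j}. ennreal (w s)) < top"
proof -
  let ?P = "{s :: nat ^ 'm. \<forall>j. 1 \<le> s $ j}"
  have w_nonneg: "0 \<le> w s" for s
    by (simp add: w_def prod_nonneg)
  have ew: "embedding_weight \<beta> \<gamma> s powr r = (\<Prod>j\<in>UNIV. (real (s $ j) + 1) powr (\<beta> $ j * r)) * block_weight s powr (\<gamma> * r)" for s
    by (simp add: embedding_weight_def powr_mult smoothness_weight_powr powr_powr)
  show "\<exists>V. \<forall>F. finite F \<longrightarrow> (\<Sum>s\<in>F. embedding_weight \<beta> \<gamma> s powr r) \<le> V" if "(\<Sum>\<^sub>\<infinity>s\<in>?P. ennreal (w s)) < top"
  proof -
    obtain B where B: "0 \<le> B" "(\<Sum>\<^sub>\<infinity>s\<in>?P. ennreal (w s)) = ennreal B"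
      using \<open>_ < top\<close> unfolding less_top_ennreal by blast
    let ?h = "\<lambda>s :: nat ^ 'm. \<chi> j. s $ j + 1"
    have inj: "inj_on ?h F" for F
      by (auto simp: inj_on_def vec_eq_iff)
    have "(\<Sum>s\<in>F. embedding_weight \<beta> \<gamma> s powr r) \<le> B" if "finite F" for F
    proof -
      \<comment> \<open>The shift reproduces the product over \<open>j\<close> exactly and only
        increases \<open>block_weight\<close>, whose exponent is nonnegative.\<close>
      have "embedding_weight \<beta> \<gamma> s powr r \<le> w (?h s)" for s
      proof -
        have "block_weight s \<le> block_weight (?h s)"
          unfolding block_weight_def by (intro sum_mono) simp
        then have "block_weight s powr (\<gamma> * r) \<le> block_weight (?h s) powr (\<gamma> * r)"
          using assms block_weight_ge_1[of s] by (intro powr_mono2) auto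
        then show ?thesis
          unfolding ew w_def by (auto intro!: mult_left_mono prod_nonneg simp: add.commute)
      qed
      then have "(\<Sum>s\<in>F. embedding_weight \<beta> \<gamma> s powr r) \<le> (\<Sum>s\<in>F. w (?h s))"
        by (rule sum_mono)
      also have "\<dots> = sum w (?h ` F)"
        by (simp only: sum.reindex[OF inj] o_def)
      also have "\<dots> \<le> B"
        using w_nonneg \<open>finite F\<close> B by (intro sum_le_of_infsum_le[where A = ?P]) auto
      finally show ?thesis .
    qed
    then show ?thesis
      by blast
  qed
  show "(\<Sum>\<^sub>\<infinity>s\<in>?P. ennreal (w s)) < top"
    if V: "\<forall>F. finite F \<and> F \<subseteq> ?P \<longrightarrow> (\<Sum>s\<in>F. embedding_weight \<beta> \<gamma> s powr r) \<le> V"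
  proof -
    \<comment> \<open>For \<open>s $ j \<ge> 1\<close> the numbers \<open>s $ j\<close> and
      \<open>s $ j + 1\<close> differ by a factor at most 2, which costs
      \<open>2 powr \<bar>a\<bar>\<close> in a power \<open>a\<close> of either sign.\<close>
    define K where "K = (\<Prod>j\<in>UNIV. 2 powr \<bar>\<beta> $ j * r\<bar>)"
    have "0 < K"
      unfolding K_def by (intro prod_pos) simp
    have "w s \<le> K * embedding_weight \<beta> \<gamma> s powr r" if "s \<in> ?P" for s
    proof -
      have "real (s $ j) powr a \<le> 2 powr \<bar>a\<bar> * (real (s $ j) + 1) powr a" for j a
      proof (cases "0 \<le> a")
        case True
        then have "real (s $ j) powr a \<le> 1 * (real (s $ j) + 1) powr a"
          by (simp add: powr_mono2)
        also have "\<dots> \<le> 2 powr \<bar>a\<bar> * (real (s $ j) + 1) powr a"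
          by (intro mult_right_mono ge_one_powr_ge_zero) auto
        finally show ?thesis .
      next
        case False
        have "1 \<le> s $ j"
          using that by simp
        then have "(2 * real (s $ j)) powr a \<le> (real (s $ j) + 1) powr a"
          using False by (intro powr_mono2') auto
        then have "2 powr (- a) * (2 * real (s $ j)) powr a \<le> 2 powr (- a) * (real (s $ j) + 1) powr a"
          by (rule mult_left_mono) simp
        moreover have "2 powr (- a) * (2 * real (s $ j)) powr a = real (s $ j) powr a"
          by (simp add: powr_mult powr_minus)
        ultimately show ?thesis
          using False by simp
      qed
      then have "(\<Prod>j\<in>UNIV. real (s $ j) powr (\<beta> $ j * r)) \<le> (\<Prod>j\<in>UNIV. 2 powr \<bar>\<beta> $ j * r\<bar> * (real (s $ j) + 1) powr (\<beta> $ j * r))"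
        by (intro prod_mono) auto
      then have "(\<Prod>j\<in>UNIV. real (s $ j) powr (\<beta> $ j * r)) \<le> K * (\<Prod>j\<in>UNIV. (real (s $ j) + 1) powr (\<beta> $ j * r))"
        by (simp add: K_def prod.distrib)
      then show ?thesis
        unfolding ew w_def mult.assoc[symmetric] by (rule mult_right_mono) simp
    qed
    then have "sum w F \<le> K * V" if "finite F" "F \<subseteq> ?P" for F
    proof -
      have "sum w F \<le> (\<Sum>s\<in>F. K * embedding_weight \<beta> \<gamma> s powr r)"
        using that \<open>\<And>s. s \<in> ?P \<Longrightarrow> w s \<le> K * embedding_weight \<beta> \<gamma> s powr r\<close> by (intro sum_mono) auto
      also have "\<dots> \<le> K * V"
        unfolding sum_distrib_left[symmetric] using V that \<open>0 < K\<close> by (intro mult_left_mono) auto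
      finally show ?thesis .
    qed
    then have "(\<Sum>\<^sub>\<infinity>s\<in>?P. ennreal (w s)) \<le> ennreal (K * V)"
      using w_nonneg by (intro infsum_ennreal_leI) (simp add: ennreal_leI)
    then show ?thesis
      by (rule le_less_trans) simp
  qed
qed

lemma conjugate_index:
  assumes "0 < \<theta>\<^sub>2" "\<theta>\<^sub>2 < \<theta>\<^sub>1" "1 / (\<theta>\<^sub>1 / \<theta>\<^sub>2) + 1 / \<eta>' = (1 :: ereal)"
  obtains q \<kappa> where "\<theta>\<^sub>2 = ereal q" "0 < q" "0 < real_of_ereal (\<theta>\<^sub>2 * \<eta>')" "inverse_index \<theta>\<^sub>1 \<kappa>"
    "1 / real_of_ereal (\<theta>\<^sub>2 * \<eta>') = 1 / q - \<kappa>"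
proof -
  obtain q where q: "\<theta>\<^sub>2 = ereal q" "0 < q"
    using assms(1,2) by (cases \<theta>\<^sub>2) auto
  show ?thesis
  proof (cases "\<theta>\<^sub>1 = \<infinity>")
    case True
    then have "\<theta>\<^sub>1 / \<theta>\<^sub>2 = \<infinity>"
      using q by simp
    then have "1 / \<eta>' = 1"
      using assms(3) by simp
    then have "\<eta>' = 1"
      by (cases \<eta>') (auto simp: one_ereal_def divide_ereal_def split: if_splits)
    then show ?thesis
      using that[of q 0] q True by (simp add: inverse_index_def)
  next
    case False
    then obtain q1 where q1: "\<theta>\<^sub>1 = ereal q1" "q < q1"
      using assms(2) q by (cases \<theta>\<^sub>1) auto
    have "1 / (\<theta>\<^sub>1 / \<theta>\<^sub>2) = ereal (q / q1)"
      using q q1 by (simp add: one_ereal_def)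
    \<comment> \<open>An infinite \<eta>' would contribute 0 and force \<open>q = q1\<close>, while
      \<eta>' = 0 would contribute \<infinity> by the convention for division in
      \<open>ereal\<close>.\<close>
    then obtain e where e: "\<eta>' = ereal e" "e \<noteq> 0" "q / q1 + 1 / e = 1"
      using assms(3) q q1 by (cases \<eta>') (auto simp: one_ereal_def divide_ereal_def inverse_eq_divide split: if_splits)
    have "1 / e = (q1 - q) / q1"
      using e q q1 by (simp add: field_simps)
    moreover have "0 < (q1 - q) / q1"
      using q q1 by simp
    ultimately have "0 < 1 / e"
      by simp
    then have "0 < e"
      by simp
    have "1 / (q * e) = 1 / q * (1 / e)"
      by simp
    also have "\<dots> = 1 / q - 1 / q1"
      using q q1 by (simp add: \<open>1 / e = (q1 - q) / q1\<close> field_simps)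
    finally show ?thesis
      using that[of q "1 / q1"] q q1 \<open>0 < e\<close> e by (simp add: inverse_index_def)
  qed
qed

theorem theorem4p2:
  fixes p \<tau>\<^sub>1 \<tau>\<^sub>2 :: real
    and \<theta>\<^sub>1 \<theta>\<^sub>2 :: ereal
    and b\<^sub>1 b\<^sub>2 :: "real ^ 'm"
  assumes "1 < p"
    and "1 < \<tau>\<^sub>2" and "\<tau>\<^sub>2 < \<tau>\<^sub>1"
    and "0 < \<theta>\<^sub>1" and "0 < \<theta>\<^sub>2"
    and "\<And>j. ereal (b\<^sub>1 $ j) > - (1 / \<theta>\<^sub>1)"
    and "\<And>j. ereal (b\<^sub>2 $ j) > - (1 / \<theta>\<^sub>2)"
  shows
    "(\<forall>\<eta> \<eta>' :: ereal.
        \<theta>\<^sub>2 < \<theta>\<^sub>1 \<longrightarrow> \<eta> = \<theta>\<^sub>1 / \<theta>\<^sub>2 \<longrightarrow> 1 / \<eta> + 1 / \<eta>' = 1 \<longrightarrow>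
        (besov_embedding p \<tau>\<^sub>1 \<theta>\<^sub>1 b\<^sub>1 \<tau>\<^sub>2 \<theta>\<^sub>2 b\<^sub>2 \<longleftrightarrow>
         (let r = real_of_ereal (\<theta>\<^sub>2 * \<eta>') in
          enn_powr
            (\<Sum>\<^sub>\<infinity>s\<in>{s :: nat ^ 'm. \<forall>j. 1 \<le> s $ j}.
               ennreal ((\<Prod>j\<in>UNIV. real (s $ j) powr ((b\<^sub>2 $ j - b\<^sub>1 $ j) * r)) *
                        (\<Sum>j\<in>UNIV. real (s $ j) + 1) powr ((1 / \<tau>\<^sub>2 - 1 / \<tau>\<^sub>1) * r)))
            (1 / r) < \<infinity>)))
     \<and>
     (\<theta>\<^sub>1 \<le> \<theta>\<^sub>2 \<longrightarrow>
        (SUP s :: nat ^ 'm.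
           ennreal ((\<Prod>j\<in>UNIV. (real (s $ j) + 1) powr (b\<^sub>2 $ j - b\<^sub>1 $ j)) *
                    (\<Sum>j\<in>UNIV. real (s $ j) + 1) powr (1 / \<tau>\<^sub>2 - 1 / \<tau>\<^sub>1))) < \<infinity> \<longrightarrow>
        besov_embedding p \<tau>\<^sub>1 \<theta>\<^sub>1 b\<^sub>1 \<tau>\<^sub>2 \<theta>\<^sub>2 b\<^sub>2)"
proof (intro conjI allI impI)
  let ?\<gamma> = "1 / \<tau>\<^sub>2 - 1 / \<tau>\<^sub>1"
  have \<gamma>: "0 \<le> ?\<gamma>"
    using assms(2,3) by (simp add: field_simps)
  fix \<eta> \<eta>' :: ereal
  assume "\<theta>\<^sub>2 < \<theta>\<^sub>1" "\<eta> = \<theta>\<^sub>1 / \<theta>\<^sub>2" "1 / \<eta> + 1 / \<eta>' = 1"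
  then obtain q \<kappa> where q: "\<theta>\<^sub>2 = ereal q" "0 < q" "0 < real_of_ereal (\<theta>\<^sub>2 * \<eta>')" "inverse_index \<theta>\<^sub>1 \<kappa>"
    "1 / real_of_ereal (\<theta>\<^sub>2 * \<eta>') = 1 / q - \<kappa>"
    using conjugate_index[OF assms(5)] by metis
  define r where "r = real_of_ereal (\<theta>\<^sub>2 * \<eta>')"
  note idx = q(2) q(3,4,5)[folded r_def]
  let ?w = "\<lambda>s :: nat ^ 'm. (\<Prod>j\<in>UNIV. real (s $ j) powr ((b\<^sub>2 - b\<^sub>1) $ j * r)) * block_weight s powr (?\<gamma> * r)"
  have "besov_embedding p \<tau>\<^sub>1 \<theta>\<^sub>1 b\<^sub>1 \<tau>\<^sub>2 \<theta>\<^sub>2 b\<^sub>2 \<longleftrightarrow> (\<Sum>\<^sub>\<infinity>s\<in>{s. \<forall>j. 1 \<le> s $ j}. ennreal (?w s)) < top"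
  proof
    assume "besov_embedding p \<tau>\<^sub>1 \<theta>\<^sub>1 b\<^sub>1 \<tau>\<^sub>2 \<theta>\<^sub>2 b\<^sub>2"
    then obtain V where "\<forall>F. finite F \<and> F \<subseteq> {s. \<forall>j. 1 \<le> s $ j} \<longrightarrow>
        (\<Sum>s\<in>F. embedding_weight (b\<^sub>2 - b\<^sub>1) ?\<gamma> s powr r) \<le> V"
      using besov_embedding_imp_summable[OF assms(1) _ _ assms(4) idx, of \<tau>\<^sub>1 \<tau>\<^sub>2 b\<^sub>1 b\<^sub>2] assms(2,3)
      unfolding q(1) by auto
    then show "(\<Sum>\<^sub>\<infinity>s\<in>{s. \<forall>j. 1 \<le> s $ j}. ennreal (?w s)) < top"
      by (rule embedding_weight_summable(2)[OF idx(2) \<gamma>])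
  next
    assume "(\<Sum>\<^sub>\<infinity>s\<in>{s. \<forall>j. 1 \<le> s $ j}. ennreal (?w s)) < top"
    then obtain V where V: "\<And>F. finite F \<Longrightarrow> (\<Sum>s\<in>F. embedding_weight (b\<^sub>2 - b\<^sub>1) ?\<gamma> s powr r) \<le> V"
      using embedding_weight_summable(1)[OF idx(2) \<gamma>] by blast
    obtain C where "C > 0" "\<And>N. lq_norm (ereal q) (\<lambda>s. ennreal (embedding_weight (b\<^sub>2 - b\<^sub>1) ?\<gamma> s) * N s) \<le> ennreal C * lq_norm \<theta>\<^sub>1 N"
      using lq_norm_Hoelder[OF idx less_imp_le[OF embedding_weight_pos] V] by blast
    then show "besov_embedding p \<tau>\<^sub>1 \<theta>\<^sub>1 b\<^sub>1 \<tau>\<^sub>2 \<theta>\<^sub>2 b\<^sub>2"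
      using assms q by (intro besov_embedding_of_lq_norm[where D = C]) auto
  qed
  \<comment> \<open>The outer power \<open>1 / r\<close> preserves finiteness, so only the sum
    matters.\<close>
  then show "besov_embedding p \<tau>\<^sub>1 \<theta>\<^sub>1 b\<^sub>1 \<tau>\<^sub>2 \<theta>\<^sub>2 b\<^sub>2 \<longleftrightarrow>
         (let r = real_of_ereal (\<theta>\<^sub>2 * \<eta>') in
          enn_powr
            (\<Sum>\<^sub>\<infinity>s\<in>{s :: nat ^ 'm. \<forall>j. 1 \<le> s $ j}.
               ennreal ((\<Prod>j\<in>UNIV. real (s $ j) powr ((b\<^sub>2 $ j - b\<^sub>1 $ j) * r)) *
                        (\<Sum>j\<in>UNIV. real (s $ j) + 1) powr ((1 / \<tau>\<^sub>2 - 1 / \<tau>\<^sub>1) * r)))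
            (1 / r) < \<infinity>)"
    unfolding Let_def r_def[symmetric] block_weight_def[symmetric] infinity_ennreal_def
      less_top[symmetric] enn_powr_eq_top_iff vector_minus_component .
next
  let ?\<gamma> = "1 / \<tau>\<^sub>2 - 1 / \<tau>\<^sub>1"
  let ?S = "SUP s :: nat ^ 'm.
           ennreal ((\<Prod>j\<in>UNIV. (real (s $ j) + 1) powr (b\<^sub>2 $ j - b\<^sub>1 $ j)) *
                    (\<Sum>j\<in>UNIV. real (s $ j) + 1) powr (1 / \<tau>\<^sub>2 - 1 / \<tau>\<^sub>1))"
  assume le: "\<theta>\<^sub>1 \<le> \<theta>\<^sub>2" and fin: "?S < \<infinity>"
  have S: "?S = (SUP s. ennreal (embedding_weight (b\<^sub>2 - b\<^sub>1) ?\<gamma> s))"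
    by (simp add: embedding_weight_def smoothness_weight_def block_weight_def)
  obtain B where B: "0 \<le> B" "?S = ennreal B"
    using fin by (cases ?S) auto
  have v: "ennreal (embedding_weight (b\<^sub>2 - b\<^sub>1) ?\<gamma> s) \<le> ennreal B" for s
    unfolding B(2)[symmetric] S by (rule SUP_upper) simp
  show "besov_embedding p \<tau>\<^sub>1 \<theta>\<^sub>1 b\<^sub>1 \<tau>\<^sub>2 \<theta>\<^sub>2 b\<^sub>2"
  proof (rule besov_embedding_of_lq_norm)
    fix N :: "nat ^ 'm \<Rightarrow> ennreal"
    have "lq_norm \<theta>\<^sub>2 (\<lambda>s. ennreal (embedding_weight (b\<^sub>2 - b\<^sub>1) ?\<gamma> s) * N s) \<le> lq_norm \<theta>\<^sub>2 (\<lambda>s. ennreal B * N s)"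
      using assms(5) v by (intro lq_norm_mono mult_right_mono) auto
    also have "\<dots> = ennreal B * lq_norm \<theta>\<^sub>2 N"
      using assms(5) B by (intro lq_norm_cmult) auto
    also have "\<dots> \<le> ennreal B * lq_norm \<theta>\<^sub>1 N"
      using assms(4) le by (intro mult_left_mono lq_norm_antimono) auto
    finally show "lq_norm \<theta>\<^sub>2 (\<lambda>s. ennreal (embedding_weight (b\<^sub>2 - b\<^sub>1) ?\<gamma> s) * N s) \<le> ennreal B * lq_norm \<theta>\<^sub>1 N" .
  qed (use assms B in auto)
qed

end
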